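(* Let $\alpha>1/4$ and $1<p\le2$. For $\nu$ with $1-\nu\in(0,\alpha+1)$, let $f\in L_{1-\nu,p}(\mathbb{R}_+)$, let its Mellin transform satisfy $f^*\in L_1(1-\nu-i\infty,1-\nu+i\infty)$, and let $f^*(s)$ be analytic in the open strip $\mathrm{Re}\,s=1-\nu\in(0,\alpha+1)$. If moreover $F_\alpha f\in L_1(\mathbb{R}_+;\tau e^{2\pi\tau}d\tau)$, then for all $x>0$ $$f(x)=-\frac{4}{\pi\sqrt\pi}\int_0^\infty\Big[\alpha\Big[\frac{1}{2x}+\frac{d}{dx}\Big(\mathrm{Re}\left[K_{\alpha+i\tau}(\sqrt x)I_{\alpha-i\tau}(\sqrt x)\right]\Big)-\frac{1}{\sqrt x}\,\mathrm{Re}\left[K_{\alpha+i\tau}(\sqrt x)I'_{\alpha-i\tau}(\sqrt x)\right]\Big]$$ $$+\tau\,\frac{d}{dx}\Big(\mathrm{Im}\left[K_{\alpha+i\tau}(\sqrt x)I_{\alpha-i\tau}(\sqrt x)\right]\Big)\Big]\cosh(\pi\tau)\,(F_\alpha f)(\tau)\,d\tau,$$ where the integral converges absolutely.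
   Context: $\mathbb{R}_+=(0,\infty)$. $K_\mu$ and $I_\mu$ are the modified Bessel functions; $I'_\mu(\sqrt x)$ denotes the derivative of $z\mapsto I_\mu(z)$ evaluated at $z=\sqrt x$. For real $\alpha$ the index transform $F_\alpha$ is $$(F_\alpha f)(\tau)=\frac{2\sqrt\pi}{\cosh(\pi\tau)}\int_0^\infty \mathrm{Re}\left[K_{\alpha+i\tau}(\sqrt x)\,I_{\alpha-i\tau}(\sqrt x)\right]f(x)\,dx,\qquad \tau\in\mathbb{R}.$$ $L_{\nu,p}(\mathbb{R}_+)$ is the space of measurable functions on $\mathbb{R}_+$ with finite norm $\|f\|_{\nu,p}=\left(\int_0^\infty|f(x)|^p x^{\nu p-1}dx\right)^{1/p}$. For $f\in L_{\nu,p}(\mathbb{R}_+)$, $1<p\le2$, the Mellin transform $f^*(s)=\int_0^\infty f(x)x^{s-1}dx$, $\mathrm{Re}\,s=\nu$, is understood as convergent in mean in $L_q(\nu-i\infty,\nu+i\infty)$, $q=p/(p-1)$. $L_1(\mathbb{R}_+;w(\tau)d\tau)$ is the weighted space of functions $h$ with $\int_0^\infty|h(\tau)|w(\tau)d\tau<\infty$. The conditions on $f$ and $f^*$ involving $\nu$ are understood for all $\nu$ with $1-\nu\in(0,\alpha+1)$. *)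

theory Defs
  imports "HOL-Analysis.Analysis"
begin

text \<open>Modified Bessel functions of complex order, on the principal branch.\<close>

definition bessel_I :: "complex \<Rightarrow> complex \<Rightarrow> complex" where
  "bessel_I \<mu> z =
     (z / 2) powr \<mu> * (\<Sum>k. (z\<^sup>2 / 4) ^ k * rGamma (\<mu> + of_nat k + 1) / fact k)"

definition bessel_K_nonint :: "complex \<Rightarrow> complex \<Rightarrow> complex" where
  "bessel_K_nonint \<mu> z =
     of_real pi / 2 * (bessel_I (- \<mu>) z - bessel_I \<mu> z) / sin (of_real pi * \<mu>)"

text \<open>At integer order the quotient is \<open>0 / 0\<close> and the limiting value is taken.\<close>

definition bessel_K :: "complex \<Rightarrow> complex \<Rightarrow> complex" where
  "bessel_K \<mu> z =
     (if \<mu> \<in> \<int> then Lim (at \<mu>) (\<lambda>w. bessel_K_nonint w z) else bessel_K_nonint \<mu> z)"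

definition KI :: "real \<Rightarrow> real \<Rightarrow> real \<Rightarrow> complex" where
  "KI \<alpha> \<tau> x =
     bessel_K (Complex \<alpha> \<tau>) (of_real (sqrt x)) * bessel_I (Complex \<alpha> (- \<tau>)) (of_real (sqrt x))"

text \<open>In \<open>KI'\<close> only the \<open>I\<close> factor is differentiated, with respect to its own argument.\<close>

definition KI' :: "real \<Rightarrow> real \<Rightarrow> real \<Rightarrow> complex" where
  "KI' \<alpha> \<tau> x =
     bessel_K (Complex \<alpha> \<tau>) (of_real (sqrt x)) *
     deriv (bessel_I (Complex \<alpha> (- \<tau>))) (of_real (sqrt x))"

definition index_transform :: "real \<Rightarrow> (real \<Rightarrow> complex) \<Rightarrow> real \<Rightarrow> complex" where
  "index_transform \<alpha> f \<tau> =
     of_real (2 * sqrt pi / cosh (pi * \<tau>)) *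
     (LINT x:{0<..}|lebesgue. of_real (Re (KI \<alpha> \<tau> x)) * f x)"

text \<open>Functions in the spaces below are only relevant on the positive half-line.\<close>

definition mem_L :: "real \<Rightarrow> real \<Rightarrow> (real \<Rightarrow> complex) \<Rightarrow> bool" where
  "mem_L \<nu> p f \<longleftrightarrow>
     set_borel_measurable lebesgue {0<..} f \<and>
     set_integrable lebesgue {0<..} (\<lambda>x. norm (f x) powr p * x powr (\<nu> * p - 1))"

definition mem_weighted_L1 :: "(real \<Rightarrow> real) \<Rightarrow> (real \<Rightarrow> complex) \<Rightarrow> bool" where
  "mem_weighted_L1 w h \<longleftrightarrow>
     set_borel_measurable lebesgue {0<..} h \<and>
     set_integrable lebesgue {0<..} (\<lambda>\<tau>. norm (h \<tau>) * w \<tau>)"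

definition truncated_mellin :: "(real \<Rightarrow> complex) \<Rightarrow> real \<Rightarrow> complex \<Rightarrow> complex" where
  "truncated_mellin f N s = (LINT x:{1/N..N}|lebesgue. f x * of_real x powr (s - 1))"

text \<open>
  \<open>F\<close> is the Mellin transform of \<open>f\<close> on the line \<open>Re s = c\<close>, as a limit in mean in
  \<open>L\<^sub>q\<close> of that line, \<open>q = p / (p - 1)\<close>. The nonnegative integral makes the distance
  infinite, rather than zero, when the difference is not in \<open>L\<^sub>q\<close>.
\<close>

definition is_mellin_transform_on_line ::
    "real \<Rightarrow> (real \<Rightarrow> complex) \<Rightarrow> real \<Rightarrow> (complex \<Rightarrow> complex) \<Rightarrow> bool" where
  "is_mellin_transform_on_line p f c F \<longleftrightarrow>
     (let q = p / (p - 1) in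
       (\<lambda>t. F (Complex c t)) \<in> borel_measurable lebesgue \<and>
       integrable lebesgue (\<lambda>t. norm (F (Complex c t)) powr q) \<and>
       ((\<lambda>N. \<integral>\<^sup>+ t. ennreal (norm (F (Complex c t) - truncated_mellin f N (Complex c t)) powr q)
            \<partial>lebesgue) \<longlongrightarrow> 0) at_top)"

definition inversion_kernel :: "real \<Rightarrow> real \<Rightarrow> real \<Rightarrow> real" where
  "inversion_kernel \<alpha> \<tau> x =
     \<alpha> * (1 / (2 * x) + deriv (\<lambda>y. Re (KI \<alpha> \<tau> y)) x - 1 / sqrt x * Re (KI' \<alpha> \<tau> x))
     + \<tau> * deriv (\<lambda>y. Im (KI \<alpha> \<tau> y)) x"

end

theory Submission
  imports Defs "HOL-Probability.Probability"
begin

text \<open>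
  With $\mu=\alpha+i\tau$ and $\nu=\alpha-i\tau$, the product in the transform is a one-sided Fourier
  transform of a Bessel function of fixed real order,
  \[ K_\mu(\sqrt x)\,I_\nu(\sqrt x) = \int_0^\infty e^{2i\tau t}\,J_{2\alpha}(2\sqrt x\sinh t)\,dt \]
  (\<open>KI_eq_integral_bessel_J\<close>). Hence \<open>cosh (pi * \<tau>) * index_transform \<alpha> f \<tau> / (2 * sqrt pi)\<close> is the cosine
  transform of $h(t)=\int_0^\infty f(x)\,J_{2\alpha}(2\sqrt x\sinh t)\,dx$, the Hankel transform of \<open>f\<close> in the variable
  $\sinh t$, and inverting the index transform amounts to inverting a cosine transform and a Hankel transform.

  The composed inverse kernel is only a divergent integral over \<open>t\<close>, so both inversions are done after
  integration against the functions $x^{\alpha+1}e^{-px}$. These determine a function on the half-line, by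
  uniqueness of the Laplace transform (\<open>laplace_unique\<close>), and their Hankel transforms are explicit, a Gaussian times a
  polynomial and a power in $\sinh t$. Up to constants, the chain is: the kernel tested against $x^{\alpha+1}e^{-px}$ is the cosine transform of
  \<open>gauss_sinh_dual\<close> (\<open>laplace_kernel_core\<close>); cosine inversion (\<open>cosine_inversion\<close>) returns \<open>h\<close>; and the Hankel
  transform of \<open>gauss_sinh_dual\<close> is $x^{\alpha+1}e^{-px}$ (\<open>hankel_gauss_sinh_dual\<close>). Thus \<open>f\<close> and the right-hand
  side have the same Laplace transforms, so they agree almost everywhere (\<open>transform_inversion\<close>). The right-hand
  side is continuous in \<open>x\<close>, so it is the continuous representative of \<open>f\<close>.

  In the inversion kernel the term $\alpha/(2x)$ does not depend on $\tau$. It contributes a multiple of the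
  integral of the cosine transform of \<open>h\<close>, which is $\frac{\pi}{4}h(0)=0$. What remains is the real part of
  \<open>kernel_core\<close>, up to the factor $-1/(2x)$ (\<open>inversion_kernel_eq\<close>).

  All explicit formulas come from one computation. By \<open>macdonald_eq_clifford\<close>, the function $K_\mu$, defined
  through $I_{-\mu}-I_\mu$, equals $\frac12(z/2)^{-\mu}\int_0^\infty e^{-s-z^2/4s}s^{\mu-1}ds$. With the power series of
  $I_\nu$, the Laplace transform of $x^\alpha K_\mu I_\nu$ is then a sum in which the Gamma factors cancel, and the
  substitution $4ps=e^{2t}-1$ turns it into a Fourier integral over \<open>t\<close> (\<open>laplace_KI_combination\<close>).
\<close>

section \<open>Integration over the positive half-line\<close>

text \<open>
  Working in a restricted measure, rather than with indicator functions, lets Fubini's theorem and dominated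
  convergence see the condition \<open>x > 0\<close> through the space of the measure.
\<close>

definition lpos :: "real measure" where
  "lpos = restrict_space lborel {0<..}"

lemma space_lpos [simp]: "space lpos = {0<..}"
  by (simp add: lpos_def space_restrict_space)

lemma measurable_lpos_ident: "(\<lambda>x. x) \<in> lpos \<rightarrow>\<^sub>M borel"
  unfolding lpos_def by (intro measurable_restrict_space1) simp

text \<open>
  Measurability is established for expressions on the whole line, where all building blocks are Borel, and then
  transferred by this rule and its version for products.
\<close>

lemma measurable_lposI: "f \<in> borel_measurable borel \<Longrightarrow> f \<in> borel_measurable lpos"
  unfolding lpos_def by (intro measurable_restrict_space1) simp

lemma sigma_finite_lpos: "sigma_finite_measure lpos"
  unfolding lpos_def by (intro sigma_finite_measure_restrict_space) (auto simp: lborel.sigma_finite_measure_axioms)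

interpretation lpos: sigma_finite_measure lpos by (rule sigma_finite_lpos)
interpretation lpos2: pair_sigma_finite lpos lpos ..

lemma integrable_lpos_iff:
  fixes f :: "real \<Rightarrow> 'a::{banach, second_countable_topology}"
  shows "integrable lpos f \<longleftrightarrow> set_integrable lborel {0<..} f"
  unfolding lpos_def set_integrable_def by (subst integrable_restrict_space) auto

lemma integral_lpos:
  fixes f :: "real \<Rightarrow> 'a::{banach, second_countable_topology}"
  shows "integral\<^sup>L lpos f = set_lebesgue_integral lborel {0<..} f"
  unfolding lpos_def set_lebesgue_integral_def by (subst integral_restrict_space) auto

lemma AE_lpos: "(AE x in lpos. P x) \<longleftrightarrow> (AE x in lborel. x > 0 \<longrightarrow> P x)"
  unfolding lpos_def by (subst AE_restrict_space_iff) auto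

lemma AE_lposI: "(\<And>x. x > 0 \<Longrightarrow> P x) \<Longrightarrow> AE x in lpos. P x"
  by (auto intro!: AE_I2)

lemma integrable_lpos_bound:
  fixes f :: "real \<Rightarrow> 'a::{banach, second_countable_topology}" and g :: "real \<Rightarrow> real"
  assumes "integrable lpos g" "f \<in> borel_measurable lpos"
    and "\<And>x. x > 0 \<Longrightarrow> norm (f x) \<le> g x"
  shows "integrable lpos f"
  using assms by (intro Bochner_Integration.integrable_bound[OF assms(1,2)])
    (auto intro!: AE_lposI order_trans[OF assms(3)])

lemma integral_cong_lpos:
  "(\<And>x. x > 0 \<Longrightarrow> f x = g x) \<Longrightarrow> integral\<^sup>L lpos f = integral\<^sup>L lpos g"
  by (intro Bochner_Integration.integral_cong) auto

lemma integrable_cong_lpos: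
  "(\<And>x. x > 0 \<Longrightarrow> f x = g x) \<Longrightarrow> integrable lpos f \<longleftrightarrow> integrable lpos g"
  by (intro Bochner_Integration.integrable_cong) auto

text \<open>
  Every exchange of integrals below is between two variables whose absolute bound splits into a product, because
  the oscillating factors have modulus at most 1 and the Bessel functions obey separable bounds.
\<close>

lemma (in pair_sigma_finite) Fubini_product_bound:
  fixes g :: "'a \<Rightarrow> 'b \<Rightarrow> 'c::{banach, second_countable_topology}"
  assumes [measurable]: "(\<lambda>(x,y). g x y) \<in> borel_measurable (M1 \<Otimes>\<^sub>M M2)"
    and a: "integrable M1 a" and b: "integrable M2 b"
    and bound: "\<And>x y. x \<in> space M1 \<Longrightarrow> y \<in> space M2 \<Longrightarrow> norm (g x y) \<le> a x * (b y :: real)"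
  shows "integrable M1 (\<lambda>x. \<integral>y. g x y \<partial>M2)"
    and "integrable M2 (\<lambda>y. \<integral>x. g x y \<partial>M1)"
    and "(\<integral>x. (\<integral>y. g x y \<partial>M2) \<partial>M1) = (\<integral>y. (\<integral>x. g x y \<partial>M1) \<partial>M2)"
proof -
  have [measurable]: "a \<in> borel_measurable M1" "b \<in> borel_measurable M2" using a b by auto
  have "integrable (M1 \<Otimes>\<^sub>M M2) (\<lambda>(x,y). a x * b y)"
  proof (rule Fubini_integrable)
    have "(\<lambda>x. \<integral>y. norm (case (x, y) of (x,y) \<Rightarrow> a x * b y) \<partial>M2) = (\<lambda>x. norm (a x) * (\<integral>y. norm (b y) \<partial>M2))"
      by (simp add: abs_mult)
    then show "integrable M1 (\<lambda>x. \<integral>y. norm (case (x, y) of (x,y) \<Rightarrow> a x * b y) \<partial>M2)"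
      using a by simp
  qed (use b in auto)
  then have int: "integrable (M1 \<Otimes>\<^sub>M M2) (\<lambda>(x,y). g x y)"
  proof (rule Bochner_Integration.integrable_bound)
    show "AE z in M1 \<Otimes>\<^sub>M M2. norm (case z of (x,y) \<Rightarrow> g x y) \<le> norm (case z of (x,y) \<Rightarrow> a x * b y)"
      using bound by (auto intro!: AE_I2 order_trans[OF bound] simp: space_pair_measure)
  qed auto
  from integrable_fst'[OF int] show "integrable M1 (\<lambda>x. \<integral>y. g x y \<partial>M2)" by simp
  from int have int': "integrable (M1 \<Otimes>\<^sub>M M2) (case_prod g)" by (simp add: case_prod_unfold)
  show "integrable M2 (\<lambda>y. \<integral>x. g x y \<partial>M1)" using integrable_snd[OF int'] .
  show "(\<integral>x. (\<integral>y. g x y \<partial>M2) \<partial>M1) = (\<integral>y. (\<integral>x. g x y \<partial>M1) \<partial>M2)"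
    using Fubini_integral[OF int'] by simp
qed

lemma lpos_absolutely_integrable:
  fixes f :: "real \<Rightarrow> 'a::euclidean_space"
  assumes "f \<in> borel_measurable lpos"
  shows "integrable lpos f \<longleftrightarrow> f absolutely_integrable_on {0<..}"
proof -
  have "(\<lambda>x. indicator {0<..} x *\<^sub>R f x) \<in> borel_measurable lborel"
    using assms unfolding lpos_def by (subst (asm) borel_measurable_restrict_space_iff) auto
  then show ?thesis
    unfolding integrable_lpos_iff set_integrable_def by (simp add: integrable_completion)
qed

lemma lpos_integral_eq:
  fixes f :: "real \<Rightarrow> 'a::euclidean_space"
  assumes "f \<in> borel_measurable lpos" "integrable lpos f"
  shows "integral\<^sup>L lpos f = integral {0<..} f"
proof -
  have m: "(\<lambda>x. indicator {0<..} x *\<^sub>R f x) \<in> borel_measurable lborel"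
    using assms unfolding lpos_def by (subst (asm) borel_measurable_restrict_space_iff) auto
  have "integral\<^sup>L lpos f = set_lebesgue_integral lebesgue {0<..} f"
    unfolding integral_lpos set_lebesgue_integral_def using m by (simp add: integral_completion)
  also have "\<dots> = integral {0<..} f"
    using assms lpos_absolutely_integrable[OF assms(1)] by (intro set_lebesgue_integral_eq_integral) auto
  finally show ?thesis .
qed

lemma lpos_substitution:
  fixes f :: "real \<Rightarrow> 'a::euclidean_space" and g h :: "real \<Rightarrow> real"
  assumes f [measurable]: "f \<in> borel_measurable borel" and int: "integrable lpos f"
    and [measurable]: "g \<in> borel_measurable borel" "h \<in> borel_measurable borel"
    and d: "\<And>x. x > 0 \<Longrightarrow> (g has_field_derivative h x) (at x)"
    and h: "\<And>x. x > 0 \<Longrightarrow> h x \<ge> 0"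
    and bij: "bij_betw g {0<..} {0<..}"
  shows "integrable lpos (\<lambda>t. h t *\<^sub>R f (g t))"
    and "integral\<^sup>L lpos f = (\<integral>t. h t *\<^sub>R f (g t) \<partial>lpos)"
proof -
  have m: "f \<in> borel_measurable lpos" "(\<lambda>t. h t *\<^sub>R f (g t)) \<in> borel_measurable lpos"
    by (auto intro!: measurable_lposI)
  have inj: "inj_on g {0<..}" and im: "g ` {0<..} = {0<..}"
    using bij by (auto simp: bij_betw_def)
  have *: "(\<lambda>x. \<bar>h x\<bar> *\<^sub>R f (g x)) absolutely_integrable_on {0<..} \<and>
        integral {0<..} (\<lambda>x. \<bar>h x\<bar> *\<^sub>R f (g x)) = integral {0<..} f"
    by (subst has_absolute_integral_change_of_variables_real)
       (use inj im d int m in \<open>auto simp: lpos_absolutely_integrable intro: DERIV_subset\<close>)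
  have eq: "(\<lambda>x. \<bar>h x\<bar> *\<^sub>R f (g x)) absolutely_integrable_on {0<..} \<longleftrightarrow>
            (\<lambda>x. h x *\<^sub>R f (g x)) absolutely_integrable_on {0<..}"
    using h by (intro set_integrable_cong) auto
  show 1: "integrable lpos (\<lambda>t. h t *\<^sub>R f (g t))"
    using * eq m by (subst lpos_absolutely_integrable) auto
  have "integral {0<..} (\<lambda>x. \<bar>h x\<bar> *\<^sub>R f (g x)) = integral {0<..} (\<lambda>x. h x *\<^sub>R f (g x))"
    using h by (intro Henstock_Kurzweil_Integration.integral_cong) auto
  then show "integral\<^sup>L lpos f = (\<integral>t. h t *\<^sub>R f (g t) \<partial>lpos)"
    using * 1 m int by (simp add: lpos_integral_eq)
qed

lemma tendsto_integral_dominated_at: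
  fixes f :: "'b::metric_space \<Rightarrow> 'a \<Rightarrow> 'c::{banach, second_countable_topology}"
  assumes "\<And>y. y \<in> S \<Longrightarrow> f y \<in> borel_measurable M" "l \<in> borel_measurable M"
    and w: "integrable M (w :: 'a \<Rightarrow> real)"
    and lim: "\<And>s. s \<in> space M \<Longrightarrow> ((\<lambda>y. f y s) \<longlongrightarrow> l s) (at x within S)"
    and bound: "\<And>y s. y \<in> S \<Longrightarrow> y \<noteq> x \<Longrightarrow> s \<in> space M \<Longrightarrow> norm (f y s) \<le> w s"
  shows "((\<lambda>y. \<integral>s. f y s \<partial>M) \<longlongrightarrow> (\<integral>s. l s \<partial>M)) (at x within S)"
  unfolding tendsto_at_iff_sequentially comp_def
proof (intro allI impI)
  fix X assume X: "\<forall>i. X i \<in> S - {x}" "X \<longlonglongrightarrow> x"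
  show "(\<lambda>n. \<integral>s. f (X n) s \<partial>M) \<longlonglongrightarrow> (\<integral>s. l s \<partial>M)"
  proof (rule integral_dominated_convergence[OF assms(2) _ w])
    show "AE s in M. (\<lambda>n. f (X n) s) \<longlonglongrightarrow> l s"
      using lim X unfolding tendsto_at_iff_sequentially comp_def by (intro AE_I2) blast
    show "AE s in M. norm (f (X n) s) \<le> w s" for n
      using bound[of "X n"] X by (intro AE_I2) auto
  qed (use assms(1) X in auto)
qed

lemma continuous_on_integral_dominated:
  fixes f :: "'b::metric_space \<Rightarrow> 'a \<Rightarrow> 'c::{banach, second_countable_topology}"
  assumes "\<And>y. y \<in> S \<Longrightarrow> f y \<in> borel_measurable M"
    and "integrable M (w :: 'a \<Rightarrow> real)"
    and "\<And>s. s \<in> space M \<Longrightarrow> continuous_on S (\<lambda>y. f y s)"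
    and "\<And>y s. y \<in> S \<Longrightarrow> s \<in> space M \<Longrightarrow> norm (f y s) \<le> w s"
  shows "continuous_on S (\<lambda>y. \<integral>s. f y s \<partial>M)"
  unfolding continuous_on_def
  by (intro ballI tendsto_integral_dominated_at[where w = w])
     (use assms in \<open>auto simp: continuous_on_def\<close>)

text \<open>
  Under $y=e^{-x}$ the hypothesis says that all moments on the unit interval vanish. By the theorem of Weierstrass
  the integral of \<open>g\<close> against every continuous function of $e^{-x}$ is zero, and piecewise linear functions converge
  to the indicators of rays; so the positive and the negative part of \<open>g\<close> are densities of the same measure.
\<close>

lemma exp_moments_zero_imp_AE_zero:
  fixes g :: "real \<Rightarrow> real"
  assumes int: "integrable lpos g"
    and zero: "\<And>n::nat. (\<integral>x. g x * exp (- x) ^ n \<partial>lpos) = 0"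
  shows "AE x in lpos. g x = 0"
proof -
  note [measurable] = measurable_lpos_ident
  have [measurable]: "g \<in> borel_measurable lpos" using int by auto
  have intb: "integrable lpos (\<lambda>x. g x * \<phi> (exp (-x)))"
    if [measurable]: "(\<lambda>x. \<phi> (exp (-x))) \<in> borel_measurable lpos"
      and "\<And>y. y \<in> {0..1} \<Longrightarrow> \<bar>\<phi> y\<bar> \<le> C" for \<phi> and C :: real
    by (rule integrable_lpos_bound[where g = "\<lambda>x. C * \<bar>g x\<bar>"])
       (use int that(2) in \<open>auto simp: abs_mult mult.commute[of "\<bar>g _\<bar>"] intro!: mult_right_mono\<close>)
  have poly: "(\<integral>x. g x * q (exp (-x)) \<partial>lpos) = 0" if q: "real_polynomial_function q" for q
  proof -
    obtain a n where q: "q = (\<lambda>x. \<Sum>i\<le>n. a i * x ^ i)"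
      using q real_polynomial_function_iff_sum by auto
    have i: "integrable lpos (\<lambda>x. g x * exp (- x) ^ i)" for i
      by (rule intb[where C = 1 and \<phi> = "\<lambda>y. y ^ i"]) (auto intro!: power_le_one)
    have "(\<integral>x. g x * q (exp (-x)) \<partial>lpos) = (\<integral>x. (\<Sum>i\<le>n. a i * (g x * exp (- x) ^ i)) \<partial>lpos)"
      by (simp add: q sum_distrib_left mult_ac)
    also have "\<dots> = 0" using i zero by (subst Bochner_Integration.integral_sum) auto
    finally show ?thesis .
  qed
  have cont: "(\<integral>x. g x * \<phi> (exp (-x)) \<partial>lpos) = 0" if c: "continuous_on {0..1} \<phi>"
    and m [measurable]: "(\<lambda>x. \<phi> (exp (-x))) \<in> borel_measurable lpos" for \<phi>
  proof -
    have "\<bar>\<integral>x. g x * \<phi> (exp (-x)) \<partial>lpos\<bar> \<le> e * (\<integral>x. \<bar>g x\<bar> \<partial>lpos)" if e: "e > 0" for e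
    proof -
      obtain q where q: "real_polynomial_function q" "\<And>y. y \<in> {0..1} \<Longrightarrow> \<bar>\<phi> y - q y\<bar> < e"
        using Stone_Weierstrass_real_polynomial_function[OF compact_Icc c e] by metis
      have qc: "continuous_on UNIV q" using q(1) by (simp add: continuous_on_polymonial_function real_polynomial_function_eq)
      then have [measurable]: "q \<in> borel_measurable borel" by (rule borel_measurable_continuous_onI)
      obtain C1 where C1: "\<And>y. y \<in> {0..1} \<Longrightarrow> \<bar>q y\<bar> \<le> C1"
        using compact_imp_bounded[OF compact_continuous_image[OF continuous_on_subset[OF qc], of "{0..1}"]]
        unfolding bounded_iff by (metis compact_Icc imageI real_norm_def subset_UNIV)
      obtain C2 where C2: "\<And>y. y \<in> {0..1} \<Longrightarrow> \<bar>\<phi> y\<bar> \<le> C2"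
        using compact_imp_bounded[OF compact_continuous_image[OF c]]
        unfolding bounded_iff by (metis compact_Icc imageI real_norm_def)
      have i1: "integrable lpos (\<lambda>x. g x * q (exp (-x)))" by (rule intb[OF _ C1]) auto
      have i2: "integrable lpos (\<lambda>x. g x * \<phi> (exp (-x)))" by (rule intb[OF _ C2]) auto
      have "(\<integral>x. g x * \<phi> (exp (-x)) \<partial>lpos) = (\<integral>x. g x * \<phi> (exp (-x)) - g x * q (exp (-x)) \<partial>lpos)"
        using i1 i2 poly[OF q(1)] by simp
      also have "\<bar>\<dots>\<bar> \<le> (\<integral>x. e * \<bar>g x\<bar> \<partial>lpos)"
      proof (rule integral_abs_bound_integral)
        fix x assume "x \<in> space lpos"
        then have "exp (-x) \<in> {0..1}" by auto
        then have "\<bar>\<phi> (exp (-x)) - q (exp (-x))\<bar> \<le> e" using q(2) less_imp_le by blast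
        then have "\<bar>g x\<bar> * \<bar>\<phi> (exp (-x)) - q (exp (-x))\<bar> \<le> \<bar>g x\<bar> * e" by (rule mult_left_mono) auto
        then show "\<bar>g x * \<phi> (exp (-x)) - g x * q (exp (-x))\<bar> \<le> e * \<bar>g x\<bar>"
          by (simp add: abs_mult[symmetric] right_diff_distrib mult.commute)
      qed (use i1 i2 int in auto)
      finally show ?thesis by simp
    qed
    note bnd = this
    have "\<bar>\<integral>x. g x * \<phi> (exp (-x)) \<partial>lpos\<bar> \<le> 0"
    proof (rule field_le_epsilon)
      fix e :: real assume e: "e > 0"
      define I where "I = (\<integral>x. \<bar>g x\<bar> \<partial>lpos)"
      have I: "I \<ge> 0" by (simp add: I_def)
      have "e / (I + 1) * I \<le> e" using I e by (simp add: field_simps)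
      moreover have "e / (I + 1) > 0" using I e by (intro divide_pos_pos) auto
      note bnd[OF this, folded I_def]
      ultimately show "\<bar>\<integral>x. g x * \<phi> (exp (-x)) \<partial>lpos\<bar> \<le> 0 + e" by linarith
    qed
    then show ?thesis by simp
  qed
  have tail: "(\<integral>x. g x * indicator {a<..} x \<partial>lpos) = 0" if a: "a \<ge> 0" for a
  proof (rule LIMSEQ_unique)
    \<comment> \<open>A ramp of slope \<open>n\<close> in \<open>y = exp (-x)\<close> that increases to the indicator of \<open>x > a\<close>.\<close>
    let ?\<phi> = "\<lambda>n y. max 0 (min 1 (real n * (exp (-a) - y)))"
    show "(\<lambda>n. \<integral>x. g x * ?\<phi> n (exp (-x)) \<partial>lpos) \<longlonglongrightarrow> 0"
      by (subst cont) (auto intro!: continuous_intros)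
    show "(\<lambda>n. \<integral>x. g x * ?\<phi> n (exp (-x)) \<partial>lpos) \<longlonglongrightarrow> (\<integral>x. g x * indicator {a<..} x \<partial>lpos)"
    proof (rule integral_dominated_convergence[where w = "\<lambda>x. \<bar>g x\<bar>"])
      show "AE x in lpos. (\<lambda>n. g x * ?\<phi> n (exp (-x))) \<longlonglongrightarrow> g x * indicator {a<..} x"
      proof (rule AE_I2, intro tendsto_mult tendsto_const)
        fix x :: real
        show "(\<lambda>n. ?\<phi> n (exp (-x))) \<longlonglongrightarrow> indicator {a<..} x"
        proof (cases "x > a")
          case True
          then have d: "exp (-a) - exp (-x) > 0" by simp
          have "eventually (\<lambda>n. ?\<phi> n (exp (-x)) = 1) sequentially"
            using eventually_ge_at_top[of "nat \<lceil>1 / (exp (-a) - exp (-x))\<rceil>"]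
          proof eventually_elim
            case (elim n)
            then have "1 / (exp (-a) - exp (-x)) \<le> real n" by linarith
            then have "1 \<le> real n * (exp (-a) - exp (-x))" using d by (simp add: field_simps)
            then show ?case by simp
          qed
          then show ?thesis using True by (simp add: tendsto_eventually)
        next
          case False
          then have "real n * (exp (-a) - exp (-x)) \<le> 0" for n by (simp add: mult_le_0_iff)
          then have "?\<phi> n (exp (-x)) = 0" for n by (metis max.absorb1 min.coboundedI2)
          then show ?thesis using False by (simp only: indicator_def) auto
        qed
      qed
      show "AE x in lpos. norm (g x * ?\<phi> n (exp (-x))) \<le> \<bar>g x\<bar>" for n
        by (intro AE_I2) (auto simp: abs_mult intro!: mult_left_le)
    qed (use int in auto)
  qed
  define G1 where "G1 x = indicator {0<..} x * max 0 (g x)" for x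
  define G2 where "G2 x = indicator {0<..} x * max 0 (- g x)" for x
  have gm: "(\<lambda>x. indicator {0<..} x * g x) \<in> borel_measurable borel"
    using int unfolding integrable_lpos_iff set_integrable_def by auto
  have G1e: "G1 = (\<lambda>x. max 0 (indicator {0<..} x * g x))" by (auto simp: G1_def indicator_def)
  have G2e: "G2 = (\<lambda>x. max 0 (- (indicator {0<..} x * g x)))" by (auto simp: G2_def indicator_def)
  have i0: "integrable lborel (\<lambda>x. indicator {0<..} x * g x)"
    using int by (simp add: integrable_lpos_iff set_integrable_def)
  have [measurable]: "G1 \<in> borel_measurable borel" "G2 \<in> borel_measurable borel"
    unfolding G1e G2e using gm by measurable
  have i1: "integrable lborel G1" unfolding G1e using i0 by (intro integrable_max) auto
  have i2: "integrable lborel G2" unfolding G2e using i0 by (intro integrable_max) auto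
  have nn: "G1 x \<ge> 0" "G2 x \<ge> 0" for x by (auto simp: G1_def G2_def)
  have em: "emeasure (density lborel G) {a<..} = ennreal (\<integral>x. G x * indicator {a<..} x \<partial>lborel)"
    if [measurable]: "G \<in> borel_measurable borel" and "integrable lborel G" "\<And>x. G x \<ge> 0" for G :: "real \<Rightarrow> real" and a
  proof -
    have "emeasure (density lborel G) {a<..} = (\<integral>\<^sup>+x. ennreal (G x * indicator {a<..} x) \<partial>lborel)"
      by (subst emeasure_density) (auto intro!: nn_integral_cong simp: indicator_def)
    also have "\<dots> = ennreal (\<integral>x. G x * indicator {a<..} x \<partial>lborel)"
      using that by (intro nn_integral_eq_integral integrable_real_mult_indicator) auto
    finally show ?thesis .
  qed
  have tail': "(\<integral>x. G1 x * indicator {a<..} x \<partial>lborel) = (\<integral>x. G2 x * indicator {a<..} x \<partial>lborel)" for a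
  proof -
    have "(\<integral>x. g x * indicator {max 0 a<..} x \<partial>lpos) = 0" by (intro tail) auto
    also have "(\<integral>x. g x * indicator {max 0 a<..} x \<partial>lpos) =
       (\<integral>x. G1 x * indicator {a<..} x - G2 x * indicator {a<..} x \<partial>lborel)"
      unfolding integral_lpos set_lebesgue_integral_def
      by (intro Bochner_Integration.integral_cong) (auto simp: G1_def G2_def indicator_def max_def)
    also have "\<dots> = (\<integral>x. G1 x * indicator {a<..} x \<partial>lborel) - (\<integral>x. G2 x * indicator {a<..} x \<partial>lborel)"
      by (intro Bochner_Integration.integral_diff integrable_real_mult_indicator i1 i2) auto
    finally show ?thesis by simp
  qed
  have "density lborel G1 = density lborel G2"
    by (rule measure_eqI_lessThan) (simp_all add: em nn i1 i2 tail')
  then have "AE x in lborel. ennreal (G1 x) = ennreal (G2 x)"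
    by (intro sigma_finite_measure.density_unique[OF sigma_finite_lborel]) auto
  then have "AE x in lborel. x > 0 \<longrightarrow> g x = 0"
    by eventually_elim (auto simp: nn G1_def G2_def indicator_def max_def split: if_splits)
  then show ?thesis unfolding AE_lpos .
qed

text \<open>
  Only parameters \<open>p \<ge> 1\<close> are used, so that the functions tested may grow like $e^{x/2}$.
\<close>

lemma laplace_unique:
  fixes g :: "real \<Rightarrow> complex"
  assumes int: "\<And>p. p \<ge> 1 \<Longrightarrow> integrable lpos (\<lambda>x. exp (- (p * x)) * g x)"
    and zero: "\<And>p. p \<ge> 1 \<Longrightarrow> (\<integral>x. exp (- (p * x)) * g x \<partial>lpos) = 0"
  shows "AE x in lpos. g x = 0"
proof -
  have e: "exp (- ((1 + real n) * x)) = exp (- x) * exp (- x) ^ n" for n x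
    by (simp add: exp_of_nat_mult[symmetric] exp_add[symmetric] algebra_simps)
  have int': "integrable lpos (\<lambda>x. complex_of_real (exp (- x)) * g x)"
    using int[of 1] by simp
  have zero': "(\<integral>x. (exp (- x) * g x) * complex_of_real (exp (- x) ^ n) \<partial>lpos) = 0" for n
    using zero[of "1 + real n"] unfolding e by (simp add: mult_ac)
  have i: "integrable lpos (\<lambda>x. (exp (- x) * g x) * complex_of_real (exp (- x) ^ n))" for n
    using int[of "1 + real n"] unfolding e by (simp add: mult_ac)
  have "AE x in lpos. Re (exp (- x) * g x) = 0"
  proof (rule exp_moments_zero_imp_AE_zero)
    show "(\<integral>x. Re (exp (- x) * g x) * exp (- x) ^ n \<partial>lpos) = 0" for n
    proof -
      have "(\<integral>x. Re (exp (- x) * g x) * exp (- x) ^ n \<partial>lpos) =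
            (\<integral>x. Re ((exp (- x) * g x) * complex_of_real (exp (- x) ^ n)) \<partial>lpos)" by simp
      also have "\<dots> = 0" by (subst integral_Re[OF i]) (simp only: zero' zero_complex.sel)
      finally show ?thesis .
    qed
  qed (rule integrable_Re[OF int'])
  moreover have "AE x in lpos. Im (exp (- x) * g x) = 0"
  proof (rule exp_moments_zero_imp_AE_zero)
    show "(\<integral>x. Im (exp (- x) * g x) * exp (- x) ^ n \<partial>lpos) = 0" for n
    proof -
      have "(\<integral>x. Im (exp (- x) * g x) * exp (- x) ^ n \<partial>lpos) =
            (\<integral>x. Im ((exp (- x) * g x) * complex_of_real (exp (- x) ^ n)) \<partial>lpos)" by simp
      also have "\<dots> = 0" by (subst integral_Im[OF i]) (simp only: zero' zero_complex.sel)
      finally show ?thesis .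
    qed
  qed (rule integrable_Im[OF int'])
  ultimately show ?thesis by eventually_elim (simp add: complex_eq_iff)
qed

lemma measurable_lpos_lposI:
  assumes "f \<in> borel_measurable (borel \<Otimes>\<^sub>M borel)"
  shows "f \<in> borel_measurable (lpos \<Otimes>\<^sub>M lpos)"
proof -
  have "(\<lambda>z. (fst z, snd z)) \<in> lpos \<Otimes>\<^sub>M lpos \<rightarrow>\<^sub>M borel \<Otimes>\<^sub>M borel"
    by (intro measurable_Pair measurable_compose[OF measurable_fst measurable_lpos_ident]
        measurable_compose[OF measurable_snd measurable_lpos_ident])
  from measurable_compose[OF this assms] show ?thesis by simp
qed

lemma AE_lpos_eq_continuous:
  fixes f g :: "real \<Rightarrow> complex"
  assumes "AE x in lpos. f x = g x" "continuous_on {0<..} f" "continuous_on {0<..} g" "x > 0"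
  shows "f x = g x"
proof (rule ccontr)
  assume ne: "f x \<noteq> g x"
  let ?U = "{y \<in> {0<..}. f y - g y \<in> - {0}}"
  have "open ?U" 
    using continuous_open_preimage[of "{0<..}" "\<lambda>y. f y - g y" "-{0}"] assms(2,3)
    by (auto intro!: continuous_intros simp: vimage_def Int_def)
  moreover have "x \<in> ?U" using ne assms(4) by auto
  ultimately have "\<not> negligible ?U" using open_not_negligible by blast
  moreover have "AE y in lborel. y \<notin> ?U" using assms(1) unfolding AE_lpos by eventually_elim auto
  then have "?U \<in> null_sets lborel" using \<open>open ?U\<close> by (subst AE_iff_null_sets) auto
  then have "negligible ?U" using null_sets_completionI negligible_iff_null_sets by blast
  ultimately show False by blast
qed

section \<open>Complex powers and termwise Laplace transforms\<close>

text \<open>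
  The complex power of a positive real base, written through the real logarithm. Unlike \<^const>\<open>powr\<close> on the complex
  numbers it is evidently jointly measurable and needs no branch.
\<close>

definition cpow :: "real \<Rightarrow> complex \<Rightarrow> complex" where
  "cpow x a = exp (a * of_real (ln x))"

lemma cpow_measurable [measurable]:
  assumes "f \<in> borel_measurable M" "g \<in> borel_measurable M"
  shows "(\<lambda>x. cpow (f x) (g x)) \<in> borel_measurable M"
  unfolding cpow_def
  by (rule borel_measurable_continuous_on[where f = exp]) (use assms in \<open>auto intro: continuous_intros\<close>)

lemma cpow_add: "cpow x (a + b) = cpow x a * cpow x b"
  by (simp add: cpow_def distrib_right exp_add)

lemma cpow_minus: "cpow x (- a) = inverse (cpow x a)"
  by (simp add: cpow_def exp_minus)

lemma cpow_nonzero [simp]: "cpow x a \<noteq> 0"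
  by (simp add: cpow_def)

lemma cpow_0 [simp]: "cpow x 0 = 1"
  by (simp add: cpow_def)

lemma cpow_one_left [simp]: "cpow 1 a = 1"
  by (simp add: cpow_def)

lemma cpow_of_real: "x > 0 \<Longrightarrow> cpow x (of_real r) = of_real (x powr r)"
  by (simp add: cpow_def powr_def flip: of_real_mult exp_of_real)

lemma cpow_1: "x > 0 \<Longrightarrow> cpow x 1 = of_real x"
  using cpow_of_real[of x 1] by simp

lemma cpow_of_nat: "x > 0 \<Longrightarrow> cpow x (of_nat k) = of_real x ^ k"
  using cpow_of_real[of x "real k"] by (simp add: powr_realpow)

lemma cpow_mult: "x > 0 \<Longrightarrow> y > 0 \<Longrightarrow> cpow (x * y) a = cpow x a * cpow y a"
  by (simp add: cpow_def ln_mult distrib_left exp_add)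

lemma cpow_divide: "x > 0 \<Longrightarrow> y > 0 \<Longrightarrow> cpow (x / y) a = cpow x a * cpow y (- a)"
  by (simp add: cpow_def ln_div ring_distribs exp_add[symmetric])

lemma norm_cpow: "x > 0 \<Longrightarrow> norm (cpow x a) = x powr Re a"
  by (simp add: cpow_def powr_def)

lemma cpow_powr: "x > 0 \<Longrightarrow> of_real x powr a = cpow x a"
  by (simp add: cpow_def powr_def Ln_of_real)

lemma has_vector_derivative_cpow:
  assumes "x > 0"
  shows "((\<lambda>x. cpow x a) has_vector_derivative a * cpow x a / of_real x) (at x)"
proof -
  have "((\<lambda>x. a * complex_of_real (ln x)) has_vector_derivative a * of_real (1 / x)) (at x)"
    using assms by (auto intro!: derivative_eq_intros has_vector_derivative_mult_right has_vector_derivative_of_real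
        simp flip: has_real_derivative_iff_has_vector_derivative)
  from field_vector_diff_chain_at[OF this, of exp "exp (a * of_real (ln x))"]
  show ?thesis using assms by (simp add: cpow_def comp_def mult_ac)
qed

lemma continuous_on_cpow [continuous_intros]:
  assumes "continuous_on S f" "\<And>x. x \<in> S \<Longrightarrow> f x > 0" "continuous_on S g"
  shows "continuous_on S (\<lambda>x. cpow (f x) (g x))"
  unfolding cpow_def using assms by (intro continuous_intros) (auto simp: less_imp_neq[symmetric])

lemma bij_betw_scale_pos: "B > 0 \<Longrightarrow> bij_betw (\<lambda>x. B * x) {0<..} {0::real<..}"
  by (rule bij_betwI[where g = "\<lambda>x. x / B"]) auto

lemma Gamma_laplace:
  assumes a: "Re a > 0" and B: "B > 0"
  shows "integrable lpos (\<lambda>x. of_real (exp (- (B * x))) * cpow x (a - 1))"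
    and "(\<integral>x. of_real (exp (- (B * x))) * cpow x (a - 1) \<partial>lpos) = Gamma a * cpow B (- a)"
proof -
  let ?f = "\<lambda>x. complex_of_real (exp (- x)) * cpow x (a - 1)"
  have [measurable]: "?f \<in> borel_measurable borel" by measurable
  have m: "?f \<in> borel_measurable lpos" by (rule measurable_lposI) measurable
  have e: "?f t = of_real t powr (a - 1) / of_real (exp t)" if "t > 0" for t
    using that by (simp add: cpow_powr exp_minus field_simps)
  have abs: "?f absolutely_integrable_on {0<..}"
    using absolutely_integrable_Gamma_integral'[OF a]
    by (subst set_integrable_cong[OF refl refl e]) auto
  then have i: "integrable lpos ?f" using m by (simp add: lpos_absolutely_integrable)
  have "integral\<^sup>L lpos ?f = integral {0<..} ?f" by (rule lpos_integral_eq[OF m i])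
  also have "\<dots> = integral {0<..} (\<lambda>t. of_real t powr (a - 1) / of_real (exp t))"
    by (intro Henstock_Kurzweil_Integration.integral_cong e) auto
  also have "\<dots> = Gamma a" using Gamma_integral_complex'[OF a] by (rule integral_unique)
  finally have v: "integral\<^sup>L lpos ?f = Gamma a" .
  have s: "(B * x) > 0 \<Longrightarrow> x > 0 \<Longrightarrow> B *\<^sub>R (?f (B * x)) = cpow B a * (of_real (exp (- (B * x))) * cpow x (a - 1))" for x
    using B cpow_add[of B "a - 1" 1] by (simp add: cpow_mult cpow_1 scaleR_conv_of_real mult_ac)
  note sub = lpos_substitution[where g = "\<lambda>x. B * x" and h = "\<lambda>_. B", OF _ i _ _ _ _ bij_betw_scale_pos[OF B]]
  have "integrable lpos (\<lambda>t. B *\<^sub>R ?f (B * t))"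
    by (rule sub(1)) (use B in \<open>auto intro!: derivative_eq_intros\<close>)
  then have i2: "integrable lpos (\<lambda>x. cpow B a * (of_real (exp (- (B * x))) * cpow x (a - 1)))"
    using B by (subst (asm) integrable_cong_lpos[OF s]) auto
  show "integrable lpos (\<lambda>x. of_real (exp (- (B * x))) * cpow x (a - 1))"
    using integrable_mult_right[where c = "inverse (cpow B a)", OF i2] by (simp flip: mult.assoc)
  have "integral\<^sup>L lpos ?f = (\<integral>t. B *\<^sub>R ?f (B * t) \<partial>lpos)"
    by (rule sub(2)) (use B in \<open>auto intro!: derivative_eq_intros\<close>)
  also have "\<dots> = (\<integral>x. cpow B a * (of_real (exp (- (B * x))) * cpow x (a - 1)) \<partial>lpos)"
    using B by (intro integral_cong_lpos s) auto
  also have "\<dots> = cpow B a * (\<integral>x. of_real (exp (- (B * x))) * cpow x (a - 1) \<partial>lpos)" by simp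
  finally show "(\<integral>x. of_real (exp (- (B * x))) * cpow x (a - 1) \<partial>lpos) = Gamma a * cpow B (- a)"
    using v by (simp add: cpow_minus field_simps)
qed

lemma Gamma_laplace_real:
  assumes a: "a > 0" and B: "B > 0"
  shows "integrable lpos (\<lambda>x. exp (- (B * x)) * x powr (a - 1))"
    and "(\<integral>x. exp (- (B * x)) * x powr (a - 1) \<partial>lpos) = Gamma a * B powr (- a)"
proof -
  have e: "complex_of_real (exp (- (B * x))) * cpow x (complex_of_real a - 1) =
           complex_of_real (exp (- (B * x)) * x powr (a - 1))" if "x > 0" for x
    using cpow_of_real[OF that, of "a - 1"] by simp
  note G = Gamma_laplace[of "complex_of_real a" B, simplified, OF a B]
  have i: "integrable lpos (\<lambda>x. complex_of_real (exp (- (B * x)) * x powr (a - 1)))"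
    using G(1) by (subst (asm) integrable_cong_lpos[OF e]) auto
  then show "integrable lpos (\<lambda>x. exp (- (B * x)) * x powr (a - 1))"
    by (simp only: complex_of_real_integrable_eq)
  have "complex_of_real (\<integral>x. exp (- (B * x)) * x powr (a - 1) \<partial>lpos) =
    (\<integral>x. complex_of_real (exp (- (B * x)) * x powr (a - 1)) \<partial>lpos)"
    by (rule integral_complex_of_real[symmetric])
  also have "\<dots> = (\<integral>x. complex_of_real (exp (- (B * x))) * cpow x (complex_of_real a - 1) \<partial>lpos)"
    by (rule integral_cong_lpos) (rule e[symmetric])
  also have "\<dots> = Gamma (complex_of_real a) * cpow B (- complex_of_real a)" by (rule G(2))
  also have "\<dots> = complex_of_real (Gamma a * B powr (- a))"
    using cpow_of_real[OF B, of "- a"] by (simp add: Gamma_complex_of_real)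
  finally show "(\<integral>x. exp (- (B * x)) * x powr (a - 1) \<partial>lpos) = Gamma a * B powr (- a)"
    by (simp only: of_real_eq_iff)
qed

text \<open>
  The ratio test in the form of a global bound; it replaces Stirling's formula in the two growth estimates that follow.
\<close>

lemma le_const_mult_of_ratio_le:
  fixes u v :: "nat \<Rightarrow> real"
  assumes v: "\<And>k. v k > 0" and r: "\<And>k. k \<ge> K \<Longrightarrow> u (Suc k) * v k \<le> u k * v (Suc k)"
    and u: "\<And>k. u k \<ge> 0"
  shows "\<exists>C\<ge>0. \<forall>k. u k \<le> C * v k"
proof -
  define C where "C = (\<Sum>j\<le>K. u j / v j)"
  have nn: "u j / v j \<ge> 0" for j using u[of j] v[of j] by simp
  have small: "u k \<le> C * v k" if "k \<le> K" for k
  proof -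
    have "u k / v k \<le> C" unfolding C_def by (rule member_le_sum) (use that nn in auto)
    then show ?thesis using v[of k] by (simp add: field_simps)
  qed
  have "u k \<le> C * v k" if "k \<ge> K" for k
    using that
  proof (induction rule: dec_induct)
    case (step k)
    have "u (Suc k) * v k \<le> C * v k * v (Suc k)"
      using r[OF step(1)] mult_right_mono[OF step(3), of "v (Suc k)"] v[of "Suc k"] by linarith
    then show ?case using v[of k] by (simp add: mult_ac)
  qed (use small in auto)
  with small have "\<forall>k. u k \<le> C * v k" using linear by blast
  moreover have "C \<ge> 0" unfolding C_def by (intro sum_nonneg nn)
  ultimately show ?thesis by blast
qed

lemma Gamma_add_nat_le:
  fixes a :: real
  assumes "a > 0"
  shows "\<exists>C\<ge>0. \<forall>k. Gamma (a + real k) \<le> C * (2 ^ k * fact k)"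
proof (rule le_const_mult_of_ratio_le[where K = "nat \<lceil>a\<rceil>"])
  fix k assume "k \<ge> nat \<lceil>a\<rceil>"
  then have k: "a \<le> real k" by linarith
  have "Gamma (a + real k + 1) = (a + real k) * Gamma (a + real k)"
    using assms by (intro Gamma_plus1) (auto simp: nonpos_Ints_def)
  moreover have "(a + real k) * Gamma (a + real k) \<le> (2 * real (Suc k)) * Gamma (a + real k)"
    using k assms by (intro mult_right_mono) (auto intro!: less_imp_le[OF Gamma_real_pos])
  moreover have "a + real (Suc k) = a + real k + 1" by simp
  ultimately have "Gamma (a + real (Suc k)) \<le> 2 * real (Suc k) * Gamma (a + real k)" by metis
  then have "Gamma (a + real (Suc k)) * (2 ^ k * fact k) \<le> (2 * real (Suc k) * Gamma (a + real k)) * (2 ^ k * fact k)"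
    by (rule mult_right_mono) auto
  also have "\<dots> = Gamma (a + real k) * (2 ^ Suc k * fact (Suc k))"
    by (simp add: fact_Suc mult_ac del: of_nat_Suc)
  finally show "Gamma (a + real (Suc k)) * (2 ^ k * fact k) \<le> Gamma (a + real k) * (2 ^ Suc k * fact (Suc k))" .
qed (use assms in \<open>auto intro!: less_imp_le[OF Gamma_real_pos]\<close>)

lemma norm_rGamma_add_nat_le:
  fixes \<mu> :: complex
  shows "\<exists>C\<ge>0. \<forall>k. norm (rGamma (\<mu> + of_nat k + 1)) \<le> C * (2 ^ k / fact k)"
proof (rule le_const_mult_of_ratio_le[where K = "nat \<lceil>2 * norm \<mu>\<rceil>"])
  fix k assume "k \<ge> nat \<lceil>2 * norm \<mu>\<rceil>"
  then have k: "2 * norm \<mu> \<le> real k" by linarith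
  let ?z = "\<mu> + of_nat k + 1"
  have "norm (of_nat k + 1 :: complex) = real k + 1"
    by (metis norm_of_nat of_nat_Suc add.commute)
  then have "real k + 1 \<le> norm ?z + norm \<mu>"
    using norm_triangle_ineq4[of ?z \<mu>] by simp
  then have z: "norm ?z \<ge> (real k + 1) / 2" using k by simp
  have "norm (rGamma ?z) = norm ?z * norm (rGamma (?z + 1))"
    using rGamma_plus1[of ?z] by (metis norm_mult)
  then have "norm (rGamma ?z) \<ge> (real k + 1) / 2 * norm (rGamma (?z + 1))"
    using mult_right_mono[OF z] by simp
  moreover have "?z + 1 = \<mu> + of_nat (Suc k) + 1" by simp
  ultimately have "norm (rGamma (\<mu> + of_nat (Suc k) + 1)) * (real k + 1) \<le> 2 * norm (rGamma ?z)" by (simp add: field_simps)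
  then have "norm (rGamma (\<mu> + of_nat (Suc k) + 1)) * (real k + 1) * (2 ^ k / fact (Suc k)) \<le> 2 * norm (rGamma ?z) * (2 ^ k / fact (Suc k))"
    by (intro mult_right_mono) auto
  moreover have "(real k + 1) * (2 ^ k / fact (Suc k)) = 2 ^ k / fact k" by (simp add: fact_Suc add.commute)
  ultimately show "norm (rGamma (\<mu> + of_nat (Suc k) + 1)) * (2 ^ k / fact k) \<le>
     norm (rGamma ?z) * (2 ^ Suc k / fact (Suc k))" by (simp only: mult.assoc power_Suc) (simp add: mult_ac)
qed auto

lemma exp_series_summable: "summable (\<lambda>k. C * (r ^ k / fact k))" for r C :: real
  using summable_mult[OF summable_exp[of r], of C] by (simp add: field_simps)

text \<open>
  The square of the factorial is what remains of the coefficients of a Bessel series; one factorial is spent on the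
  growth of $\Gamma(a+k)$, the other makes the resulting series converge for every \<open>B > 0\<close>.
\<close>

lemma laplace_power_series:
  fixes c :: "nat \<Rightarrow> complex"
  assumes a: "Re a > 0" and B: "B > 0"
    and c: "\<And>k. norm (c k) \<le> C * (r ^ k / (fact k * fact k))" and r: "r \<ge> 0" and C: "C \<ge> 0"
  shows "integrable lpos (\<lambda>x. of_real (exp (- (B * x))) * cpow x (a - 1) * (\<Sum>k. c k * of_real x ^ k))"
    and "(\<lambda>k. c k * Gamma (a + of_nat k) * cpow B (- (a + of_nat k))) sums
         (\<integral>x. of_real (exp (- (B * x))) * cpow x (a - 1) * (\<Sum>k. c k * of_real x ^ k) \<partial>lpos)"
proof -
  let ?f = "\<lambda>k x. c k * (of_real (exp (- (B * x))) * cpow x (a + of_nat k - 1))"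
  obtain D where D: "D \<ge> 0" "\<And>k. Gamma (Re a + real k) \<le> D * (2 ^ k * fact k)"
    using Gamma_add_nat_le[OF a] by blast
  have ak: "Re (a + of_nat k) > 0" for k using a by simp
  note Gk = Gamma_laplace[OF ak B]
  have i: "integrable lpos (?f k)" for k using Gk(1)[of k] by simp
  have nf: "norm (?f k x) = norm (c k) * (exp (- (B * x)) * x powr (Re a + real k - 1))" if "x > 0" for k x
    using that by (simp add: norm_mult norm_cpow)
  have I: "(\<integral>x. norm (?f k x) \<partial>lpos) = norm (c k) * (Gamma (Re a + real k) * B powr (- (Re a + real k)))" for k
  proof -
    have "(\<integral>x. norm (?f k x) \<partial>lpos) = (\<integral>x. norm (c k) * (exp (- (B * x)) * x powr (Re a + real k - 1)) \<partial>lpos)"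
      by (rule integral_cong_lpos) (rule nf)
    also have "\<dots> = norm (c k) * (Gamma (Re a + real k) * B powr (- (Re a + real k)))"
      using a B by (simp add: Gamma_laplace_real(2))
    finally show ?thesis .
  qed
  have sI: "summable (\<lambda>k. \<integral>x. norm (?f k x) \<partial>lpos)"
  proof (rule summable_comparison_test'[where N = 0])
    show "summable (\<lambda>k. (C * D * B powr (- Re a)) * ((2 * r / B) ^ k / fact k))" by (rule exp_series_summable)
    fix k :: nat
    have "norm (\<integral>x. norm (?f k x) \<partial>lpos) = norm (c k) * (Gamma (Re a + real k) * B powr (- (Re a + real k)))"
      unfolding I using a by (simp add: abs_mult less_imp_le[OF Gamma_real_pos])
    also have "\<dots> \<le> (C * (r ^ k / (fact k * fact k))) * ((D * (2 ^ k * fact k)) * B powr (- (Re a + real k)))"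
      using C r by (intro mult_mono c D(2)) (auto intro!: less_imp_le[OF Gamma_real_pos] mult_nonneg_nonneg simp: a add_pos_nonneg D(1))
    also have "B powr (- (Re a + real k)) = B powr (- Re a) / B ^ k"
      using B by (simp add: powr_add powr_minus powr_realpow field_simps powr_diff)
    also have "(C * (r ^ k / (fact k * fact k))) * ((D * (2 ^ k * fact k)) * (B powr (- Re a) / B ^ k))
       = (C * D * B powr (- Re a)) * ((2 * r / B) ^ k / fact k)"
      using B by (simp add: field_simps power_mult_distrib)
    finally show "norm (\<integral>x. norm (?f k x) \<partial>lpos) \<le> \<dots>" .
  qed
  have sc: "summable (\<lambda>k. norm (c k * of_real x ^ k))" for x :: real
  proof (rule summable_comparison_test'[where N = 0])
    show "summable (\<lambda>k. C * ((r * \<bar>x\<bar>) ^ k / fact k))" by (rule exp_series_summable)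
    fix k :: nat
    have "1 / (fact k * fact k) \<le> 1 / (fact k :: real)"
      by (intro divide_left_mono) (auto simp: fact_ge_1 mult_le_cancel_left1)
    then have "C * r ^ k * (1 / (fact k * fact k)) \<le> C * r ^ k * (1 / fact k)"
      using C r by (intro mult_left_mono) auto
    then have ck: "norm (c k) \<le> C * (r ^ k / fact k)" using c[of k] by simp
    have "norm (c k) * \<bar>x\<bar> ^ k \<le> C * (r ^ k / fact k) * \<bar>x\<bar> ^ k"
      using ck by (intro mult_right_mono) auto
    then show "norm (norm (c k * of_real x ^ k)) \<le> C * ((r * \<bar>x\<bar>) ^ k / fact k)"
      by (simp add: norm_mult norm_power power_mult_distrib mult_ac)
  qed
  have feq: "?f k x = (of_real (exp (- (B * x))) * cpow x (a - 1)) * (c k * of_real x ^ k)" if "x > 0" for k x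
    using that cpow_add[of x "a - 1" "of_nat k"] by (simp add: cpow_of_nat add_ac add_diff_eq mult_ac)
  have AE: "AE x in lpos. summable (\<lambda>k. norm (?f k x))"
  proof (rule AE_lposI)
    fix x :: real assume x: "x > 0"
    show "summable (\<lambda>k. norm (?f k x))"
      unfolding feq[OF x] norm_mult[of "_ * cpow _ _"] by (intro summable_mult sc)
  qed
  have eq: "(\<Sum>k. ?f k x) = of_real (exp (- (B * x))) * cpow x (a - 1) * (\<Sum>k. c k * of_real x ^ k)" if x: "x > 0" for x
    unfolding feq[OF x] by (rule suminf_mult) (rule summable_norm_cancel[OF sc])
  have "integrable lpos (\<lambda>x. \<Sum>k. ?f k x)" by (rule integrable_suminf[OF i AE sI])
  then show "integrable lpos (\<lambda>x. of_real (exp (- (B * x))) * cpow x (a - 1) * (\<Sum>k. c k * of_real x ^ k))"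
    by (subst (asm) integrable_cong_lpos[OF eq])
  have "(\<lambda>k. integral\<^sup>L lpos (?f k)) sums (\<integral>x. (\<Sum>k. ?f k x) \<partial>lpos)" by (rule sums_integral[OF i AE sI])
  moreover have "(\<integral>x. (\<Sum>k. ?f k x) \<partial>lpos) = (\<integral>x. of_real (exp (- (B * x))) * cpow x (a - 1) * (\<Sum>k. c k * of_real x ^ k) \<partial>lpos)"
    by (rule integral_cong_lpos) (rule eq)
  moreover have "integral\<^sup>L lpos (?f k) = c k * Gamma (a + of_nat k) * cpow B (- (a + of_nat k))" for k
    using Gk(2)[of k] by (simp only: integral_mult_right_zero mult.assoc)
  ultimately show "(\<lambda>k. c k * Gamma (a + of_nat k) * cpow B (- (a + of_nat k))) sums
         (\<integral>x. of_real (exp (- (B * x))) * cpow x (a - 1) * (\<Sum>k. c k * of_real x ^ k) \<partial>lpos)" by (simp only:)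
qed

text \<open>
  The Bessel--Clifford function: the entire part of the modified Bessel function, with
  $I_\mu(z)=(z/2)^\mu$ \<open>clifford\<close> $\mu\,(z^2/4)$. With a negative argument it gives $J_\mu$ in the same way.
\<close>

definition clifford :: "complex \<Rightarrow> complex \<Rightarrow> complex" where
  "clifford \<mu> z = (\<Sum>k. z ^ k * rGamma (\<mu> + of_nat k + 1) / fact k)"

lemma clifford_coeff_bound:
  "\<exists>C\<ge>0. \<forall>k. norm (rGamma (\<mu> + of_nat k + 1 :: complex) / fact k) \<le> C * (2 ^ k / (fact k * fact k))"
proof -
  obtain C where C: "C \<ge> 0" "\<forall>k. norm (rGamma (\<mu> + of_nat k + 1)) \<le> C * (2 ^ k / fact k)"
    using norm_rGamma_add_nat_le[of \<mu>] by (elim exE conjE)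
  note C = C(1) C(2)[rule_format]
  have "norm (rGamma (\<mu> + of_nat k + 1) / fact k) \<le> C * (2 ^ k / (fact k * fact k))" for k
    using divide_right_mono[OF C(2)[of k], of "fact k"] by (simp add: norm_divide)
  then show ?thesis by (intro exI[of _ C] conjI C(1) allI)
qed

lemma clifford_summable: "summable (\<lambda>k. norm (z ^ k * rGamma (\<mu> + of_nat k + 1 :: complex) / fact k))"
proof -
  obtain C where C: "C \<ge> 0" "\<forall>k. norm (rGamma (\<mu> + of_nat k + 1)) \<le> C * (2 ^ k / fact k)"
    using norm_rGamma_add_nat_le[of \<mu>] by (elim exE conjE)
  note C = C(1) C(2)[rule_format]
  show ?thesis
  proof (rule summable_comparison_test'[where N = 0])
    show "summable (\<lambda>k. C * ((2 * norm z) ^ k / fact k))" by (rule exp_series_summable)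
    fix k :: nat
    have "norm z ^ k * norm (rGamma (\<mu> + of_nat k + 1)) / fact k \<le> norm z ^ k * norm (rGamma (\<mu> + of_nat k + 1)) / 1"
      by (intro divide_left_mono) (auto simp: fact_ge_1)
    also have "\<dots> \<le> norm z ^ k * (C * (2 ^ k / fact k))" using mult_left_mono[OF C(2)[of k], of "norm z ^ k"] by simp
    finally show "norm (norm (z ^ k * rGamma (\<mu> + of_nat k + 1) / fact k)) \<le> C * ((2 * norm z) ^ k / fact k)"
      by (simp add: norm_mult norm_divide norm_power power_mult_distrib mult_ac)
  qed
qed

lemma clifford_sums: "(\<lambda>k. z ^ k * rGamma (\<mu> + of_nat k + 1) / fact k) sums clifford \<mu> z"
  unfolding clifford_def by (intro summable_sums summable_norm_cancel[OF clifford_summable])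

lemma clifford_alt: "clifford \<mu> z = (\<Sum>k. (rGamma (\<mu> + of_nat k + 1) / fact k) * z ^ k)"
  by (simp add: clifford_def mult.commute)

lemma DERIV_clifford [derivative_intros]:
  assumes "(f has_field_derivative f') (at z within A)"
  shows "((\<lambda>z. clifford \<mu> (f z)) has_field_derivative f' * clifford (\<mu> + 1) (f z)) (at z within A)"
proof -
  let ?c = "\<lambda>k. rGamma (\<mu> + of_nat k + 1) / fact k :: complex"
  have d: "diffs ?c n = rGamma (\<mu> + 1 + of_nat n + 1) / fact n" for n
    by (simp add: diffs_def fact_Suc del: of_nat_Suc) (simp add: add_ac)
  have "((\<lambda>z. \<Sum>k. ?c k * z ^ k) has_field_derivative (\<Sum>k. diffs ?c k * w ^ k)) (at w)" for w
    by (rule termdiffs_strong_converges_everywhere)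
       (use summable_norm_cancel[OF clifford_summable] in \<open>simp add: mult.commute\<close>)
  then have "(clifford \<mu> has_field_derivative clifford (\<mu> + 1) w) (at w)" for w
    unfolding d clifford_alt[abs_def] .
  from DERIV_chain2[OF this assms] show ?thesis by (simp add: mult.commute)
qed

lemma continuous_on_clifford [continuous_intros]:
  assumes "continuous_on A f"
  shows "continuous_on A (\<lambda>x. clifford \<mu> (f x))"
proof -
  have "continuous_on UNIV (clifford \<mu>)"
    by (rule DERIV_continuous_on) (rule DERIV_clifford[OF DERIV_ident])
  from continuous_on_compose2[OF this assms] show ?thesis by auto
qed

lemma clifford_rec: "clifford \<mu> z = (\<mu> + 1) * clifford (\<mu> + 1) z + z * clifford (\<mu> + 2) z"
proof -
  let ?t = "\<lambda>k. z ^ k * rGamma (\<mu> + 1 + of_nat k + 1) / fact k"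
  have "(\<lambda>k. z * (z ^ k * rGamma (\<mu> + 2 + of_nat k + 1) / fact k)) sums (z * clifford (\<mu> + 2) z)"
    by (intro sums_mult clifford_sums)
  then have "(\<lambda>k. of_nat (Suc k) * ?t (Suc k)) sums (z * clifford (\<mu> + 2) z)"
    by (rule sums_cong[THEN iffD1, rotated]) (simp add: field_simps del: of_nat_Suc, simp add: add_ac)
  then have "(\<lambda>k. of_nat k * ?t k) sums (z * clifford (\<mu> + 2) z)"
    by (subst (asm) sums_Suc_iff) simp
  from sums_add[OF sums_mult[OF clifford_sums[of z "\<mu> + 1"], of "\<mu> + 1"] this]
  have "(\<lambda>k. (\<mu> + 1 + of_nat k) * ?t k) sums ((\<mu> + 1) * clifford (\<mu> + 1) z + z * clifford (\<mu> + 2) z)"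
    by (simp only: distrib_right)
  moreover have "(\<mu> + 1 + of_nat k) * ?t k = z ^ k * rGamma (\<mu> + of_nat k + 1) / fact k" for k
    using rGamma_plus1[of "\<mu> + of_nat k + 1"] by (simp add: field_simps)
  ultimately have "(\<lambda>k. z ^ k * rGamma (\<mu> + of_nat k + 1) / fact k) sums ((\<mu> + 1) * clifford (\<mu> + 1) z + z * clifford (\<mu> + 2) z)"
    by (simp only:)
  from sums_unique2[OF clifford_sums this] show ?thesis .
qed

text \<open>
  Each step divides by $\mu+k+1$, which has real part at least 1.
\<close>

lemma norm_rGamma_add_nat_antimono:
  assumes "Re \<mu> > 0"
  shows "norm (rGamma (\<mu> + of_nat k + 1)) \<le> norm (rGamma (\<mu> + 1))"
proof (induction k)
  case (Suc k)
  let ?z = "\<mu> + of_nat k + 1"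
  have "1 \<le> Re ?z" using assms by simp
  then have "1 \<le> norm ?z" using complex_Re_le_cmod order_trans by blast
  then have "norm (rGamma (?z + 1)) \<le> norm ?z * norm (rGamma (?z + 1))"
    by (simp add: mult_le_cancel_right1)
  also have "\<dots> = norm (rGamma ?z)" using rGamma_plus1[of ?z] by (metis norm_mult)
  finally show ?case using Suc by (simp add: add_ac)
qed simp

lemma norm_clifford_le:
  assumes "Re \<mu> > 0" 
  shows "norm (clifford \<mu> z) \<le> norm (rGamma (\<mu> + 1)) * exp (norm z)"
    and "norm (clifford (\<mu> + 1) z) \<le> norm (rGamma (\<mu> + 1)) * exp (norm z)"
proof -
  have *: "norm (\<Sum>k. z ^ k * g k / fact k) \<le> A * exp (norm z)"
    if g: "\<And>k. norm (g k) \<le> A" for g :: "nat \<Rightarrow> complex" and A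
  proof -
    have s: "(\<lambda>k. A * (norm z ^ k / fact k)) sums (A * exp (norm z))"
      using sums_mult[OF exp_converges[of "norm z"], of A] by (simp add: field_simps)
    have le: "norm (z ^ k * g k / fact k) \<le> A * (norm z ^ k / fact k)" for k
      using mult_right_mono[OF g[of k], of "norm z ^ k / fact k"] by (simp add: norm_mult norm_divide norm_power mult_ac)
    have "norm (\<Sum>k. z ^ k * g k / fact k) \<le> (\<Sum>k. A * (norm z ^ k / fact k))"
      by (rule norm_suminf_le[OF le sums_summable[OF s]])
    then show ?thesis using sums_unique[OF s] by simp
  qed
  show "norm (clifford \<mu> z) \<le> norm (rGamma (\<mu> + 1)) * exp (norm z)"
    unfolding clifford_def by (rule *) (rule norm_rGamma_add_nat_antimono[OF assms])
  show "norm (clifford (\<mu> + 1) z) \<le> norm (rGamma (\<mu> + 1)) * exp (norm z)"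
    unfolding clifford_def by (rule *) (use norm_rGamma_add_nat_antimono[OF assms, of "Suc _"] in \<open>simp add: add_ac\<close>)
qed

lemma laplace_clifford_sums:
  assumes a: "Re a > 0" and B: "B > 0"
  shows "integrable lpos (\<lambda>x. of_real (exp (- (B * x))) * cpow x (a - 1) * clifford \<mu> (\<beta> * of_real x))"
    and "(\<lambda>k. \<beta> ^ k * rGamma (\<mu> + of_nat k + 1) / fact k * Gamma (a + of_nat k) * cpow B (- (a + of_nat k))) sums
      (\<integral>x. of_real (exp (- (B * x))) * cpow x (a - 1) * clifford \<mu> (\<beta> * of_real x) \<partial>lpos)"
proof -
  obtain C where C: "C \<ge> 0" "\<forall>k. norm (rGamma (\<mu> + of_nat k + 1) / fact k) \<le> C * (2 ^ k / (fact k * fact k))"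
    using clifford_coeff_bound[of \<mu>] by (elim exE conjE)
  note C = C(1) C(2)[rule_format]
  let ?c = "\<lambda>k. \<beta> ^ k * rGamma (\<mu> + of_nat k + 1) / fact k"
  have c: "norm (?c k) \<le> C * ((norm \<beta> * 2) ^ k / (fact k * fact k))" for k
    using mult_left_mono[OF C(2)[of k], of "norm \<beta> ^ k"]
    by (simp add: norm_mult norm_power norm_divide power_mult_distrib mult_ac)
  have e: "(\<Sum>k. ?c k * of_real x ^ k) = clifford \<mu> (\<beta> * of_real x)" for x :: real
    by (simp add: clifford_def power_mult_distrib mult_ac)
  note L = laplace_power_series[OF a B c _ C(1), unfolded e]
  show "integrable lpos (\<lambda>x. of_real (exp (- (B * x))) * cpow x (a - 1) * clifford \<mu> (\<beta> * of_real x))"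
    by (rule L) simp
  show "(\<lambda>k. \<beta> ^ k * rGamma (\<mu> + of_nat k + 1) / fact k * Gamma (a + of_nat k) * cpow B (- (a + of_nat k))) sums
      (\<integral>x. of_real (exp (- (B * x))) * cpow x (a - 1) * clifford \<mu> (\<beta> * of_real x) \<partial>lpos)"
    by (rule L) simp
qed

lemma exp_complex_sums: "(\<lambda>k. w ^ k / fact k) sums exp (w :: complex)"
  using exp_converges[of w] by (simp add: scaleR_conv_of_real field_simps)

lemma k_exp_complex_sums: "(\<lambda>k. of_nat k * (w ^ k / fact k)) sums (w * exp (w :: complex))"
proof -
  have "(\<lambda>k. of_nat (Suc k) * (w ^ Suc k / fact (Suc k))) sums (w * exp w)"
    using sums_mult[OF exp_complex_sums[of w], of w]
    by (rule sums_cong[THEN iffD1, rotated]) (simp add: field_simps del: of_nat_Suc)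
  then show ?thesis by (subst (asm) sums_Suc_iff) simp
qed

lemma rGamma_mult_Gamma: "Re z > 0 \<Longrightarrow> rGamma z * Gamma z = (1 :: complex)"
  unfolding rGamma_inverse_Gamma
  by (rule left_inverse) (auto simp: Gamma_eq_zero_iff elim!: nonpos_Ints_cases)

lemma cpow_minus_add_nat: "B > 0 \<Longrightarrow> cpow B (- (a + of_nat k)) = cpow B (- a) * (1 / of_real B) ^ k"
  using cpow_add[of B "- a" "- of_nat k"] by (simp add: cpow_minus cpow_of_nat power_divide inverse_eq_divide)

text \<open>
  When the weight is $x^\mu$, the factor $\Gamma(\mu+k+1)$ from integrating the power cancels the coefficient of the series,
  and an exponential series is left. This cancellation is the source of all closed forms below.
\<close>

lemma laplace_clifford:
  assumes \<mu>: "Re \<mu> > -1" and B: "B > 0"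
  shows "(\<integral>x. of_real (exp (- (B * x))) * cpow x \<mu> * clifford \<mu> (\<beta> * of_real x) \<partial>lpos) =
           cpow B (- (\<mu> + 1)) * exp (\<beta> / of_real B)"
    and "(\<integral>x. of_real (exp (- (B * x))) * cpow x (\<mu> + 1) * clifford \<mu> (\<beta> * of_real x) \<partial>lpos) =
           cpow B (- (\<mu> + 2)) * (\<mu> + 1 + \<beta> / of_real B) * exp (\<beta> / of_real B)"
proof -
  let ?w = "\<beta> / of_real B"
  have a: "Re (\<mu> + 1) > 0" "Re (\<mu> + 2) > 0" using \<mu> by auto
  have g: "rGamma (\<mu> + of_nat k + 1) * Gamma (\<mu> + 1 + of_nat k) = 1" for k
    using rGamma_mult_Gamma[of "\<mu> + 1 + of_nat k"] \<mu> by (simp add: add_ac)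
  have g2: "Gamma (\<mu> + 2 + of_nat k) = (\<mu> + 1 + of_nat k) * Gamma (\<mu> + 1 + of_nat k)" for k
  proof -
    have "\<mu> + 1 + of_nat k \<notin> \<int>\<^sub>\<le>\<^sub>0" using \<mu> by (auto elim!: nonpos_Ints_cases simp: complex_eq_iff)
    then show ?thesis using Gamma_plus1[of "\<mu> + 1 + of_nat k"] by (simp add: add_ac)
  qed
  have "(\<lambda>k. cpow B (- (\<mu> + 1)) * (?w ^ k / fact k)) sums (cpow B (- (\<mu> + 1)) * exp ?w)"
    by (intro sums_mult exp_complex_sums)
  moreover have "\<beta> ^ k * rGamma (\<mu> + of_nat k + 1) / fact k * Gamma (\<mu> + 1 + of_nat k) * cpow B (- (\<mu> + 1 + of_nat k))
      = cpow B (- (\<mu> + 1)) * (?w ^ k / fact k)" for k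
  proof -
    have "\<beta> ^ k * rGamma (\<mu> + of_nat k + 1) / fact k * Gamma (\<mu> + 1 + of_nat k) * cpow B (- (\<mu> + 1 + of_nat k)) =
      (rGamma (\<mu> + of_nat k + 1) * Gamma (\<mu> + 1 + of_nat k)) * (\<beta> ^ k * (1 / of_real B) ^ k / fact k * cpow B (- (\<mu> + 1)))"
      unfolding cpow_minus_add_nat[OF B] by (simp add: mult_ac)
    then show ?thesis unfolding g by (simp add: power_divide)
  qed
  ultimately show "(\<integral>x. of_real (exp (- (B * x))) * cpow x \<mu> * clifford \<mu> (\<beta> * of_real x) \<partial>lpos) =
           cpow B (- (\<mu> + 1)) * exp (\<beta> / of_real B)"
    using laplace_clifford_sums(2)[OF a(1) B, of \<beta> \<mu>] by (simp only: add_diff_cancel_right' sums_unique2)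
  have "(\<lambda>k. cpow B (- (\<mu> + 2)) * ((\<mu> + 1) * (?w ^ k / fact k) + of_nat k * (?w ^ k / fact k))) sums
     (cpow B (- (\<mu> + 2)) * ((\<mu> + 1) * exp ?w + ?w * exp ?w))"
    by (intro sums_mult sums_add exp_complex_sums k_exp_complex_sums)
  moreover have "\<beta> ^ k * rGamma (\<mu> + of_nat k + 1) / fact k * Gamma (\<mu> + 2 + of_nat k) * cpow B (- (\<mu> + 2 + of_nat k))
      = cpow B (- (\<mu> + 2)) * ((\<mu> + 1) * (?w ^ k / fact k) + of_nat k * (?w ^ k / fact k))" for k
  proof -
    have "\<beta> ^ k * rGamma (\<mu> + of_nat k + 1) / fact k * Gamma (\<mu> + 2 + of_nat k) * cpow B (- (\<mu> + 2 + of_nat k)) =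
      (rGamma (\<mu> + of_nat k + 1) * Gamma (\<mu> + 1 + of_nat k)) * ((\<mu> + 1 + of_nat k) * (\<beta> ^ k * (1 / of_real B) ^ k / fact k * cpow B (- (\<mu> + 2))))"
      unfolding cpow_minus_add_nat[OF B] g2 by (simp add: mult_ac)
    then show ?thesis unfolding g by (simp add: power_divide algebra_simps add_divide_distrib)
  qed
  ultimately have "(\<integral>x. of_real (exp (- (B * x))) * cpow x (\<mu> + 2 - 1) * clifford \<mu> (\<beta> * of_real x) \<partial>lpos) =
     cpow B (- (\<mu> + 2)) * ((\<mu> + 1) * exp ?w + ?w * exp ?w)"
    using laplace_clifford_sums(2)[OF a(2) B, of \<beta> \<mu>] by (simp only: sums_unique2)
  moreover have "\<mu> + 2 - 1 = \<mu> + 1" by simp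
  ultimately show "(\<integral>x. of_real (exp (- (B * x))) * cpow x (\<mu> + 1) * clifford \<mu> (\<beta> * of_real x) \<partial>lpos) =
           cpow B (- (\<mu> + 2)) * (\<mu> + 1 + \<beta> / of_real B) * exp (\<beta> / of_real B)"
    by (simp only:) (simp add: algebra_simps)
qed

section \<open>Macdonald's function as an integral\<close>

text \<open>
  $K_\mu(z)=\frac12(z/2)^{-\mu}$ \<open>macdonald\<close> $\mu\,(z^2/4)$, by \<open>bessel_K_pos\<close> below. The integral is convenient
  because its modulus is bounded uniformly in the imaginary part of $\mu$.
\<close>

definition macdonald :: "complex \<Rightarrow> real \<Rightarrow> complex" where
  "macdonald \<mu> x = (\<integral>s. of_real (exp (- s - x / s)) * cpow s (\<mu> - 1) \<partial>lpos)"

text \<open>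
  The regularised lower incomplete Gamma function $P(-\mu,y)$, given by its entire series so that it makes sense for
  every complex $\mu$.
\<close>

definition gamma_P :: "complex \<Rightarrow> real \<Rightarrow> complex" where
  "gamma_P \<mu> y = (\<Sum>k. of_real y ^ k * rGamma (of_nat k + 1 - \<mu>)) * of_real (exp (- y)) * cpow y (- \<mu>)"

lemma rGamma_series_summable:
  fixes z \<mu> :: complex
  shows "summable (\<lambda>k. norm (rGamma (of_nat k + 1 - \<mu>) * z ^ k))"
proof -
  obtain C where C: "C \<ge> 0" "\<forall>k. norm (rGamma (- \<mu> + of_nat k + 1)) \<le> C * (2 ^ k / fact k)"
    using norm_rGamma_add_nat_le[of "- \<mu>"] by (elim exE conjE)
  note C = C(1) C(2)[rule_format]
  show ?thesis
  proof (rule summable_comparison_test'[where N = 0])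
    show "summable (\<lambda>k. C * ((2 * norm z) ^ k / fact k))" by (rule exp_series_summable)
    fix k :: nat
    have e: "- \<mu> + of_nat k + 1 = of_nat k + 1 - \<mu>" by simp
    show "norm (norm (rGamma (of_nat k + 1 - \<mu>) * z ^ k)) \<le> C * ((2 * norm z) ^ k / fact k)"
      using mult_right_mono[OF C(2)[of k, unfolded e], of "norm z ^ k"]
      by (simp add: norm_mult norm_power power_mult_distrib mult_ac)
  qed
qed

lemma gamma_P_shift:
  assumes "y > 0"
  shows "gamma_P \<mu> y = of_real (exp (- y)) * cpow y (- \<mu>) * rGamma (1 - \<mu>) + gamma_P (\<mu> - 1) y"
proof -
  have s: "summable (\<lambda>k. of_real y ^ k * rGamma (of_nat k + 1 - \<mu>))" for \<mu> :: complex
    using summable_norm_cancel[OF rGamma_series_summable[of \<mu> "of_real y"]] by (simp add: mult.commute)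
  have "(\<Sum>k. of_real y ^ k * rGamma (of_nat k + 1 - \<mu>)) =
     rGamma (1 - \<mu>) + (\<Sum>k. of_real y ^ Suc k * rGamma (of_nat (Suc k) + 1 - \<mu>))"
    using suminf_split_head[OF s[of \<mu>]] by simp
  also have "(\<Sum>k. of_real y ^ Suc k * rGamma (of_nat (Suc k) + 1 - \<mu>)) =
     of_real y * (\<Sum>k. of_real y ^ k * rGamma (of_nat k + 1 - (\<mu> - 1)))"
    using suminf_mult[OF s[of "\<mu> - 1"], of "of_real y"] by (simp add: algebra_simps)
  finally show ?thesis
    using assms cpow_add[of y "- \<mu>" 1] by (simp add: gamma_P_def cpow_1 algebra_simps)
qed

text \<open>
  The derivative of the series telescopes, since $(k-\mu)/\Gamma(k+1-\mu)=1/\Gamma(k-\mu)$; only the term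
  $k=0$ survives.
\<close>

lemma gamma_P_deriv:
  assumes y: "y > 0"
  shows "(gamma_P \<mu> has_vector_derivative (rGamma (- \<mu>) * (of_real (exp (- y)) * cpow y (- \<mu> - 1)))) (at y)"
proof -
  let ?c = "\<lambda>k. rGamma (of_nat k + 1 - \<mu>)"
  let ?S = "\<lambda>z. \<Sum>k. ?c k * z ^ k"
  let ?D = "\<lambda>z. \<Sum>k. diffs ?c k * z ^ k"
  have sc: "summable (\<lambda>k. ?c k * z ^ k)" for z by (rule summable_norm_cancel[OF rGamma_series_summable])
  have S: "(?S has_field_derivative ?D z) (at z)" for z
    by (rule termdiffs_strong_converges_everywhere) (rule sc)
  have sd: "summable (\<lambda>k. diffs ?c k * z ^ k)" for z
    by (rule termdiff_converges_all) (rule sc)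
  let ?y = "complex_of_real y"
  have tele: "?y * ?D ?y - \<mu> * ?S ?y = rGamma (- \<mu>) + ?y * ?S ?y"
  proof -
    have "(\<lambda>k. of_nat k * ?c k * ?y ^ k) sums (?y * ?D ?y)"
    proof -
      have "(\<lambda>k. ?y * (diffs ?c k * ?y ^ k)) sums (?y * ?D ?y)" by (intro sums_mult summable_sums sd)
      then have "(\<lambda>k. of_nat (Suc k) * ?c (Suc k) * ?y ^ Suc k) sums (?y * ?D ?y)"
        by (simp add: diffs_def mult_ac del: of_nat_Suc)
      then show ?thesis by (subst (asm) sums_Suc_iff) simp
    qed
    from sums_diff[OF this sums_mult[OF summable_sums[OF sc[of ?y]], of \<mu>]]
    have 1: "(\<lambda>k. (of_nat k - \<mu>) * ?c k * ?y ^ k) sums (?y * ?D ?y - \<mu> * ?S ?y)"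
      by (simp only: left_diff_distrib mult.assoc)
    have r: "(of_nat k - \<mu>) * ?c k = rGamma (of_nat k - \<mu>)" for k
      using rGamma_plus1[of "of_nat k - \<mu>"] by (simp add: algebra_simps)
    have "(\<lambda>k. rGamma (of_nat k - \<mu>) * ?y ^ k) sums (?y * ?D ?y - \<mu> * ?S ?y)"
      using 1 unfolding r .
    moreover have "(\<lambda>k. rGamma (of_nat k - \<mu>) * ?y ^ k) sums (rGamma (- \<mu>) + ?y * ?S ?y)"
    proof -
      have "(\<lambda>k. ?y * (?c k * ?y ^ k)) sums (?y * ?S ?y)" by (intro sums_mult summable_sums sc)
      then have "(\<lambda>k. rGamma (of_nat (Suc k) - \<mu>) * ?y ^ Suc k) sums (?y * ?S ?y)" by (simp add: mult_ac add.commute[of 1])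
      then have "(\<lambda>k. rGamma (of_nat k - \<mu>) * ?y ^ k) sums (?y * ?S ?y + rGamma (of_nat 0 - \<mu>) * ?y ^ 0)"
        by (subst (asm) sums_Suc_iff) (simp add: diff_eq_eq)
      then show ?thesis by (simp add: add.commute)
    qed
    ultimately show ?thesis by (rule sums_unique2)
  qed
  have 1: "((\<lambda>y. ?S (of_real y)) has_vector_derivative ?D ?y) (at y)"
    using has_vector_derivative_real_field[OF S[of "of_real y"]] by simp
  have 2: "((\<lambda>y. complex_of_real (exp (- y))) has_vector_derivative - of_real (exp (- y))) (at y)"
    by (auto intro!: derivative_eq_intros has_vector_derivative_of_real[THEN has_vector_derivative_eq_rhs]
         simp: has_real_derivative_iff_has_vector_derivative[symmetric])
  have "((\<lambda>y. ?S (of_real y) * of_real (exp (- y)) * cpow y (- \<mu>)) has_vector_derivative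
      ?S ?y * of_real (exp (- y)) * (- \<mu> * cpow y (- \<mu>) / ?y) + (?S ?y * (- of_real (exp (- y))) + ?D ?y * of_real (exp (- y))) * cpow y (- \<mu>)) (at y)"
    by (intro has_vector_derivative_mult 1 2 has_vector_derivative_cpow y)
  moreover have "?S ?y * of_real (exp (- y)) * (- \<mu> * cpow y (- \<mu>) / ?y) + (?S ?y * (- of_real (exp (- y))) + ?D ?y * of_real (exp (- y))) * cpow y (- \<mu>)
    = (?y * ?D ?y - \<mu> * ?S ?y - ?y * ?S ?y) * (of_real (exp (- y)) * (cpow y (- \<mu>) / ?y))"
    using y by (simp add: field_simps)
  moreover have "cpow y (- \<mu>) / ?y = cpow y (- \<mu> - 1)"
    using cpow_add[of y "- \<mu> - 1" 1] y by (simp add: cpow_1)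
  ultimately have "((\<lambda>y. ?S (of_real y) * of_real (exp (- y)) * cpow y (- \<mu>)) has_vector_derivative
       rGamma (- \<mu>) * (of_real (exp (- y)) * cpow y (- \<mu> - 1))) (at y)"
    using tele by (simp add: diff_eq_eq)
  moreover have "gamma_P \<mu> = (\<lambda>y. ?S (of_real y) * of_real (exp (- y)) * cpow y (- \<mu>))"
    by (simp add: gamma_P_def mult.commute fun_eq_iff)
  ultimately show ?thesis by (simp only:)
qed

lemma exp_powr_integrable: "a > 0 \<Longrightarrow> integrable lpos (\<lambda>x. exp (- x) * x powr (a - 1))"
  using Gamma_laplace_real(1)[of a 1] by simp

lemma einterval_pos: "y \<ge> 0 \<Longrightarrow> einterval (ereal y) \<infinity> = {y<..}"
  by (auto simp: einterval_def)

lemma tendsto_exp_powr_at_top: "((\<lambda>y. exp (- y) * y powr a) \<longlongrightarrow> 0) at_top" for a :: real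
  by real_asymp

lemma gamma_P_tendsto_neg:
  assumes \<mu>: "Re \<mu> < 0"
  shows "(gamma_P \<mu> \<longlongrightarrow> 1) at_top"
proof -
  let ?g = "\<lambda>y. rGamma (- \<mu>) * (of_real (exp (- y)) * cpow y (- \<mu> - 1))"
  have G: "integrable lpos (\<lambda>x. of_real (exp (- x)) * cpow x (- \<mu> - 1))"
      "(\<integral>x. of_real (exp (- x)) * cpow x (- \<mu> - 1) \<partial>lpos) = Gamma (- \<mu>)"
    using Gamma_laplace[of "- \<mu>" 1] \<mu> by simp_all
  have X0: "(gamma_P \<mu> \<longlongrightarrow> 0) (at_right 0)"
  proof -
    let ?c = "\<lambda>k. rGamma (of_nat k + 1 - \<mu>)"
    have "isCont (\<lambda>z. \<Sum>k. ?c k * z ^ k) 0"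
      by (rule isCont_powser_converges_everywhere) (rule summable_norm_cancel[OF rGamma_series_summable])
    then have "((\<lambda>z. \<Sum>k. ?c k * z ^ k) \<longlongrightarrow> (\<Sum>k. ?c k * 0 ^ k)) (at 0)" by (simp add: isCont_def)
    moreover have "filterlim (\<lambda>y. complex_of_real y) (at 0) (at_right 0)"
      by (auto simp: filterlim_at eventually_at_filter intro!: tendsto_eq_intros)
    ultimately have "((\<lambda>y. \<Sum>k. ?c k * of_real y ^ k) \<longlongrightarrow> (\<Sum>k. ?c k * 0 ^ k)) (at_right (0::real))"
      by (rule filterlim_compose)
    moreover have "((\<lambda>y. of_real (exp (- y)) :: complex) \<longlongrightarrow> of_real (exp (- 0))) (at_right 0)"
      by (intro tendsto_intros)
    moreover have "((\<lambda>y. cpow y (- \<mu>)) \<longlongrightarrow> 0) (at_right 0)"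
    proof (rule tendsto_norm_zero_cancel)
      have "((\<lambda>y. y powr (- Re \<mu>)) \<longlongrightarrow> 0) (at_right (0::real))" using \<mu> by real_asymp
      then show "((\<lambda>y. norm (cpow y (- \<mu>))) \<longlongrightarrow> 0) (at_right 0)"
        by (rule Lim_transform_eventually) (auto simp: eventually_at_filter norm_cpow)
    qed
    ultimately have "((\<lambda>y. (\<Sum>k. ?c k * of_real y ^ k) * of_real (exp (- y)) * cpow y (- \<mu>)) \<longlongrightarrow>
        (\<Sum>k. ?c k * 0 ^ k) * of_real (exp (- 0)) * 0) (at_right 0)" by (intro tendsto_mult)
    then show ?thesis by (simp add: gamma_P_def[abs_def] mult.commute)
  qed
  have gi: "set_integrable lborel {0<..} ?g"
    using G(1) unfolding integrable_lpos_iff[symmetric] by simp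
  have Xeq: "gamma_P \<mu> y = (\<integral>x. indicator {0<..<y} x *\<^sub>R ?g x \<partial>lborel)" if y: "y > 0" for y
  proof -
    have "(LBINT x=ereal 0..ereal y. ?g x) = gamma_P \<mu> y - 0"
    proof (rule interval_integral_FTC_integrable)
      show "ereal 0 < ereal y" using y by simp
      fix x assume x: "ereal 0 < ereal x" "ereal x < ereal y"
      then show "(gamma_P \<mu> has_vector_derivative ?g x) (at x)" by (intro gamma_P_deriv) simp
      have "continuous_on {0<..} ?g" by (auto intro!: continuous_intros)
      then show "isCont ?g x" using x by (auto simp: continuous_on_eq_continuous_at)
    next
      show "set_integrable lborel (einterval (ereal 0) (ereal y)) ?g"
        using gi by (rule set_integrable_subset) auto
      have "((\<lambda>x. gamma_P \<mu> x) \<longlongrightarrow> gamma_P \<mu> y) (at_left y)"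
        using has_vector_derivative_continuous[OF gamma_P_deriv[OF y]] 
        by (auto simp: continuous_def isCont_def intro: tendsto_within_subset)
      then show "((gamma_P \<mu> \<circ> real_of_ereal) \<longlongrightarrow> gamma_P \<mu> y) (at_left (ereal y))"
        by (simp add: ereal_tendsto_simps)
      show "((gamma_P \<mu> \<circ> real_of_ereal) \<longlongrightarrow> 0) (at_right (ereal 0))"
        using X0 by (simp add: ereal_tendsto_simps)
    qed
    then show ?thesis using y
      unfolding interval_lebesgue_integral_def set_lebesgue_integral_def
      by (simp flip: integral_mult_right_zero)
  qed
  have "((\<lambda>y. \<integral>x. indicator {0<..<y} x *\<^sub>R ?g x \<partial>lborel) \<longlongrightarrow> (\<integral>x. indicator {0<..} x *\<^sub>R ?g x \<partial>lborel)) at_top"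
  proof (rule integral_dominated_convergence_at_top[where w = "\<lambda>x. norm (indicator {0<..} x *\<^sub>R ?g x)"])
    show "integrable lborel (\<lambda>x. norm (indicator {0<..} x *\<^sub>R ?g x))"
      using gi unfolding set_integrable_def by (rule integrable_norm)
    show "\<forall>\<^sub>F y in at_top. AE x in lborel. norm (indicator {0<..<y} x *\<^sub>R ?g x) \<le> norm (indicator {0<..} x *\<^sub>R ?g x)"
      by (auto intro!: always_eventually AE_I2 simp: indicator_def)
    show "AE x in lborel. ((\<lambda>y. indicator {0<..<y} x *\<^sub>R ?g x) \<longlongrightarrow> indicator {0<..} x *\<^sub>R ?g x) at_top"
    proof (rule AE_I2)
      fix x :: real
      have "\<forall>\<^sub>F y in at_top. indicator {0<..<y} x *\<^sub>R ?g x = indicator {0<..} x *\<^sub>R ?g x"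
        using eventually_gt_at_top[of x] by eventually_elim (auto simp: indicator_def)
      then show "((\<lambda>y. indicator {0<..<y} x *\<^sub>R ?g x) \<longlongrightarrow> indicator {0<..} x *\<^sub>R ?g x) at_top"
        by (rule tendsto_eventually)
    qed
  qed measurable
  also have "(\<integral>x. indicator {0<..} x *\<^sub>R ?g x \<partial>lborel) = rGamma (- \<mu>) * Gamma (- \<mu>)"
    unfolding G(2)[symmetric] integral_lpos set_lebesgue_integral_def by (simp flip: integral_mult_right_zero)
  also have "\<dots> = 1" using \<mu> by (intro rGamma_mult_Gamma) auto
  finally show ?thesis
    by (rule Lim_transform_eventually) (rule eventually_mono[OF eventually_gt_at_top[of 0]], rule Xeq[symmetric])
qed

text \<open>
  For $\mathrm{Re}\,\mu<0$ the value is a Gamma integral over the half-line. Raising $\mu$ by one changes the function only by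
  the term $e^{-y}y^{-\mu}/\Gamma(1-\mu)$, which vanishes at infinity, and so the limit is the same for all $\mu$.
\<close>

lemma gamma_P_tendsto: "(gamma_P \<mu> \<longlongrightarrow> 1) at_top"
proof -
  have "Re \<mu> < real n \<Longrightarrow> (gamma_P \<mu> \<longlongrightarrow> 1) at_top" for n
  proof (induction n arbitrary: \<mu>)
    case 0
    then show ?case by (intro gamma_P_tendsto_neg) simp
  next
    case (Suc n)
    have "((\<lambda>y. of_real (exp (- y)) * cpow y (- \<mu>) * rGamma (1 - \<mu>)) \<longlongrightarrow> 0) at_top"
    proof (rule tendsto_norm_zero_cancel)
      have "((\<lambda>y. exp (- y) * y powr (- Re \<mu>) * norm (rGamma (1 - \<mu>))) \<longlongrightarrow> 0) at_top"
        using tendsto_mult[OF tendsto_exp_powr_at_top[of "- Re \<mu>"] tendsto_const[of "norm (rGamma (1 - \<mu>))"]] by simp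
      then show "((\<lambda>y. norm (of_real (exp (- y)) * cpow y (- \<mu>) * rGamma (1 - \<mu>))) \<longlongrightarrow> 0) at_top"
        by (rule Lim_transform_eventually)
           (rule eventually_mono[OF eventually_gt_at_top[of 0]], simp add: norm_mult norm_cpow)
    qed
    from tendsto_add[OF this Suc.IH[of "\<mu> - 1"]] Suc.prems
    have "((\<lambda>y. of_real (exp (- y)) * cpow y (- \<mu>) * rGamma (1 - \<mu>) + gamma_P (\<mu> - 1) y) \<longlongrightarrow> 1) at_top" by simp
    then show ?case
      by (rule Lim_transform_eventually)
         (rule eventually_mono[OF eventually_gt_at_top[of 0]], simp add: gamma_P_shift[of _ \<mu>])
  qed
  then show ?thesis using reals_Archimedean2 by blast
qed

lemma exp_cpow_tail_integrable:
  assumes y: "y > 0"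
  shows "set_integrable lborel {y<..} (\<lambda>v. complex_of_real (exp (- v)) * cpow v a)"
proof -
  define n where "n = nat \<lceil>- Re a\<rceil> + 1"
  have n: "Re a + real n > 0" unfolding n_def by linarith
  have "integrable lpos (\<lambda>x. exp (- x) * x powr (Re a + real n + 1 - 1))"
    using n by (intro exp_powr_integrable) auto
  then have "set_integrable lborel {0<..} (\<lambda>x. exp (- x) * x powr (Re a + real n))"
    by (simp add: integrable_lpos_iff)
  then have "set_integrable lborel {y<..} (\<lambda>x. exp (- x) * x powr (Re a + real n))"
    by (rule set_integrable_subset) (use y in auto)
  then have i: "set_integrable lborel {y<..} (\<lambda>x. exp (- x) * x powr (Re a + real n) * y powr (- real n))"
    by (simp add: set_integrable_mult_left)
  show ?thesis
  proof (rule set_integrable_bound[OF i])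
    show "set_borel_measurable lborel {y<..} (\<lambda>v. complex_of_real (exp (- v)) * cpow v a)"
    proof -
      have "(\<lambda>v. complex_of_real (exp (- v)) * cpow v a) \<in> borel_measurable borel" by measurable
      then show ?thesis unfolding set_borel_measurable_def by (intro borel_measurable_scaleR) auto
    qed
    show "AE x in lborel. x \<in> {y<..} \<longrightarrow> norm (complex_of_real (exp (- x)) * cpow x a) \<le> norm (exp (- x) * x powr (Re a + real n) * y powr (- real n))"
    proof (rule AE_I2, rule impI)
      fix x assume x: "x \<in> {y<..}"
      then have x0: "x > 0" using y by simp
      have "x powr Re a = x powr (Re a + real n) * x powr (- real n)" using x0 by (simp flip: powr_add)
      also have "\<dots> \<le> x powr (Re a + real n) * y powr (- real n)"
        using x y by (intro mult_left_mono powr_mono2') auto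
      finally show "norm (complex_of_real (exp (- x)) * cpow x a) \<le> norm (exp (- x) * x powr (Re a + real n) * y powr (- real n))"
        using x0 y by (simp add: norm_mult norm_cpow mult.assoc abs_mult mult_left_mono)
    qed
  qed
qed

text \<open>
  Thus the upper incomplete Gamma function is expressed by a power series: this is the connection formula that, after
  a Laplace transform, becomes the one between $K_\mu$ and $I_{\pm\mu}$.
\<close>

lemma gamma_P_tail:
  assumes y: "y > 0"
  shows "rGamma (- \<mu>) * (LINT v:{y<..}|lborel. of_real (exp (- v)) * cpow v (- \<mu> - 1)) = 1 - gamma_P \<mu> y"
proof -
  let ?g = "\<lambda>y. rGamma (- \<mu>) * (of_real (exp (- y)) * cpow y (- \<mu> - 1))"
  have "(LBINT x=ereal y..\<infinity>. ?g x) = 1 - gamma_P \<mu> y"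
  proof (rule interval_integral_FTC_integrable)
    fix x assume x: "ereal y < ereal x" "ereal x < \<infinity>"
    then have x0: "x > 0" using y by simp
    show "(gamma_P \<mu> has_vector_derivative ?g x) (at x)" by (intro gamma_P_deriv x0)
    have "continuous_on {0<..} ?g" by (auto intro!: continuous_intros)
    then show "isCont ?g x" using x0 by (auto simp: continuous_on_eq_continuous_at)
  next
    show "set_integrable lborel (einterval (ereal y) \<infinity>) ?g"
      using exp_cpow_tail_integrable[OF y, of "- \<mu> - 1"] y
      by (subst einterval_pos) (auto simp: set_integrable_mult_right)
    have "((\<lambda>x. gamma_P \<mu> x) \<longlongrightarrow> gamma_P \<mu> y) (at_right y)"
      using has_vector_derivative_continuous[OF gamma_P_deriv[OF y]] 
      by (auto simp: continuous_def isCont_def intro: tendsto_within_subset)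
    then show "((gamma_P \<mu> \<circ> real_of_ereal) \<longlongrightarrow> gamma_P \<mu> y) (at_right (ereal y))"
      by (simp add: ereal_tendsto_simps)
    show "((gamma_P \<mu> \<circ> real_of_ereal) \<longlongrightarrow> 1) (at_left \<infinity>)"
      using gamma_P_tendsto by (simp add: ereal_tendsto_simps)
  qed simp
  then show ?thesis using y
    unfolding interval_lebesgue_integral_def set_lebesgue_integral_def
    by (simp add: einterval_pos flip: integral_mult_right_zero)
qed

lemma Gamma_laplace_one:
  assumes "B > 0"
  shows "integrable lpos (\<lambda>x. exp (- (B * x)))" "(\<integral>x. exp (- (B * x)) \<partial>lpos) = 1 / B"
proof -
  have e: "exp (- (B * x)) * x powr (1 - 1) = exp (- (B * x))" if "x > 0" for x :: real using that by simp
  show "integrable lpos (\<lambda>x. exp (- (B * x)))"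
    using Gamma_laplace_real(1)[of 1 B] assms by (subst (asm) integrable_cong_lpos[OF e]) auto
  have "(\<integral>x. exp (- (B * x)) \<partial>lpos) = (\<integral>x. exp (- (B * x)) * x powr (1 - 1) \<partial>lpos)"
    by (rule integral_cong_lpos) (rule e[symmetric])
  then show "(\<integral>x. exp (- (B * x)) \<partial>lpos) = 1 / B"
    using Gamma_laplace_real(2)[of 1 B] assms by (simp add: powr_minus_divide)
qed

lemma macdonald_laplace_fubini:
  assumes \<mu>: "Re \<mu> > 0" and p: "p > 0"
  shows "integrable lpos (\<lambda>x. of_real (exp (- (p * x))) * macdonald \<mu> x)"
    and "(\<integral>x. of_real (exp (- (p * x))) * macdonald \<mu> x \<partial>lpos) =
         (\<integral>s. of_real (exp (- s) / (1 + p * s)) * cpow s \<mu> \<partial>lpos)"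
proof -
  let ?g = "\<lambda>x s. complex_of_real (exp (- (p * x))) * (of_real (exp (- s - x / s)) * cpow s (\<mu> - 1))"
  have m: "(\<lambda>(x, s). ?g x s) \<in> borel_measurable (lpos \<Otimes>\<^sub>M lpos)"
    by (rule measurable_lpos_lposI) measurable
  have ia: "integrable lpos (\<lambda>x. exp (- (p * x)))" by (rule Gamma_laplace_one(1)[OF p])
  have ib: "integrable lpos (\<lambda>s. exp (- s) * s powr (Re \<mu> - 1))" by (rule exp_powr_integrable[OF \<mu>])
  have bd: "norm (?g x s) \<le> exp (- (p * x)) * (exp (- s) * s powr (Re \<mu> - 1))"
    if "x \<in> space lpos" "s \<in> space lpos" for x s
    using that by (auto simp: norm_mult norm_cpow intro!: mult_left_mono mult_right_mono)
  note F = lpos2.Fubini_product_bound[OF m ia ib bd]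
  have N: "(\<integral>s. ?g x s \<partial>lpos) = of_real (exp (- (p * x))) * macdonald \<mu> x" for x
    unfolding macdonald_def by simp
  show "integrable lpos (\<lambda>x. of_real (exp (- (p * x))) * macdonald \<mu> x)" using F(1) unfolding N .
  have "(\<integral>x. ?g x s \<partial>lpos) = of_real (exp (- s) / (1 + p * s)) * cpow s \<mu>" if s: "s > 0" for s
  proof -
    have B: "p + 1 / s > 0" using p s by (simp add: add_pos_pos)
    have "(\<integral>x. ?g x s \<partial>lpos) = (\<integral>x. of_real (exp (- ((p + 1 / s) * x))) * (of_real (exp (- s)) * cpow s (\<mu> - 1)) \<partial>lpos)"
      by (intro integral_cong_lpos) (simp add: algebra_simps flip: exp_add of_real_mult)
    also have "\<dots> = (\<integral>x. complex_of_real (exp (- ((p + 1 / s) * x))) \<partial>lpos) * (of_real (exp (- s)) * cpow s (\<mu> - 1))"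
      by (rule integral_mult_left_zero)
    also have "(\<integral>x. complex_of_real (exp (- ((p + 1 / s) * x))) \<partial>lpos) = of_real (1 / (p + 1 / s))"
      using Gamma_laplace_one(2)[OF B] by (simp only: integral_complex_of_real)
    also have "1 / (p + 1 / s) = s / (1 + p * s)" using s by (simp add: field_simps)
    also have "of_real (s / (1 + p * s)) * (of_real (exp (- s)) * cpow s (\<mu> - 1)) =
        of_real (exp (- s) / (1 + p * s)) * (cpow s (\<mu> - 1) * cpow s 1)"
      using s by (simp add: cpow_1)
    also have "cpow s (\<mu> - 1) * cpow s 1 = cpow s \<mu>" by (simp flip: cpow_add)
    finally show ?thesis .
  qed
  then have "(\<integral>s. (\<integral>x. ?g x s \<partial>lpos) \<partial>lpos) = (\<integral>s. of_real (exp (- s) / (1 + p * s)) * cpow s \<mu> \<partial>lpos)"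
    by (intro integral_cong_lpos)
  then show "(\<integral>x. of_real (exp (- (p * x))) * macdonald \<mu> x \<partial>lpos) = (\<integral>s. of_real (exp (- s) / (1 + p * s)) * cpow s \<mu> \<partial>lpos)"
    using F(3) unfolding N by (simp only:)
qed

text \<open>
  Here $1/(1+ps)$ is written as $\int_0^\infty e^{-w(1+ps)}dw$, and the integral over \<open>s\<close> is a Gamma integral.
\<close>

lemma macdonald_laplace_gamma:
  assumes \<mu>: "Re \<mu> > 0" and p: "p > 0"
  shows "(\<integral>s. of_real (exp (- s) / (1 + p * s)) * cpow s \<mu> \<partial>lpos) =
     Gamma (\<mu> + 1) * (\<integral>w. of_real (exp (- w)) * cpow (1 + p * w) (- (\<mu> + 1)) \<partial>lpos)"
proof -
  let ?g = "\<lambda>s w. complex_of_real (exp (- s)) * cpow s \<mu> * of_real (exp (- (w * (1 + p * s))))"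
  have m: "(\<lambda>(x, s). ?g x s) \<in> borel_measurable (lpos \<Otimes>\<^sub>M lpos)"
    by (rule measurable_lpos_lposI) measurable
  have ia: "integrable lpos (\<lambda>s. exp (- s) * s powr Re \<mu>)" using exp_powr_integrable[of "Re \<mu> + 1"] \<mu> by simp
  have ib: "integrable lpos (\<lambda>w. exp (- w))" using Gamma_laplace_one(1)[of 1] by simp
  have bd: "norm (?g s w) \<le> (exp (- s) * s powr Re \<mu>) * exp (- w)"
    if "s \<in> space lpos" "w \<in> space lpos" for s w
    using that p by (auto simp: norm_mult norm_cpow mult_le_cancel_left1 intro!: mult_left_mono)
  note F = lpos2.Fubini_product_bound[OF m ia ib bd]
  have 1: "(\<integral>w. ?g s w \<partial>lpos) = of_real (exp (- s) / (1 + p * s)) * cpow s \<mu>" if s: "s > 0" for s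
  proof -
    have B: "1 + p * s > 0" using p s by (simp add: add_pos_pos)
    have "(\<integral>w. ?g s w \<partial>lpos) = complex_of_real (exp (- s)) * cpow s \<mu> * (\<integral>w. complex_of_real (exp (- ((1 + p * s) * w))) \<partial>lpos)"
      by (simp add: mult.commute)
    also have "(\<integral>w. complex_of_real (exp (- ((1 + p * s) * w))) \<partial>lpos) = of_real (1 / (1 + p * s))"
      using Gamma_laplace_one(2)[OF B] by (simp only: integral_complex_of_real)
    finally show ?thesis by simp
  qed
  have 2: "(\<integral>s. ?g s w \<partial>lpos) = Gamma (\<mu> + 1) * (of_real (exp (- w)) * cpow (1 + p * w) (- (\<mu> + 1)))" if w: "w > 0" for w
  proof -
    have B: "1 + p * w > 0" using p w by (simp add: add_pos_pos)
    have "(\<integral>s. ?g s w \<partial>lpos) = (\<integral>s. of_real (exp (- w)) * (of_real (exp (- ((1 + p * w) * s))) * cpow s (\<mu> + 1 - 1)) \<partial>lpos)"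
      by (intro integral_cong_lpos) (simp add: exp_add[symmetric] of_real_mult[symmetric] algebra_simps exp_diff exp_minus exp_add)
    also have "\<dots> = of_real (exp (- w)) * (Gamma (\<mu> + 1) * cpow (1 + p * w) (- (\<mu> + 1)))"
      using Gamma_laplace(2)[of "\<mu> + 1", OF _ B] \<mu> by (simp only: integral_mult_right_zero) simp
    finally show ?thesis by (simp add: mult_ac)
  qed
  have "(\<integral>s. of_real (exp (- s) / (1 + p * s)) * cpow s \<mu> \<partial>lpos) = (\<integral>s. (\<integral>w. ?g s w \<partial>lpos) \<partial>lpos)"
    by (intro integral_cong_lpos 1[symmetric])
  also have "\<dots> = (\<integral>w. (\<integral>s. ?g s w \<partial>lpos) \<partial>lpos)" by (rule F(3))
  also have "\<dots> = (\<integral>w. Gamma (\<mu> + 1) * (of_real (exp (- w)) * cpow (1 + p * w) (- (\<mu> + 1))) \<partial>lpos)"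
    by (intro integral_cong_lpos 2)
  also have "\<dots> = Gamma (\<mu> + 1) * (\<integral>w. of_real (exp (- w)) * cpow (1 + p * w) (- (\<mu> + 1)) \<partial>lpos)"
    by (rule integral_mult_right_zero)
  finally show ?thesis .
qed

lemma macdonald_laplace_tail:
  assumes p: "p > 0"
  shows "(\<integral>w. of_real (exp (- w)) * cpow (1 + p * w) (- (\<mu> + 1)) \<partial>lpos) =
     of_real (exp (1 / p)) * cpow p (- (\<mu> + 1)) * (LINT v:{1/p<..}|lborel. of_real (exp (- v)) * cpow v (- \<mu> - 1))"
proof -
  let ?f = "\<lambda>v. indicator {1/p<..} v *\<^sub>R (complex_of_real (exp (- v)) * cpow v (- \<mu> - 1))"
  have "(LINT v:{1/p<..}|lborel. of_real (exp (- v)) * cpow v (- \<mu> - 1)) = (\<integral>w. ?f (1 / p + 1 * w) \<partial>lborel)"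
    unfolding set_lebesgue_integral_def by (subst lborel_integral_real_affine[where c = 1 and t = "1/p"]) auto
  also have "\<dots> = (LINT w:{0<..}|lborel. of_real (exp (- (1 / p + w))) * cpow (1 / p + w) (- \<mu> - 1))"
    unfolding set_lebesgue_integral_def by (intro Bochner_Integration.integral_cong) (auto simp: indicator_def)
  also have "\<dots> = (\<integral>w. of_real (exp (- (1 / p + w))) * cpow (1 / p + w) (- \<mu> - 1) \<partial>lpos)"
    by (simp add: integral_lpos)
  also have "of_real (exp (1 / p)) * cpow p (- (\<mu> + 1)) * \<dots> = (\<integral>w. of_real (exp (- w)) * cpow (1 + p * w) (- (\<mu> + 1)) \<partial>lpos)"
    unfolding integral_mult_right_zero[symmetric]
  proof (rule integral_cong_lpos)
    fix w :: real assume w: "w > 0"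
    have e: "1 + p * w = p * (1 / p + w)" using p by (simp add: field_simps)
    have "cpow (1 + p * w) (- (\<mu> + 1)) = cpow p (- (\<mu> + 1)) * cpow (1 / p + w) (- (\<mu> + 1))"
      unfolding e using p w by (intro cpow_mult) (auto intro: add_pos_pos)
    moreover have "complex_of_real (exp (- w)) = of_real (exp (1 / p)) * of_real (exp (- (1 / p + w)))"
      by (simp flip: of_real_mult exp_add)
    moreover have "- (\<mu> + 1) = - \<mu> - 1" by simp
    ultimately show "of_real (exp (1 / p)) * cpow p (- (\<mu> + 1)) * (of_real (exp (- (1 / p + w))) * cpow (1 / p + w) (- \<mu> - 1)) =
      of_real (exp (- w)) * cpow (1 + p * w) (- (\<mu> + 1))" by (simp only: mult_ac)
  qed
  finally show ?thesis by simp
qed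

lemma Gamma_reflection_minus:
  fixes \<mu> :: complex
  shows "Gamma (\<mu> + 1) * Gamma (- \<mu>) = - (of_real pi / sin (of_real pi * \<mu>))"
  using Gamma_reflection_complex[of "- \<mu>"] by (simp add: add.commute mult.commute)

lemma macdonald_laplace:
  assumes \<mu>: "Re \<mu> > 0" and int: "\<mu> \<notin> \<int>" and p: "p > 0"
  shows "(\<integral>x. of_real (exp (- (p * x))) * macdonald \<mu> x \<partial>lpos) =
    of_real pi / sin (of_real pi * \<mu>) *
      ((\<Sum>k. of_real (1 / p) ^ k * rGamma (of_nat k + 1 - \<mu>)) * of_real (1 / p) - cpow p (- (\<mu> + 1)) * of_real (exp (1 / p)))"
proof -
  let ?I = "LINT v:{1/p<..}|lborel. of_real (exp (- v)) * cpow v (- \<mu> - 1)"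
  let ?\<Sigma> = "\<Sum>k. of_real (1 / p) ^ k * rGamma (of_nat k + 1 - \<mu>)"
  have y: "1 / p > 0" using p by simp
  have n: "- \<mu> \<notin> \<int>\<^sub>\<le>\<^sub>0" using int nonpos_Ints_subset_Ints by (metis Ints_minus minus_minus subsetD)
  have I: "?I = Gamma (- \<mu>) * (1 - gamma_P \<mu> (1 / p))"
    using gamma_P_tail[OF y, of \<mu>] n unfolding rGamma_inverse_Gamma
    by (simp add: Gamma_eq_zero_iff field_simps)
  have c: "cpow p (- (\<mu> + 1)) * cpow (1 / p) (- \<mu>) = of_real (1 / p)"
  proof -
    have "cpow (1 / p) (- \<mu>) = cpow p \<mu>" using p cpow_divide[of 1 p "- \<mu>"] by simp
    then have "cpow p (- (\<mu> + 1)) * cpow (1 / p) (- \<mu>) = cpow p (- 1)" by (simp flip: cpow_add)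
    also have "\<dots> = of_real (1 / p)" using p by (simp add: cpow_minus cpow_1 inverse_eq_divide)
    finally show ?thesis .
  qed
  have "(\<integral>x. of_real (exp (- (p * x))) * macdonald \<mu> x \<partial>lpos) =
     Gamma (\<mu> + 1) * (of_real (exp (1 / p)) * cpow p (- (\<mu> + 1)) * (Gamma (- \<mu>) * (1 - gamma_P \<mu> (1 / p))))"
    by (simp only: macdonald_laplace_fubini(2)[OF \<mu> p] macdonald_laplace_gamma[OF \<mu> p] macdonald_laplace_tail[OF p] I)
  also have "\<dots> = (Gamma (\<mu> + 1) * Gamma (- \<mu>)) * (of_real (exp (1 / p)) * cpow p (- (\<mu> + 1)) -
       ?\<Sigma> * (of_real (exp (1 / p)) * of_real (exp (- (1 / p)))) * (cpow p (- (\<mu> + 1)) * cpow (1 / p) (- \<mu>)))"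
    unfolding gamma_P_def by (simp only: algebra_simps mult_1_left)
  also have "of_real (exp (1 / p)) * of_real (exp (- (1 / p))) = (1 :: complex)"
    by (simp flip: of_real_mult exp_add)
  finally show ?thesis unfolding c Gamma_reflection_minus by (simp add: algebra_simps)
qed

lemma macdonald_integrand_measurable [measurable]:
  "(\<lambda>s. complex_of_real (exp (- s - x / s)) * cpow s a) \<in> borel_measurable lpos"
  by (rule measurable_lposI) measurable

lemma continuous_on_macdonald:
  assumes "Re \<mu> > 0"
  shows "continuous_on {0<..} (macdonald \<mu>)"
  unfolding macdonald_def[abs_def]
proof (rule continuous_on_integral_dominated[OF macdonald_integrand_measurable exp_powr_integrable[OF assms]])
  fix s :: real assume "s \<in> space lpos"
  then show "continuous_on {0<..} (\<lambda>y. complex_of_real (exp (- s - y / s)) * cpow s (\<mu> - 1))"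
    by (auto intro!: continuous_intros)
next
  fix y s :: real assume "y \<in> {0<..}" "s \<in> space lpos"
  then show "norm (complex_of_real (exp (- s - y / s)) * cpow s (\<mu> - 1)) \<le> exp (- s) * s powr (Re \<mu> - 1)"
    by (auto simp: norm_mult norm_cpow intro!: mult_right_mono)
qed

text \<open>
  Both sides are continuous and have the same Laplace transform: an upper incomplete Gamma function on the left, and
  its expansion by \<open>gamma_P_tail\<close> on the right.
\<close>

theorem macdonald_eq_clifford:
  assumes \<mu>: "Re \<mu> > 0" and int: "\<mu> \<notin> \<int>" and x: "x > 0"
  shows "macdonald \<mu> x = of_real pi / sin (of_real pi * \<mu>) * (clifford (- \<mu>) (of_real x) - cpow x \<mu> * clifford \<mu> (of_real x))"
proof -
  let ?c = "of_real pi / sin (of_real pi * \<mu>)"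
  let ?A = "\<lambda>x. macdonald \<mu> x - ?c * (clifford (- \<mu>) (of_real x) - cpow x \<mu> * clifford \<mu> (of_real x))"
  have L: "integrable lpos (\<lambda>x. of_real (exp (- (p * x))) * ?A x) \<and>
           (\<integral>x. of_real (exp (- (p * x))) * ?A x \<partial>lpos) = 0" if p1: "p \<ge> 1" for p
  proof -
    have p: "p > 0" using p1 by simp
    let ?E = "\<lambda>x. complex_of_real (exp (- (p * x)))"
    have "Re 1 > 0" by simp
    note S1 = laplace_clifford_sums[where a = 1 and \<mu> = "- \<mu>" and \<beta> = 1, OF this p,
        unfolded diff_self cpow_0 mult_1_right mult_1_left power_one]
    note S2i = laplace_clifford_sums(1)[of "\<mu> + 1" p \<mu> 1, simplified, OF _ p]
    note S2 = laplace_clifford(1)[of \<mu> p 1, simplified, OF _ p]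
    have i1: "integrable lpos (\<lambda>x. ?E x * macdonald \<mu> x)" by (rule macdonald_laplace_fubini(1)[OF \<mu> p])
    have i2: "integrable lpos (\<lambda>x. ?E x * clifford (- \<mu>) (of_real x))" using S1(1) by simp
    have i3: "integrable lpos (\<lambda>x. ?E x * cpow x \<mu> * clifford \<mu> (of_real x))" using S2i \<mu> by simp
    have eq: "?E x * ?A x = ?E x * macdonald \<mu> x - ?c * (?E x * clifford (- \<mu>) (of_real x)) + ?c * (?E x * cpow x \<mu> * clifford \<mu> (of_real x))" for x
      by (simp add: algebra_simps)
    have "(\<lambda>k. (of_real (1 / p) ^ k * rGamma (of_nat k + 1 - \<mu>)) * of_real (1 / p)) sums (\<integral>x. ?E x * clifford (- \<mu>) (of_real x) \<partial>lpos)"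
    proof (rule sums_cong[THEN iffD1, OF _ S1(2)])
      fix k :: nat
      have g: "Gamma (1 + of_nat k :: complex) = fact k" using Gamma_fact[of k, where 'a = complex] by simp
      have c: "cpow p (- (1 + of_nat k)) = of_real (1 / p) * of_real (1 / p) ^ k"
        using cpow_minus_add_nat[OF p, of 1 k] p by (simp add: cpow_minus cpow_1 inverse_eq_divide)
      have r: "- \<mu> + of_nat k + 1 = of_nat k + 1 - \<mu>" by simp
      show "rGamma (- \<mu> + of_nat k + 1) / fact k * Gamma (1 + of_nat k) * cpow p (- (1 + of_nat k)) =
            (of_real (1 / p) ^ k * rGamma (of_nat k + 1 - \<mu>)) * of_real (1 / p)"
        unfolding g c r by (simp add: mult_ac)
    qed
    moreover have "summable (\<lambda>k. of_real (1 / p) ^ k * rGamma (of_nat k + 1 - \<mu>))"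
      using summable_norm_cancel[OF rGamma_series_summable[of \<mu> "of_real (1/p)"]] by (simp only: mult.commute)
    then have "(\<lambda>k. (of_real (1 / p) ^ k * rGamma (of_nat k + 1 - \<mu>)) * of_real (1 / p)) sums
       ((\<Sum>k. of_real (1 / p) ^ k * rGamma (of_nat k + 1 - \<mu>)) * of_real (1 / p))"
      by (intro sums_mult2 summable_sums)
    ultimately have v2: "(\<integral>x. ?E x * clifford (- \<mu>) (of_real x) \<partial>lpos) =
        (\<Sum>k. of_real (1 / p) ^ k * rGamma (of_nat k + 1 - \<mu>)) * of_real (1 / p)"
      by (rule sums_unique2)
    have v3: "(\<integral>x. ?E x * cpow x \<mu> * clifford \<mu> (of_real x) \<partial>lpos) = cpow p (- (\<mu> + 1)) * of_real (exp (1 / p))"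
      using S2 \<mu> by (simp add: exp_of_real[symmetric])
    have "integrable lpos (\<lambda>x. ?E x * ?A x)" unfolding eq using i1 i2 i3 by simp
    moreover have "(\<integral>x. ?E x * ?A x \<partial>lpos) = (\<integral>x. ?E x * macdonald \<mu> x \<partial>lpos) - ?c * (\<integral>x. ?E x * clifford (- \<mu>) (of_real x) \<partial>lpos)
        + ?c * (\<integral>x. ?E x * cpow x \<mu> * clifford \<mu> (of_real x) \<partial>lpos)"
      unfolding eq using i1 i2 i3 by simp
    moreover have "\<dots> = 0"
      unfolding v2 v3 macdonald_laplace[OF \<mu> int p] by (simp add: algebra_simps)
    ultimately show ?thesis by simp
  qed
  have "AE x in lpos. ?A x = 0" by (rule laplace_unique) (use L in auto)
  then have AE: "AE x in lpos. macdonald \<mu> x = ?c * (clifford (- \<mu>) (of_real x) - cpow x \<mu> * clifford \<mu> (of_real x))"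
    by eventually_elim simp
  show ?thesis
    by (rule AE_lpos_eq_continuous[OF AE continuous_on_macdonald[OF \<mu>] _ x])
       (rule continuous_on_mult[OF continuous_on_const], auto intro!: continuous_intros)
qed

lemma norm_macdonald_le:
  assumes "Re \<mu> > 0" "x > 0"
  shows "norm (macdonald \<mu> x) \<le> Gamma (Re \<mu>)"
proof -
  have "norm (macdonald \<mu> x) \<le> (\<integral>s. exp (- s) * s powr (Re \<mu> - 1) \<partial>lpos)"
    unfolding macdonald_def
    by (rule Bochner_Integration.integral_norm_bound_integral[OF integrable_lpos_bound[OF exp_powr_integrable[OF assms(1)]] exp_powr_integrable[OF assms(1)]])
       (use assms in \<open>auto simp: norm_mult norm_cpow intro!: mult_right_mono\<close>)
  also have "\<dots> = Gamma (Re \<mu>)" using Gamma_laplace_real(2)[of "Re \<mu>" 1] assms by simp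
  finally show ?thesis .
qed

lemma times_exp_minus_le_one: "v * exp (- v) \<le> 1" for v :: real
proof -
  have "v \<le> exp v" using exp_ge_add_one_self[of v] by linarith
  then show ?thesis by (simp add: exp_minus field_simps)
qed

text \<open>
  The factor \<open>x\<close> makes the bound uniform in \<open>x\<close> and available even where the order $\mu-1$ has negative real part, since
  $(x/s)e^{-x/s}\le 1$.
\<close>

lemma macdonald_minus_one_integrand_le:
  assumes "x > 0" "s > 0"
  shows "norm (of_real x * (complex_of_real (exp (- s - x / s)) * cpow s (\<mu> - 1 - 1))) \<le> exp (- s) * s powr (Re \<mu> - 1)"
proof -
  have pw: "s powr (Re \<mu> - 1 - 1) = s powr (Re \<mu> - 1) / s" using assms(2) by (simp add: powr_diff power2_eq_square)
  have e: "exp (- s - x / s) = exp (- s) * exp (- (x / s))" by (simp flip: exp_add)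
  have "norm (of_real x * (complex_of_real (exp (- s - x / s)) * cpow s (\<mu> - 1 - 1))) =
    x * (exp (- s - x / s) * s powr (Re \<mu> - 1 - 1))"
    using assms norm_cpow[of s "\<mu> - 1 - 1"] by (simp add: norm_mult del: diff_diff_eq)
  also have "\<dots> = (x / s * exp (- (x / s))) * (exp (- s) * s powr (Re \<mu> - 1))"
    unfolding e pw by simp
  also have "\<dots> \<le> 1 * (exp (- s) * s powr (Re \<mu> - 1))"
    by (intro mult_right_mono times_exp_minus_le_one) auto
  finally show ?thesis by simp
qed

lemma norm_macdonald_minus_one_le:
  assumes "Re \<mu> > 0" "x > 0"
  shows "norm (of_real x * macdonald (\<mu> - 1) x) \<le> Gamma (Re \<mu>)"
proof -
  have "norm (of_real x * macdonald (\<mu> - 1) x) = norm (\<integral>s. of_real x * (complex_of_real (exp (- s - x / s)) * cpow s (\<mu> - 1 - 1)) \<partial>lpos)"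
    unfolding macdonald_def by (simp only: integral_mult_right_zero)
  also have "\<dots> \<le> (\<integral>s. exp (- s) * s powr (Re \<mu> - 1) \<partial>lpos)"
    by (rule Bochner_Integration.integral_norm_bound_integral[OF integrable_lpos_bound[OF exp_powr_integrable[OF assms(1)]] exp_powr_integrable[OF assms(1)]])
       (use macdonald_minus_one_integrand_le assms in \<open>auto\<close>)
  also have "\<dots> = Gamma (Re \<mu>)" using Gamma_laplace_real(2)[of "Re \<mu>" 1] assms by simp
  finally show ?thesis .
qed

lemma exp_diff_quotient_le:
  fixes a b c :: real
  assumes "c \<le> a" "c \<le> b"
  shows "\<bar>exp (- a) - exp (- b)\<bar> \<le> \<bar>a - b\<bar> * exp (- c)"
proof -
  have *: "exp (- a) - exp (- b) \<le> (b - a) * exp (- c)" if "a \<le> b" "c \<le> a" for a b :: real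
  proof -
    have "exp (- a) - exp (- b) = exp (- a) * (1 - exp (- (b - a)))" by (simp add: algebra_simps flip: exp_add)
    also have "\<dots> \<le> exp (- a) * (b - a)"
    proof (rule mult_left_mono)
      show "1 - exp (- (b - a)) \<le> b - a" using exp_ge_add_one_self[of "- (b - a)"] by linarith
    qed simp
    also have "\<dots> \<le> exp (- c) * (b - a)" using that by (intro mult_right_mono) auto
    finally show ?thesis by (simp add: mult.commute)
  qed
  show ?thesis
  proof (cases "a \<le> b")
    case True
    then have "exp (- b) \<le> exp (- a)" by simp
    with *[OF True assms(1)] True show ?thesis by (simp add: abs_if)
  next
    case False
    then have "exp (- a) \<le> exp (- b)" by simp
    with *[of b a] assms(2) False show ?thesis by (simp add: abs_if)
  qed
qed

lemma macdonald_deriv: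
  assumes \<mu>: "Re \<mu> > 0" and x: "x > 0"
  shows "(macdonald \<mu> has_vector_derivative - macdonald (\<mu> - 1) x) (at x)"
proof -
  let ?e = "\<lambda>y s. complex_of_real (exp (- s - y / s)) * cpow s (\<mu> - 1)"
  let ?q = "\<lambda>y s. (1 / (y - x)) *\<^sub>R (?e y s - ?e x s)"
  have int: "integrable lpos (?e y)" if "y > 0" for y
    by (rule integrable_lpos_bound[OF exp_powr_integrable[OF \<mu>]])
       (use that in \<open>auto simp: norm_mult norm_cpow intro!: mult_right_mono\<close>)
  have lim: "((\<lambda>y. \<integral>s. ?q y s \<partial>lpos) \<longlongrightarrow> (\<integral>s. - (complex_of_real (exp (- s - x / s)) * cpow s (\<mu> - 1 - 1)) \<partial>lpos)) (at x within {x/2<..})"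
  proof (rule tendsto_integral_dominated_at[where w = "\<lambda>s. (2 / x) * (exp (- s) * s powr (Re \<mu> - 1))"])
    show "integrable lpos (\<lambda>s. (2 / x) * (exp (- s) * s powr (Re \<mu> - 1)))"
      using exp_powr_integrable[OF \<mu>] by (rule integrable_mult_right)
    fix s assume s: "s \<in> space lpos"
    have "((\<lambda>y. exp (- s - y / s)) has_real_derivative - (1 / s) * exp (- s - x / s)) (at x)"
      using s by (auto intro!: derivative_eq_intros)
    then have "((\<lambda>y. (exp (- s - y / s) - exp (- s - x / s)) / (y - x)) \<longlongrightarrow> - (1 / s) * exp (- s - x / s)) (at x)"
      by (simp add: has_field_derivative_iff)
    then have "((\<lambda>y. (exp (- s - y / s) - exp (- s - x / s)) / (y - x)) \<longlongrightarrow> - (1 / s) * exp (- s - x / s)) (at x within {x/2<..})"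
      by (rule tendsto_within_subset) auto
    then have "((\<lambda>y. complex_of_real ((exp (- s - y / s) - exp (- s - x / s)) / (y - x)) * cpow s (\<mu> - 1)) \<longlongrightarrow>
        complex_of_real (- (1 / s) * exp (- s - x / s)) * cpow s (\<mu> - 1)) (at x within {x/2<..})"
      by (intro tendsto_intros)
    moreover have "cpow s (\<mu> - 1 - 1) = cpow s (\<mu> - 1) / of_real s"
      using cpow_add[of s "\<mu> - 1" "- 1"] s by (simp add: cpow_minus cpow_1 field_simps)
    ultimately show "((\<lambda>y. ?q y s) \<longlongrightarrow> - (complex_of_real (exp (- s - x / s)) * cpow s (\<mu> - 1 - 1))) (at x within {x/2<..})"
      by (simp add: scaleR_conv_of_real algebra_simps diff_divide_distrib)
  next
    fix y s :: real assume y: "y \<in> {x/2<..}" "y \<noteq> x" and s: "s \<in> space lpos"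
    have "\<bar>exp (- (y / s)) - exp (- (x / s))\<bar> \<le> \<bar>y / s - x / s\<bar> * exp (- (x / 2 / s))"
      using y(1) s x by (intro exp_diff_quotient_le) (auto simp: field_simps)
    also have "\<bar>y / s - x / s\<bar> * exp (- (x / 2 / s)) = (2 / x * \<bar>y - x\<bar>) * ((x / 2 / s) * exp (- (x / 2 / s)))"
      using s x by (simp add: diff_divide_distrib[symmetric] abs_divide)
    also have "\<dots> \<le> (2 / x * \<bar>y - x\<bar>) * 1"
      using x by (intro mult_left_mono times_exp_minus_le_one) auto
    finally have 1: "\<bar>exp (- (y / s)) - exp (- (x / s))\<bar> / \<bar>y - x\<bar> \<le> 2 / x"
      using y(2) by (simp add: divide_le_eq)
    have "?e y s - ?e x s = of_real (exp (- (y / s)) - exp (- (x / s))) * (of_real (exp (- s)) * cpow s (\<mu> - 1))"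
      by (simp add: exp_diff exp_minus field_simps)
    then have "norm (?q y s) = (\<bar>exp (- (y / s)) - exp (- (x / s))\<bar> / \<bar>y - x\<bar>) * (exp (- s) * s powr (Re \<mu> - 1))"
      using s by (simp add: norm_mult norm_cpow abs_divide del: of_real_diff)
    also have "\<dots> \<le> (2 / x) * (exp (- s) * s powr (Re \<mu> - 1))" by (intro mult_right_mono 1) auto
    finally show "norm (?q y s) \<le> (2 / x) * (exp (- s) * s powr (Re \<mu> - 1))" .
  qed (auto intro!: macdonald_integrand_measurable)
  have "((\<lambda>y. (1 / (y - x)) *\<^sub>R (macdonald \<mu> y - macdonald \<mu> x)) \<longlongrightarrow> - macdonald (\<mu> - 1) x) (at x within {x/2<..})"
  proof (rule Lim_transform_eventually)
    show "((\<lambda>y. \<integral>s. ?q y s \<partial>lpos) \<longlongrightarrow> - macdonald (\<mu> - 1) x) (at x within {x/2<..})"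
      using lim by (simp add: macdonald_def)
    have h: "(\<integral>s. ?q y s \<partial>lpos) = (1 / (y - x)) *\<^sub>R (macdonald \<mu> y - macdonald \<mu> x)" if "y > x/2" for y
      using int[of y] int[of x] that x by (simp add: macdonald_def)
    show "\<forall>\<^sub>F y in at x within {x/2<..}. (\<integral>s. ?q y s \<partial>lpos) = (1 / (y - x)) *\<^sub>R (macdonald \<mu> y - macdonald \<mu> x)"
      unfolding eventually_at_filter by (intro always_eventually allI impI h) (simp only: greaterThan_iff)
  qed
  moreover have "at x within {x/2<..} = at x" using x by (intro at_within_open) auto
  ultimately have L: "((\<lambda>y. (1 / (y - x)) *\<^sub>R (macdonald \<mu> y - macdonald \<mu> x)) \<longlongrightarrow> - macdonald (\<mu> - 1) x) (at x)" by simp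
  have "((\<lambda>y. norm (macdonald \<mu> y - macdonald \<mu> x - (y - x) *\<^sub>R (- macdonald (\<mu> - 1) x)) / norm (y - x)) \<longlongrightarrow> 0) (at x)"
  proof (rule Lim_transform_eventually)
    show "((\<lambda>y. norm ((1 / (y - x)) *\<^sub>R (macdonald \<mu> y - macdonald \<mu> x) - (- macdonald (\<mu> - 1) x))) \<longlongrightarrow> 0) (at x)"
      by (rule tendsto_norm_zero[OF LIM_zero[OF L]])
    have "norm ((1 / (y - x)) *\<^sub>R (macdonald \<mu> y - macdonald \<mu> x) - (- macdonald (\<mu> - 1) x)) =
       norm (macdonald \<mu> y - macdonald \<mu> x - (y - x) *\<^sub>R (- macdonald (\<mu> - 1) x)) / norm (y - x)" if "y \<noteq> x" for y
    proof -
      have "macdonald \<mu> y - macdonald \<mu> x - (y - x) *\<^sub>R (- macdonald (\<mu> - 1) x) =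
         (y - x) *\<^sub>R ((1 / (y - x)) *\<^sub>R (macdonald \<mu> y - macdonald \<mu> x) - (- macdonald (\<mu> - 1) x))"
        using that by (simp add: scaleR_diff_right scaleR_add_right)
      then show ?thesis using that by simp
    qed
    then show "\<forall>\<^sub>F y in at x. norm ((1 / (y - x)) *\<^sub>R (macdonald \<mu> y - macdonald \<mu> x) - (- macdonald (\<mu> - 1) x)) =
       norm (macdonald \<mu> y - macdonald \<mu> x - (y - x) *\<^sub>R (- macdonald (\<mu> - 1) x)) / norm (y - x)"
      by (auto simp: eventually_at_filter)
  qed
  then show ?thesis
    unfolding has_vector_derivative_def has_derivative_iff_norm
    by (intro conjI bounded_linear_scaleR_left) simp_all
qed

section \<open>Closed forms of the kernels\<close>

text \<open>
  For $\tau\neq0$ the order $\alpha+i\tau$ is not an integer, so that $K_\mu$ is given by the quotient in its definition;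
  for the integrals over $\tau$ the point $\tau=0$ is a null set.
\<close>

lemma Complex_not_Ints: "\<tau> \<noteq> 0 \<Longrightarrow> Complex \<alpha> \<tau> \<notin> \<int>"
  by (simp add: complex_is_Int_iff)

lemma bessel_I_pos:
  assumes "z > 0"
  shows "bessel_I \<mu> (of_real z) = cpow (z / 2) \<mu> * clifford \<mu> (of_real (z\<^sup>2 / 4))"
proof -
  have "(complex_of_real z / 2) powr \<mu> = cpow (z / 2) \<mu>"
    using cpow_powr[of "z / 2" \<mu>] assms by simp
  then show ?thesis by (simp add: bessel_I_def clifford_def)
qed

lemma deriv_bessel_I_pos:
  assumes z: "z > 0"
  shows "deriv (bessel_I \<nu>) (of_real z) =
    cpow (z / 2) \<nu> * (\<nu> / of_real z * clifford \<nu> (of_real (z\<^sup>2 / 4)) + of_real (z / 2) * clifford (\<nu> + 1) (of_real (z\<^sup>2 / 4)))"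
proof -
  let ?z = "complex_of_real z"
  have nr: "?z / 2 \<notin> \<real>\<^sub>\<le>\<^sub>0" using z by (auto simp: complex_nonpos_Reals_iff)
  have e: "bessel_I \<nu> = (\<lambda>w. (w / 2) powr \<nu> * clifford \<nu> (w\<^sup>2 / 4))"
    by (simp add: fun_eq_iff bessel_I_def clifford_def)
  have "((\<lambda>w. (w / 2) powr \<nu>) has_field_derivative (\<nu> * (?z / 2) powr (\<nu> - 1)) * (1 / 2)) (at ?z)"
    by (rule DERIV_chain2[where f = "\<lambda>w. w powr \<nu>" and g = "\<lambda>w. w / 2", OF has_field_derivative_powr[OF nr]]) (auto intro!: derivative_eq_intros)
  moreover have "((\<lambda>w. clifford \<nu> (w\<^sup>2 / 4)) has_field_derivative (?z / 2) * clifford (\<nu> + 1) (?z\<^sup>2 / 4)) (at ?z)"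
    by (rule DERIV_clifford) (auto intro!: derivative_eq_intros)
  ultimately have "(bessel_I \<nu> has_field_derivative
     (\<nu> * (?z / 2) powr (\<nu> - 1)) * (1 / 2) * clifford \<nu> (?z\<^sup>2 / 4) + (?z / 2) * clifford (\<nu> + 1) (?z\<^sup>2 / 4) * (?z / 2) powr \<nu>) (at ?z)"
    unfolding e by (rule DERIV_mult)
  moreover have "(?z / 2) powr \<nu> = cpow (z / 2) \<nu>"
    using cpow_powr[of "z / 2" \<nu>] z by simp
  moreover have "(?z / 2) powr (\<nu> - 1) = cpow (z / 2) \<nu> * (2 / ?z)"
    using cpow_powr[of "z / 2" "\<nu> - 1"] cpow_add[of "z / 2" \<nu> "- 1"] z
    by (simp add: cpow_minus cpow_1)
  ultimately show ?thesis using z by (simp add: DERIV_imp_deriv algebra_simps)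
qed

lemma bessel_K_pos:
  assumes \<mu>: "Re \<mu> > 0" "\<mu> \<notin> \<int>" and z: "z > 0"
  shows "bessel_K \<mu> (of_real z) = 1 / 2 * cpow (z / 2) (- \<mu>) * macdonald \<mu> (z\<^sup>2 / 4)"
proof -
  have z4: "z\<^sup>2 / 4 = z / 2 * (z / 2)" by (simp add: power2_eq_square)
  have "cpow (z\<^sup>2 / 4) \<mu> = cpow (z / 2) \<mu> * cpow (z / 2) \<mu>" unfolding z4 using z by (intro cpow_mult) auto
  then have "cpow (z / 2) (- \<mu>) * (clifford (- \<mu>) (of_real (z\<^sup>2 / 4)) - cpow (z\<^sup>2 / 4) \<mu> * clifford \<mu> (of_real (z\<^sup>2 / 4))) =
     bessel_I (- \<mu>) (of_real z) - bessel_I \<mu> (of_real z)"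
    using z by (simp add: bessel_I_pos cpow_minus algebra_simps)
  moreover have "macdonald \<mu> (z\<^sup>2 / 4) = of_real pi / sin (of_real pi * \<mu>) *
     (clifford (- \<mu>) (of_real (z\<^sup>2 / 4)) - cpow (z\<^sup>2 / 4) \<mu> * clifford \<mu> (of_real (z\<^sup>2 / 4)))"
    using z by (intro macdonald_eq_clifford \<mu>) auto
  ultimately show ?thesis using \<mu>(2)
    by (simp add: bessel_K_def bessel_K_nonint_def mult.left_commute mult.commute)
qed

lemma cpow_sqrt_half: "x > 0 \<Longrightarrow> cpow (sqrt x / 2) a = cpow (x / 4) (a / 2)"
proof -
  assume x: "x > 0"
  have "sqrt (x / 4) = sqrt x / 2" by (simp add: real_sqrt_divide)
  then have "ln (sqrt x / 2) = ln (sqrt (x / 4))" by (simp only:)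
  also have "\<dots> = ln (x / 4) / 2" using x by (intro ln_sqrt) simp
  finally have l: "ln (sqrt x / 2) = ln (x / 4) / 2" .
  show ?thesis unfolding cpow_def l by simp
qed

lemma cpow_mu_nu:
  "cpow y (- Complex \<alpha> \<tau> / 2) * cpow y (Complex \<alpha> (- \<tau>) / 2) = cpow y (- (\<i> * of_real \<tau>))"
  unfolding cpow_add[symmetric] by (rule arg_cong[where f = "cpow y"]) (simp add: complex_eq_iff)

lemma KI_eq:
  assumes "\<alpha> > 0" "\<tau> \<noteq> 0" "x > 0"
  shows "KI \<alpha> \<tau> x = 1 / 2 * cpow (x / 4) (- (\<i> * of_real \<tau>)) *
           (macdonald (Complex \<alpha> \<tau>) (x / 4) * clifford (Complex \<alpha> (- \<tau>)) (of_real (x / 4)))"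
  unfolding KI_def using assms Complex_not_Ints[of \<tau> \<alpha>] cpow_mu_nu[of "x / 4" \<alpha> \<tau>]
  by (simp add: bessel_K_pos bessel_I_pos cpow_sqrt_half mult_ac)

lemma KI'_eq:
  assumes "\<alpha> > 0" "\<tau> \<noteq> 0" "x > 0"
  shows "of_real (1 / sqrt x) * KI' \<alpha> \<tau> x = 1 / 2 * cpow (x / 4) (- (\<i> * of_real \<tau>)) *
           (macdonald (Complex \<alpha> \<tau>) (x / 4) * (Complex \<alpha> (- \<tau>) / of_real x * clifford (Complex \<alpha> (- \<tau>)) (of_real (x / 4)) +
               1 / 2 * clifford (Complex \<alpha> (- \<tau>) + 1) (of_real (x / 4))))"
proof -
  let ?\<nu> = "Complex \<alpha> (- \<tau>)"
  let ?s = "complex_of_real (sqrt x)"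
  have s: "?s * ?s = of_real x" "?s \<noteq> 0" using assms(3) by (simp_all flip: of_real_mult)
  have "of_real (1 / sqrt x) * KI' \<alpha> \<tau> x = 1 / 2 * (cpow (x / 4) (- Complex \<alpha> \<tau> / 2) * cpow (x / 4) (?\<nu> / 2)) *
     (macdonald (Complex \<alpha> \<tau>) (x / 4) * (1 / ?s * (?\<nu> / ?s * clifford ?\<nu> (of_real (x / 4)) + ?s / 2 * clifford (?\<nu> + 1) (of_real (x / 4)))))"
    unfolding KI'_def using assms Complex_not_Ints[of \<tau> \<alpha>]
    by (simp add: bessel_K_pos deriv_bessel_I_pos cpow_sqrt_half mult_ac)
  also have "1 / ?s * (?\<nu> / ?s * clifford ?\<nu> (of_real (x / 4)) + ?s / 2 * clifford (?\<nu> + 1) (of_real (x / 4))) =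
     ?\<nu> / of_real x * clifford ?\<nu> (of_real (x / 4)) + 1 / 2 * clifford (?\<nu> + 1) (of_real (x / 4))"
    using s(2) by (simp add: s(1)[symmetric] distrib_left)
  finally show ?thesis unfolding cpow_mu_nu .
qed

lemma has_vector_derivative_scale4:
  assumes "(f has_vector_derivative f') (at (x / 4))"
  shows "((\<lambda>x. f (x / 4)) has_vector_derivative (1 / 4) *\<^sub>R f') (at x)"
proof -
  have "((\<lambda>x. x / 4) has_real_derivative 1 / 4) (at x)" by (auto intro!: derivative_eq_intros)
  then have "((\<lambda>x. x / 4) has_vector_derivative 1 / 4) (at x)"
    by (simp add: has_real_derivative_iff_has_vector_derivative)
  from vector_diff_chain_at[OF this assms] show ?thesis by (simp add: comp_def)
qed

text \<open>
  The $\tau$-dependent part of the inversion kernel, as a function of $v=x/4$: with $N_\mu=$ \<open>macdonald\<close> $\mu\,v$ and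
  $m_\nu=$ \<open>clifford\<close> $\nu\,v$ it is
  $v^{-i\tau}(\mu\nu N_\mu m_\nu+\nu vN_{\mu-1}m_\nu+\mu vN_\mu m_{\nu+1})$.
\<close>

definition kernel_core :: "real \<Rightarrow> real \<Rightarrow> real \<Rightarrow> complex" where
  "kernel_core \<alpha> \<tau> x = (let \<mu> = Complex \<alpha> \<tau>; \<nu> = Complex \<alpha> (- \<tau>); v = x / 4 in
     cpow v (- (\<i> * of_real \<tau>)) *
      (\<mu> * \<nu> * (macdonald \<mu> v * clifford \<nu> (of_real v)) + \<nu> * (of_real v * macdonald (\<mu> - 1) v * clifford \<nu> (of_real v))
        + \<mu> * (macdonald \<mu> v * (of_real v * clifford (\<nu> + 1) (of_real v)))))"

lemma KI_deriv:
  assumes \<alpha>: "\<alpha> > 0" and \<tau>: "\<tau> \<noteq> 0" and x: "x > 0"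
  defines "\<mu> \<equiv> Complex \<alpha> \<tau>" and "\<nu> \<equiv> Complex \<alpha> (- \<tau>)" and "v \<equiv> x / 4"
  shows "(KI \<alpha> \<tau> has_vector_derivative
     1 / 2 * cpow v (- (\<i> * of_real \<tau>)) / of_real x * (- (\<i> * of_real \<tau>) * (macdonald \<mu> v * clifford \<nu> (of_real v))
       - of_real v * macdonald (\<mu> - 1) v * clifford \<nu> (of_real v) + of_real v * macdonald \<mu> v * clifford (\<nu> + 1) (of_real v))) (at x)"
proof -
  let ?a = "- (\<i> * complex_of_real \<tau>)"
  let ?f = "\<lambda>v. 1 / 2 * cpow v ?a * (macdonald \<mu> v * clifford \<nu> (of_real v))"
  have v: "v > 0" using x by (simp add: v_def)
  have \<mu>: "Re \<mu> > 0" using \<alpha> by (simp add: \<mu>_def)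
  have 1: "(macdonald \<mu> has_vector_derivative - macdonald (\<mu> - 1) v) (at v)" by (rule macdonald_deriv[OF \<mu> v])
  have 2: "((\<lambda>v. clifford \<nu> (of_real v)) has_vector_derivative clifford (\<nu> + 1) (of_real v)) (at v)"
    using has_vector_derivative_real_field[OF DERIV_clifford[OF DERIV_ident]] by simp
  have "(?f has_vector_derivative
     1 / 2 * cpow v ?a * (macdonald \<mu> v * clifford (\<nu> + 1) (of_real v) + (- macdonald (\<mu> - 1) v) * clifford \<nu> (of_real v))
     + 1 / 2 * (?a * cpow v ?a / of_real v) * (macdonald \<mu> v * clifford \<nu> (of_real v))) (at v)"
    by (intro has_vector_derivative_mult has_vector_derivative_mult_right has_vector_derivative_cpow 1 2 v)
  then have "((\<lambda>x. ?f (x / 4)) has_vector_derivative (1 / 4) *\<^sub>R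
     (1 / 2 * cpow v ?a * (macdonald \<mu> v * clifford (\<nu> + 1) (of_real v) + (- macdonald (\<mu> - 1) v) * clifford \<nu> (of_real v))
     + 1 / 2 * (?a * cpow v ?a / of_real v) * (macdonald \<mu> v * clifford \<nu> (of_real v)))) (at x)"
    unfolding v_def by (rule has_vector_derivative_scale4)
  moreover have "(1 / 4) *\<^sub>R
     (1 / 2 * cpow v ?a * (macdonald \<mu> v * clifford (\<nu> + 1) (of_real v) + (- macdonald (\<mu> - 1) v) * clifford \<nu> (of_real v))
     + 1 / 2 * (?a * cpow v ?a / of_real v) * (macdonald \<mu> v * clifford \<nu> (of_real v))) =
     1 / 2 * cpow v ?a / of_real x * (?a * (macdonald \<mu> v * clifford \<nu> (of_real v))
       - of_real v * macdonald (\<mu> - 1) v * clifford \<nu> (of_real v) + of_real v * macdonald \<mu> v * clifford (\<nu> + 1) (of_real v))"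
  proof -
    have ox: "of_real x = 4 * complex_of_real v" "complex_of_real v \<noteq> 0" using v by (simp_all add: v_def)
    show ?thesis unfolding ox(1) scaleR_conv_of_real using ox(2) by (simp add: field_simps)
  qed
  ultimately have "((\<lambda>x. ?f (x / 4)) has_vector_derivative
     1 / 2 * cpow v ?a / of_real x * (?a * (macdonald \<mu> v * clifford \<nu> (of_real v))
       - of_real v * macdonald (\<mu> - 1) v * clifford \<nu> (of_real v) + of_real v * macdonald \<mu> v * clifford (\<nu> + 1) (of_real v))) (at x)"
    by simp
  then show ?thesis
  proof (rule has_vector_derivative_transform_within_open[where S = "{0<..}"])
    show "?f (y / 4) = KI \<alpha> \<tau> y" if "y \<in> {0<..}" for y
      using KI_eq[OF \<alpha> \<tau>, of y] that by (simp add: \<mu>_def \<nu>_def)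
  qed (use x in auto)
qed

text \<open>
  With $D=x\frac{d}{dx}(K_\mu I_\nu)$ and $E=xK_\mu\frac{d}{dx}I_\nu$, where the arguments are $\sqrt x$, the kernel is
  $\frac1x(\frac\alpha2+\mathrm{Re}[\alpha(D-2E)-i\tau D])$. The bracket simplifies to minus half of \<open>kernel_core\<close> because
  $\alpha-i\tau=\nu$ and $\nu-2\alpha=-\mu$.
\<close>

lemma inversion_kernel_eq:
  assumes \<alpha>: "\<alpha> > 0" and \<tau>: "\<tau> \<noteq> 0" and x: "x > 0"
  shows "inversion_kernel \<alpha> \<tau> x = (\<alpha> - Re (kernel_core \<alpha> \<tau> x)) / (2 * x)"
proof -
  define \<mu> \<nu> v where "\<mu> = Complex \<alpha> \<tau>" and "\<nu> = Complex \<alpha> (- \<tau>)" and "v = x / 4"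
  define c N m N1 m1 where "c = cpow v (- (\<i> * of_real \<tau>))" and "N = macdonald \<mu> v" and "m = clifford \<nu> (of_real v)"
    and "N1 = of_real v * macdonald (\<mu> - 1) v" and "m1 = of_real v * clifford (\<nu> + 1) (of_real v)"
  define D where "D = 1 / 2 * c * (- (\<i> * of_real \<tau>) * (N * m) - N1 * m + N * m1)"
  define E where "E = 1 / 2 * c * (N * (\<nu> * m / 2 + m1))"
  have D: "(KI \<alpha> \<tau> has_vector_derivative D / of_real x) (at x)"
    using KI_deriv[OF \<alpha> \<tau> x] unfolding D_def c_def N_def m_def N1_def m1_def \<mu>_def \<nu>_def v_def
    by (simp add: mult_ac)
  have "((\<lambda>y. Re (KI \<alpha> \<tau> y)) has_real_derivative Re (D / of_real x)) (at x)"
    unfolding has_real_derivative_iff_has_vector_derivative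
    by (rule bounded_linear.has_vector_derivative[OF bounded_linear_Re D])
  then have dR: "deriv (\<lambda>y. Re (KI \<alpha> \<tau> y)) x = Re D / x" by (simp add: DERIV_imp_deriv)
  have "((\<lambda>y. Im (KI \<alpha> \<tau> y)) has_real_derivative Im (D / of_real x)) (at x)"
    unfolding has_real_derivative_iff_has_vector_derivative
    by (rule bounded_linear.has_vector_derivative[OF bounded_linear_Im D])
  then have dI: "deriv (\<lambda>y. Im (KI \<alpha> \<tau> y)) x = Im D / x" by (simp add: DERIV_imp_deriv)
  have ox: "of_real x = 4 * complex_of_real v" "complex_of_real v \<noteq> 0" using x by (simp_all add: v_def)
  have "of_real (1 / sqrt x) * KI' \<alpha> \<tau> x = (2 * E) / of_real x"
    unfolding KI'_eq[OF \<alpha> \<tau> x] E_def c_def N_def m_def m1_def \<mu>_def[symmetric] \<nu>_def[symmetric] v_def[symmetric]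
    unfolding ox(1) using ox(2) by (simp add: field_simps)
  then have "Re (of_real (1 / sqrt x) * KI' \<alpha> \<tau> x) = Re ((2 * E) / of_real x)" by (simp only:)
  then have K': "1 / sqrt x * Re (KI' \<alpha> \<tau> x) = 2 * Re E / x" by simp
  have Z: "kernel_core \<alpha> \<tau> x = c * (\<mu> * \<nu> * (N * m) + \<nu> * (N1 * m) + \<mu> * (N * m1))"
    unfolding kernel_core_def Let_def c_def N_def m_def N1_def m1_def \<mu>_def \<nu>_def v_def by (simp add: mult_ac)
  have \<mu>': "\<mu> = of_real \<alpha> + \<i> * of_real \<tau>" and \<nu>': "\<nu> = of_real \<alpha> - \<i> * of_real \<tau>"
    by (simp_all add: \<mu>_def \<nu>_def complex_eq_iff)
  have "of_real \<alpha> * (D - 2 * E) - \<i> * of_real \<tau> * D = - (kernel_core \<alpha> \<tau> x) / 2"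
    unfolding Z D_def E_def \<mu>' \<nu>' by (simp add: field_simps)
  then have "Re (of_real \<alpha> * (D - 2 * E) - \<i> * of_real \<tau> * D) = - Re (kernel_core \<alpha> \<tau> x) / 2" by simp
  then have "\<alpha> * (Re D - 2 * Re E) + \<tau> * Im D = - Re (kernel_core \<alpha> \<tau> x) / 2" by simp
  note main = this
  have "inversion_kernel \<alpha> \<tau> x = (\<alpha> / 2 + (\<alpha> * (Re D - 2 * Re E) + \<tau> * Im D)) / x"
    unfolding inversion_kernel_def dR dI K' using x by (simp add: field_simps)
  then show ?thesis unfolding main using x by (simp add: field_simps)
qed

lemma norm_Gamma_le:
  assumes "Re z > 0"
  shows "norm (Gamma z :: complex) \<le> Gamma (Re z)"
proof -
  note G = Gamma_laplace[OF assms, of 1, simplified]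
  have "norm (Gamma z) \<le> (\<integral>s. exp (- s) * s powr (Re z - 1) \<partial>lpos)"
    unfolding G(2)[symmetric]
    by (rule Bochner_Integration.integral_norm_bound_integral[OF G(1) exp_powr_integrable[OF assms]])
       (auto simp: norm_mult norm_cpow)
  also have "\<dots> = Gamma (Re z)" using Gamma_laplace_real(2)[of "Re z" 1] assms by simp
  finally show ?thesis .
qed

lemma norm_pochhammer_ge: "\<bar>Im w\<bar> ^ n \<le> norm (pochhammer w n)"
proof (induction n)
  case (Suc n)
  have "\<bar>Im w\<bar> \<le> norm (w + of_nat n)" using abs_Im_le_cmod[of "w + of_nat n"] by simp
  from mult_mono[OF Suc this] show ?case by (simp add: pochhammer_Suc norm_mult mult.commute)
qed simp

lemma norm_sin_le: "norm (sin z :: complex) \<le> exp \<bar>Im z\<bar>"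
proof -
  have "norm (sin z) = norm (exp (\<i> * z) - exp (- (\<i> * z))) / 2"
    by (simp add: sin_exp_eq norm_divide norm_mult)
  also have "\<dots> \<le> (norm (exp (\<i> * z)) + norm (exp (- (\<i> * z)))) / 2"
    by (intro divide_right_mono norm_triangle_ineq4) auto
  also have "\<dots> \<le> (exp \<bar>Im z\<bar> + exp \<bar>Im z\<bar>) / 2"
    by (intro divide_right_mono add_mono) (auto simp: norm_exp_eq_Re)
  finally show ?thesis by simp
qed

text \<open>
  By the reflection formula $1/\Gamma(1+\nu)=\Gamma(-\nu)\sin(\pi(1+\nu))/\pi$, where the sine grows like $e^{\pi\tau}$, and
  the Gamma factor can be shifted to the right at a gain of $\tau^{-n}$ for any \<open>n\<close>. The power gained pays for the factors
  $\mu$ and $\nu$ in \<open>kernel_core\<close>.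
\<close>

lemma rGamma_vertical_bound:
  assumes \<alpha>: "\<alpha> > 0"
  shows "\<exists>C\<ge>0. \<forall>\<tau>>0. norm (rGamma (Complex \<alpha> (- \<tau>) + 1)) * (1 + \<alpha> + \<tau>) ^ 3 \<le> C * exp (pi * \<tau>)"
proof -
  let ?F = "\<lambda>\<tau>. norm (rGamma (Complex \<alpha> (- \<tau>) + 1)) * (1 + \<alpha> + \<tau>) ^ 3"
  have "continuous_on {0..1} ?F"
    unfolding Complex_eq
    by (intro continuous_intros continuous_on_compose2[OF continuous_on_rGamma[of UNIV]]) 
       (auto simp: nonpos_Ints_def)
  from compact_imp_bounded[OF compact_continuous_image[OF this compact_Icc]]
  obtain C1 where C1': "\<forall>y\<in>?F ` {0..1}. norm y \<le> C1"
    unfolding bounded_iff by (elim exE)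
  have C1: "?F \<tau> \<le> C1" if "\<tau> \<in> {0..1}" for \<tau>
    using bspec[OF C1' imageI[OF that]] unfolding real_norm_def by (rule abs_le_D1)
  \<comment> \<open>At least \<open>3\<close>, to absorb the cube, and larger than \<open>\<alpha>\<close>, to reach the half-plane of the Gamma integral.\<close>
  define n where "n = nat \<lceil>\<alpha>\<rceil> + 3"
  define C2 where "C2 = (2 + \<alpha>) ^ 3 * Gamma (real n - \<alpha>)"
  have n: "real n - \<alpha> > 0" "n \<ge> 3" unfolding n_def by linarith+
  have C2: "?F \<tau> \<le> C2 * exp (pi * \<tau>)" if \<tau>: "\<tau> \<ge> 1" for \<tau>
  proof -
    let ?z = "Complex \<alpha> (- \<tau>) + 1" and ?w = "Complex (- \<alpha>) \<tau>"
    have zw: "1 - ?z = ?w" by (simp add: complex_eq_iff)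
    have w: "?w \<notin> \<int>\<^sub>\<le>\<^sub>0" using \<tau> by (auto elim!: nonpos_Ints_cases simp: complex_eq_iff)
    have z: "?z \<notin> \<int>\<^sub>\<le>\<^sub>0" using \<tau> by (auto elim!: nonpos_Ints_cases simp: complex_eq_iff)
    have wn: "Gamma (?w + of_nat n) = pochhammer ?w n * Gamma ?w"
      using pochhammer_Gamma[OF w, of n] Gamma_nonzero[OF w] by simp
    have "norm (pochhammer ?w n) \<ge> \<tau> ^ n" using norm_pochhammer_ge[of ?w n] \<tau> by simp
    then have "\<tau> ^ n * norm (Gamma ?w) \<le> norm (Gamma (?w + of_nat n))"
      unfolding wn norm_mult by (rule mult_right_mono) auto
    also have "\<dots> \<le> Gamma (real n - \<alpha>)" using norm_Gamma_le[of "?w + of_nat n"] n by simp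
    finally have G: "\<tau> ^ n * norm (Gamma ?w) \<le> Gamma (real n - \<alpha>)" .
    have "Gamma ?z * Gamma ?w = of_real pi / sin (of_real pi * ?z)"
      using Gamma_reflection_complex[of ?z] unfolding zw .
    moreover have "sin (of_real pi * ?z) \<noteq> 0"
      using \<open>Gamma ?z * Gamma ?w = _\<close> Gamma_nonzero[OF w] Gamma_nonzero[OF z] by auto
    ultimately have "rGamma ?z = Gamma ?w * sin (of_real pi * ?z) / of_real pi"
      using Gamma_nonzero[OF z] unfolding rGamma_inverse_Gamma by (simp add: field_simps)
    then have "norm (rGamma ?z) = norm (Gamma ?w) * norm (sin (of_real pi * ?z)) / pi"
      by (simp add: norm_mult norm_divide)
    also have "\<dots> \<le> norm (Gamma ?w) * exp (pi * \<tau>) / 1"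
      using norm_sin_le[of "of_real pi * ?z"] \<tau> pi_ge_two by (intro frac_le mult_left_mono) (auto simp: abs_mult)
    finally have "?F \<tau> \<le> (norm (Gamma ?w) * exp (pi * \<tau>)) * (1 + \<alpha> + \<tau>) ^ 3"
      using \<tau> \<alpha> by (intro mult_right_mono) auto
    also have "\<dots> \<le> (norm (Gamma ?w) * exp (pi * \<tau>)) * ((2 + \<alpha>) ^ 3 * \<tau> ^ n)"
    proof (rule mult_left_mono)
      have "1 + \<alpha> \<le> (1 + \<alpha>) * \<tau>" using \<tau> \<alpha> by simp
      then have "1 + \<alpha> + \<tau> \<le> (2 + \<alpha>) * \<tau>" by (simp add: algebra_simps)
      then have "(1 + \<alpha> + \<tau>) ^ 3 \<le> ((2 + \<alpha>) * \<tau>) ^ 3" using \<tau> \<alpha> by (intro power_mono) auto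
      also have "\<dots> = (2 + \<alpha>) ^ 3 * \<tau> ^ 3" by (rule power_mult_distrib)
      also have "\<dots> \<le> (2 + \<alpha>) ^ 3 * \<tau> ^ n" using \<tau> \<alpha> n by (intro mult_left_mono power_increasing) auto
      finally show "(1 + \<alpha> + \<tau>) ^ 3 \<le> (2 + \<alpha>) ^ 3 * \<tau> ^ n" .
    qed auto
    also have "\<dots> = (2 + \<alpha>) ^ 3 * (\<tau> ^ n * norm (Gamma ?w)) * exp (pi * \<tau>)" by (simp add: mult_ac)
    also have "\<dots> \<le> (2 + \<alpha>) ^ 3 * Gamma (real n - \<alpha>) * exp (pi * \<tau>)"
      using G \<alpha> by (intro mult_right_mono mult_left_mono) auto
    finally show ?thesis unfolding C2_def .
  qed
  have C1': "?F \<tau> \<le> C1 * exp (pi * \<tau>)" if "\<tau> > 0" "\<tau> \<le> 1" for \<tau>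
  proof -
    have "0 \<le> C1" using C1[of 0] \<alpha> by (auto intro: order_trans[rotated])
    then have "C1 * 1 \<le> C1 * exp (pi * \<tau>)" using that by (intro mult_left_mono) auto
    with C1[of \<tau>] that show ?thesis by simp
  qed
  show ?thesis
  proof (intro exI[of _ "max 0 (max C1 C2)"] conjI allI impI)
    fix \<tau> :: real assume "\<tau> > 0"
    then have "?F \<tau> \<le> max C1 C2 * exp (pi * \<tau>)"
      using C1'[of \<tau>] C2[of \<tau>] by (cases "\<tau> \<le> 1") (auto simp: max_def intro: order_trans mult_right_mono)
    also have "\<dots> \<le> max 0 (max C1 C2) * exp (pi * \<tau>)" by (intro mult_right_mono) auto
    finally show "?F \<tau> \<le> max 0 (max C1 C2) * exp (pi * \<tau>)" .
  qed auto
qed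

lemma kernel_core_bound:
  assumes \<alpha>: "\<alpha> > 0"
  shows "\<exists>C\<ge>0. \<forall>\<tau>>0. \<forall>x>0. norm (kernel_core \<alpha> \<tau> x) \<le> C * exp (pi * \<tau>) * exp (x / 2)"
proof -
  obtain C where C: "C \<ge> 0" "\<forall>\<tau>>0. norm (rGamma (Complex \<alpha> (- \<tau>) + 1)) * (1 + \<alpha> + \<tau>) ^ 3 \<le> C * exp (pi * \<tau>)"
    using rGamma_vertical_bound[OF \<alpha>] by (elim exE conjE)
  show ?thesis
  proof (intro exI[of _ "3 * Gamma \<alpha> * C"] conjI allI impI)
    show "0 \<le> 3 * Gamma \<alpha> * C" using C \<alpha> by (simp add: less_imp_le[OF Gamma_real_pos])
    fix \<tau> x :: real assume \<tau>: "\<tau> > 0" and x: "x > 0"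
    define \<mu> \<nu> v where "\<mu> = Complex \<alpha> \<tau>" and "\<nu> = Complex \<alpha> (- \<tau>)" and "v = x / 4"
    define R where "R = norm (rGamma (\<nu> + 1))"
    define L where "L = 1 + \<alpha> + \<tau>"
    have v: "v > 0" using x by (simp add: v_def)
    have L1: "L \<ge> 1" using \<alpha> \<tau> by (simp add: L_def)
    have \<mu>: "Re \<mu> > 0" "Re \<nu> > 0" "Re \<mu> = \<alpha>" using \<alpha> by (simp_all add: \<mu>_def \<nu>_def)
    have nm: "norm \<mu> \<le> L" "norm \<nu> \<le> L"
      using cmod_le[of \<mu>] cmod_le[of \<nu>] \<alpha> \<tau> by (simp_all add: \<mu>_def \<nu>_def L_def)
    have N: "norm (macdonald \<mu> v) \<le> Gamma \<alpha>" "norm (of_real v * macdonald (\<mu> - 1) v) \<le> Gamma \<alpha>"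
      using norm_macdonald_le[OF \<mu>(1) v] norm_macdonald_minus_one_le[OF \<mu>(1) v] \<mu>(3) by auto
    have m: "norm (clifford \<nu> (of_real v)) \<le> R * exp (x / 2)"
    proof -
      have "norm (clifford \<nu> (of_real v)) \<le> R * exp v"
        using norm_clifford_le(1)[OF \<mu>(2), of "of_real v"] v by (simp add: R_def)
      also have "\<dots> \<le> R * exp (x / 2)" using x by (intro mult_left_mono) (auto simp: R_def v_def)
      finally show ?thesis .
    qed
    have m1: "norm (of_real v * clifford (\<nu> + 1) (of_real v)) \<le> R * exp (x / 2)"
    proof -
      have "norm (of_real v * clifford (\<nu> + 1) (of_real v)) \<le> v * (R * exp v)"
        using norm_clifford_le(2)[OF \<mu>(2), of "of_real v"] v by (simp add: R_def norm_mult mult_left_mono)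
      also have "\<dots> \<le> exp v * (R * exp v)"
      proof (rule mult_right_mono)
        show "v \<le> exp v" using exp_ge_add_one_self[of v] by linarith
      qed (auto simp: R_def)
      also have "\<dots> = R * exp (x / 2)" by (simp add: v_def mult.left_commute flip: exp_add)
      finally show ?thesis .
    qed
    have G0: "Gamma \<alpha> \<ge> 0" using \<alpha> by (simp add: less_imp_le[OF Gamma_real_pos])
    have R0: "R \<ge> 0" by (simp add: R_def)
    have c: "norm (cpow v (- (\<i> * of_real \<tau>))) = 1" using v by (simp add: norm_cpow)
    define T where "T = Gamma \<alpha> * (R * exp (x / 2))"
    have T0: "T \<ge> 0" using G0 R0 by (simp add: T_def)
    have "norm (\<mu> * \<nu> * (macdonald \<mu> v * clifford \<nu> (of_real v))) \<le> L * L * T"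
      unfolding norm_mult T_def using nm N m L1 G0 R0 by (intro mult_mono mult_nonneg_nonneg) auto
    moreover have "norm (\<nu> * (of_real v * macdonald (\<mu> - 1) v * clifford \<nu> (of_real v))) \<le> L * T"
      unfolding norm_mult[of \<nu>] norm_mult[of _ "clifford _ _"] T_def using nm N m L1 G0 R0 by (intro mult_mono mult_nonneg_nonneg) auto
    moreover have "norm (\<mu> * (macdonald \<mu> v * (of_real v * clifford (\<nu> + 1) (of_real v)))) \<le> L * T"
      unfolding norm_mult[of \<mu>] norm_mult[of "macdonald _ _"] T_def using nm N m1 L1 G0 R0 by (intro mult_mono mult_nonneg_nonneg) auto
    moreover have "L * T \<le> L ^ 3 * T" "L * L * T \<le> L ^ 3 * T"
    proof -
      have "L ^ 1 \<le> L ^ 3" "L ^ 2 \<le> L ^ 3" using L1 by (intro power_increasing; simp)+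
      then show "L * T \<le> L ^ 3 * T" "L * L * T \<le> L ^ 3 * T"
        using T0 by (auto simp: power2_eq_square intro!: mult_right_mono)
    qed
    ultimately have "norm (\<mu> * \<nu> * (macdonald \<mu> v * clifford \<nu> (of_real v)) + \<nu> * (of_real v * macdonald (\<mu> - 1) v * clifford \<nu> (of_real v))
        + \<mu> * (macdonald \<mu> v * (of_real v * clifford (\<nu> + 1) (of_real v)))) \<le> L ^ 3 * T + L ^ 3 * T + L ^ 3 * T"
      by (intro norm_triangle_le add_mono) auto
    then have "norm (kernel_core \<alpha> \<tau> x) \<le> L ^ 3 * T + L ^ 3 * T + L ^ 3 * T"
      unfolding kernel_core_def Let_def \<mu>_def[symmetric] \<nu>_def[symmetric] v_def[symmetric] norm_mult[of "cpow _ _"] c by simp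
    also have "\<dots> = 3 * Gamma \<alpha> * (R * L ^ 3) * exp (x / 2)" by (simp add: T_def mult_ac)
    also have "\<dots> \<le> 3 * Gamma \<alpha> * (C * exp (pi * \<tau>)) * exp (x / 2)"
      using C(2) \<tau> G0 by (intro mult_right_mono mult_left_mono) (auto simp: R_def L_def \<nu>_def)
    finally show "norm (kernel_core \<alpha> \<tau> x) \<le> 3 * Gamma \<alpha> * C * exp (pi * \<tau>) * exp (x / 2)" by (simp add: mult_ac)
  qed
qed

lemma measurable_snd_lpos:
  assumes "f \<in> borel_measurable (N \<Otimes>\<^sub>M borel)"
  shows "f \<in> borel_measurable (N \<Otimes>\<^sub>M lpos)"
proof -
  have "(\<lambda>z. (fst z, snd z)) \<in> N \<Otimes>\<^sub>M lpos \<rightarrow>\<^sub>M N \<Otimes>\<^sub>M borel"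
    by (intro measurable_Pair measurable_fst measurable_compose[OF measurable_snd measurable_lpos_ident])
  from measurable_compose[OF this assms] show ?thesis by simp
qed

lemma rGamma_measurable [measurable]: "rGamma \<in> borel_measurable (borel :: complex measure)"
  by (intro borel_measurable_continuous_onI continuous_intros)

lemma clifford_measurable [measurable]:
  assumes [measurable]: "f \<in> borel_measurable M" "g \<in> borel_measurable M"
  shows "(\<lambda>x. clifford (f x) (g x)) \<in> borel_measurable M"
  unfolding clifford_def by measurable

lemma macdonald_measurable [measurable]:
  assumes [measurable]: "f \<in> borel_measurable M" "g \<in> borel_measurable M"
  shows "(\<lambda>x. macdonald (f x) (g x)) \<in> borel_measurable M"
  unfolding macdonald_def
proof (rule lpos.borel_measurable_lebesgue_integral)
  show "(\<lambda>(x, s). complex_of_real (exp (- s - g x / s)) * cpow s (f x - 1)) \<in> borel_measurable (M \<Otimes>\<^sub>M lpos)"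
    by (rule measurable_snd_lpos) measurable
qed

lemma Complex_measurable [measurable]:
  assumes [measurable]: "f \<in> borel_measurable M" "g \<in> borel_measurable M"
  shows "(\<lambda>x. Complex (f x) (g x)) \<in> borel_measurable M"
  unfolding Complex_eq by measurable

lemma kernel_core_measurable [measurable]:
  assumes [measurable]: "f \<in> borel_measurable M" "g \<in> borel_measurable M"
  shows "(\<lambda>x. kernel_core \<alpha> (f x) (g x)) \<in> borel_measurable M"
  unfolding kernel_core_def Let_def by measurable

lemma continuous_on_macdonald_minus_one:
  assumes "Re \<mu> > 0"
  shows "continuous_on {0<..} (\<lambda>x. of_real x * macdonald (\<mu> - 1) x)"
proof -
  have "of_real x * macdonald (\<mu> - 1) x = (\<integral>s. of_real x * (complex_of_real (exp (- s - x / s)) * cpow s (\<mu> - 1 - 1)) \<partial>lpos)" for x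
    unfolding macdonald_def by (simp only: integral_mult_right_zero)
  moreover have "continuous_on {0<..} (\<lambda>x. \<integral>s. of_real x * (complex_of_real (exp (- s - x / s)) * cpow s (\<mu> - 1 - 1)) \<partial>lpos)"
  proof (rule continuous_on_integral_dominated[OF _ exp_powr_integrable[OF assms]])
    show "(\<lambda>s. of_real y * (complex_of_real (exp (- s - y / s)) * cpow s (\<mu> - 1 - 1))) \<in> borel_measurable lpos" for y
      by (intro borel_measurable_times macdonald_integrand_measurable) auto
    show "continuous_on {0<..} (\<lambda>y. of_real y * (complex_of_real (exp (- s - y / s)) * cpow s (\<mu> - 1 - 1)))"
      if "s \<in> space lpos" for s using that by (auto intro!: continuous_intros)
  qed (use macdonald_minus_one_integrand_le in auto)
  ultimately show ?thesis by (simp only:)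
qed

lemma continuous_on_kernel_core:
  assumes \<alpha>: "\<alpha> > 0"
  shows "continuous_on {0<..} (kernel_core \<alpha> \<tau>)"
proof -
  have \<mu>: "Re (Complex \<alpha> \<tau>) > 0" using \<alpha> by simp
  have 1: "continuous_on {0<..} (\<lambda>x. macdonald (Complex \<alpha> \<tau>) (x / 4))"
    by (rule continuous_on_compose2[OF continuous_on_macdonald[OF \<mu>]]) (auto intro!: continuous_intros)
  have 2: "continuous_on {0<..} (\<lambda>x. of_real (x / 4) * macdonald (Complex \<alpha> \<tau> - 1) (x / 4))"
    by (rule continuous_on_compose2[OF continuous_on_macdonald_minus_one[OF \<mu>], where f = "\<lambda>x. x / 4"]) (auto intro!: continuous_intros)
  show ?thesis unfolding kernel_core_def[abs_def] Let_def
    by (intro continuous_intros 1 2) auto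
qed

section \<open>Laplace transforms of the kernels\<close>

text \<open>
  The Hankel transform of $x^\alpha e^{-px}$: a multiple of $u^{2\alpha}e^{-u^2/p}$ at $u=\sinh t$.
\<close>

definition gauss_sinh :: "real \<Rightarrow> real \<Rightarrow> real \<Rightarrow> real" where
  "gauss_sinh \<alpha> p t = p powr (- (2 * \<alpha> + 1)) * sinh t powr (2 * \<alpha>) * exp (- ((sinh t)\<^sup>2 / p))"

text \<open>
  The Hankel transform of $x^{\alpha+1}e^{-px}$ at $u=\sinh t$, times the density $u\cosh t$ of the Hankel inversion
  integral in the variable \<open>t\<close>.
\<close>

definition gauss_sinh_dual :: "real \<Rightarrow> real \<Rightarrow> real \<Rightarrow> real" where
  "gauss_sinh_dual \<alpha> p t = ((2 * \<alpha> + 1) / p - (sinh t)\<^sup>2 / p\<^sup>2) * sinh t * cosh t * gauss_sinh \<alpha> p t"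

lemma sinh_measurable [measurable]: "(sinh :: real \<Rightarrow> real) \<in> borel_measurable borel"
  by (intro borel_measurable_continuous_onI continuous_intros)

lemma cosh_measurable [measurable]: "(cosh :: real \<Rightarrow> real) \<in> borel_measurable borel"
  by (intro borel_measurable_continuous_onI continuous_intros)

lemma gauss_sinh_measurable [measurable]: "gauss_sinh \<alpha> p \<in> borel_measurable borel"
  unfolding gauss_sinh_def[abs_def] by measurable

lemma gauss_sinh_dual_measurable [measurable]: "gauss_sinh_dual \<alpha> p \<in> borel_measurable borel"
  unfolding gauss_sinh_dual_def[abs_def] by measurable

lemma bij_betw_exp_subst:
  assumes "p > 0"
  shows "bij_betw (\<lambda>t. (exp (2 * t) - 1) / (4 * p)) {0<..} {0::real<..}"
proof (rule bij_betwI[where g = "\<lambda>s. ln (1 + 4 * p * s) / 2"])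
  have *: "1 + 4 * p * s > 1" if "s > 0" for s using that assms by simp
  show "(\<lambda>s. ln (1 + 4 * p * s) / 2) \<in> {0<..} \<rightarrow> {0<..}"
    using ln_gt_zero[OF *] by (auto simp: Pi_iff)
  show "(exp (2 * (ln (1 + 4 * p * s) / 2)) - 1) / (4 * p) = s" if "s \<in> {0<..}" for s
  proof -
    have "exp (ln (1 + 4 * p * s)) = 1 + 4 * p * s" using *[of s] that by (intro exp_ln) auto
    then show ?thesis using assms by simp
  qed
qed (use assms in auto)

lemma bij_betw_sinh_square: "bij_betw (\<lambda>t. (sinh t)\<^sup>2) {0<..} {0::real<..}"
proof (rule bij_betwI[where g = "\<lambda>v. arsinh (sqrt v)"])
  have "arsinh (sqrt v) > 0" if "v > 0" for v
    using that sinh_real_pos_iff[of "arsinh (sqrt v)"] by (simp add: sinh_arsinh_real)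
  then show "(\<lambda>v. arsinh (sqrt v)) \<in> {0<..} \<rightarrow> {0<..}" by auto
qed (auto simp: arsinh_sinh_real sinh_arsinh_real)

lemma sinh_square_substitution:
  fixes f :: "real \<Rightarrow> 'a::euclidean_space"
  assumes [measurable]: "f \<in> borel_measurable borel" and "integrable lpos f"
  shows "integrable lpos (\<lambda>t. (2 * sinh t * cosh t) *\<^sub>R f ((sinh t)\<^sup>2))"
    and "integral\<^sup>L lpos f = (\<integral>t. (2 * sinh t * cosh t) *\<^sub>R f ((sinh t)\<^sup>2) \<partial>lpos)"
  by (rule lpos_substitution[where g = "\<lambda>t. (sinh t)\<^sup>2" and h = "\<lambda>t. 2 * sinh t * cosh t"];
      use assms bij_betw_sinh_square in \<open>auto intro!: derivative_eq_intros\<close>)+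

lemma gauss_sinh_dual_integrable:
  assumes "\<alpha> > 0" "p > 0"
  shows "integrable lpos (gauss_sinh_dual \<alpha> p)"
proof -
  let ?f = "\<lambda>v. 1 / 2 * p powr (- (2 * \<alpha> + 1)) * (((2 * \<alpha> + 1) / p) * (exp (- (1 / p * v)) * v powr (\<alpha> + 1 - 1)) -
      1 / p\<^sup>2 * (exp (- (1 / p * v)) * v powr (\<alpha> + 2 - 1)))"
  have i: "integrable lpos ?f"
    using Gamma_laplace_real(1)[of "\<alpha> + 1" "1/p"] Gamma_laplace_real(1)[of "\<alpha> + 2" "1/p"] assms
    by (intro integrable_mult_right Bochner_Integration.integrable_diff) auto
  have "integrable lpos (\<lambda>t. (2 * sinh t * cosh t) *\<^sub>R ?f ((sinh t)\<^sup>2))"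
    by (rule sinh_square_substitution(1)[OF _ i]) measurable
  also have "?this \<longleftrightarrow> ?thesis"
  proof (rule integrable_cong_lpos)
    fix t :: real assume t: "t > 0"
    have s: "sinh t > 0" using t by simp
    have 1: "((sinh t)\<^sup>2) powr \<alpha> = sinh t powr (2 * \<alpha>)" using s by (simp add: powr_powr flip: powr_numeral)
    have 2: "((sinh t)\<^sup>2) powr (\<alpha> + 1) = sinh t powr (2 * \<alpha>) * (sinh t)\<^sup>2" using s 1 by (simp add: powr_add)
    show "(2 * sinh t * cosh t) *\<^sub>R ?f ((sinh t)\<^sup>2) = gauss_sinh_dual \<alpha> p t"
      using 1 2 by (simp add: gauss_sinh_dual_def gauss_sinh_def algebra_simps)
  qed
  finally show ?thesis .
qed

text \<open>
  With $4ps=e^{2t}-1$ and $B=p+1/(4s)$ one has $4sB=e^{2t}$ and $-s+1/(4B)=-\sinh^2(t)/p$. All remaining factors are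
  powers, and their exponents are compared after taking logarithms.
\<close>

lemma exp_substitution_identity:
  fixes \<alpha> \<tau> p t :: real
  assumes p: "p > 0" and t: "t > 0"
  defines "s \<equiv> (exp (2 * t) - 1) / (4 * p)"
  defines "B \<equiv> p + 1 / (4 * s)"
  defines "\<mu> \<equiv> Complex \<alpha> \<tau>" and "\<nu> \<equiv> Complex \<alpha> (- \<tau>)"
  shows "B > 0" "4 * s * B = exp (2 * t)" "1 / (4 * B) = (1 - exp (- 2 * t)) / (4 * p)"
    and "of_real (exp (2 * t) / (2 * p)) * (1 / 2 * cpow 4 (\<i> * of_real \<tau>) * (of_real (exp (- s)) * cpow s (\<mu> - 1)
            * (cpow B (- (\<nu> + 1)) * of_real (exp (1 / (4 * B))))))
         = exp (2 * \<i> * of_real (\<tau> * t)) * of_real (gauss_sinh \<alpha> p t)"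
proof -
  have e1: "exp (2 * t) > 1" using t by simp
  have s: "s > 0" unfolding s_def using p e1 by (intro divide_pos_pos) auto
  show B: "B > 0" unfolding B_def using p s by (simp add: add_pos_pos)
  show sB: "4 * s * B = exp (2 * t)"
    unfolding B_def using s p by (simp add: s_def field_simps)
  have B': "B = p * exp (2 * t) / (exp (2 * t) - 1)"
    using sB p e1 unfolding s_def by (simp add: field_simps)
  show y: "1 / (4 * B) = (1 - exp (- 2 * t)) / (4 * p)"
    unfolding B' using p e1 by (simp add: field_simps exp_minus)
  have sh: "sinh t > 0" using t by simp
  have e2: "exp (2 * t) - 1 = 2 * exp t * sinh t"
  proof -
    have "exp (2 * t) = exp t * exp t" by (simp flip: exp_add)
    then show ?thesis by (simp add: sinh_field_def exp_minus field_simps)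
  qed
  have ls: "ln s = t + ln (sinh t) - ln 2 - ln p"
    unfolding s_def e2 using p sh by (simp add: ln_div ln_mult ln_mult_pos ln_realpow[of 2 2, simplified])
  have lB: "ln B = ln p + t - ln 2 - ln (sinh t)"
    unfolding B' e2 using p sh by (simp add: ln_div ln_mult ln_mult_pos)
  have l4: "ln 4 = 2 * ln (2::real)" using ln_realpow[of 2 2] by simp
  have ey: "- s + 1 / (4 * B) = - ((sinh t)\<^sup>2 / p)"
  proof -
    have "exp (2 * t) = exp t * exp t" "exp (- 2 * t) = exp (- t) * exp (- t)" by (simp_all flip: exp_add)
    then show ?thesis unfolding y s_def using p
      by (simp add: sinh_field_def power2_eq_square field_simps exp_minus)
  qed
  have k: "gauss_sinh \<alpha> p t = exp (- (2 * \<alpha> + 1) * ln p + 2 * \<alpha> * ln (sinh t) + (- s + 1 / (4 * B)))"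
    unfolding ey using p sh by (simp add: gauss_sinh_def powr_def flip: exp_add)
  have pe: "exp (2 * t) / (2 * p) = exp (2 * t - ln 2 - ln p)" using p by (simp add: exp_diff)
  have h: "1 / 2 = exp (- complex_of_real (ln 2))" by (simp add: exp_minus exp_of_real flip: of_real_minus)
  have \<mu>': "\<mu> = of_real \<alpha> + \<i> * of_real \<tau>" and \<nu>': "\<nu> = of_real \<alpha> - \<i> * of_real \<tau>"
    by (simp_all add: \<mu>_def \<nu>_def complex_eq_iff)
  define y where "y = 1 / (4 * B)"
  show "of_real (exp (2 * t) / (2 * p)) * (1 / 2 * cpow 4 (\<i> * of_real \<tau>) * (of_real (exp (- s)) * cpow s (\<mu> - 1)
            * (cpow B (- (\<nu> + 1)) * of_real (exp (1 / (4 * B))))))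
         = exp (2 * \<i> * of_real (\<tau> * t)) * of_real (gauss_sinh \<alpha> p t)"
    unfolding k pe h cpow_def ls lB l4 \<mu>' \<nu>' y_def[symmetric] exp_of_real[symmetric] exp_add[symmetric]
    by (rule arg_cong[where f = exp]) (simp add: algebra_simps)
qed

text \<open>
  The three coefficients allow for the product $K_\mu I_\nu$ itself and for the three summands of \<open>kernel_core\<close>. For
  fixed \<open>s\<close> in the integral for $K_\mu$, the integral over \<open>x\<close> is a Laplace transform of a \<open>clifford\<close> function.
\<close>

lemma laplace_KI_combination:
  fixes c1 c2 c3 :: complex and \<alpha> \<tau> p :: real
  assumes \<alpha>: "\<alpha> > 0" and p: "p \<ge> 1"
  defines "\<mu> \<equiv> Complex \<alpha> \<tau>" and "\<nu> \<equiv> Complex \<alpha> (- \<tau>)"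
  defines "W \<equiv> (\<lambda>x. of_real (exp (- (p * x))) * cpow x (of_real \<alpha>) * (1 / 2 * cpow (x / 4) (- (\<i> * of_real \<tau>)) *
          (c1 * (macdonald \<mu> (x / 4) * clifford \<nu> (of_real (x / 4))) + c2 * (of_real (x / 4) * macdonald (\<mu> - 1) (x / 4) * clifford \<nu> (of_real (x / 4)))
           + c3 * (macdonald \<mu> (x / 4) * (of_real (x / 4) * clifford (\<nu> + 1) (of_real (x / 4)))))))"
  defines "b \<equiv> (\<lambda>t. c1 + c2 * of_real (exp (- 2 * t)) * (\<nu> + 1 + of_real ((1 - exp (- 2 * t)) / (4 * p))) + c3 * of_real ((1 - exp (- 2 * t)) / (4 * p)))"
  shows "integrable lpos W"
    and "integrable lpos (\<lambda>t. exp (2 * \<i> * of_real (\<tau> * t)) * of_real (gauss_sinh \<alpha> p t) * b t)"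
    and "integral\<^sup>L lpos W = (\<integral>t. exp (2 * \<i> * of_real (\<tau> * t)) * of_real (gauss_sinh \<alpha> p t) * b t \<partial>lpos)"
proof -
  let ?m = "\<lambda>x. clifford \<nu> (of_real (x / 4))" and ?m1 = "\<lambda>x. clifford (\<nu> + 1) (of_real (x / 4))"
  let ?e = "\<lambda>x s. complex_of_real (exp (- s - x / (4 * s))) * cpow s (\<mu> - 1)"
  let ?h = "\<lambda>x. of_real (exp (- (p * x))) * cpow x (of_real \<alpha>) * (1 / 2 * cpow (x / 4) (- (\<i> * of_real \<tau>)))"
  let ?g = "\<lambda>x s. ?h x * (?e x s * (c1 * ?m x + c2 * (of_real (x / (4 * s)) * ?m x) + c3 * (of_real (x / 4) * ?m1 x)))"
  have \<mu>: "Re \<mu> > 0" "Re \<mu> = \<alpha>" and \<nu>: "Re \<nu> > 0" using \<alpha> by (simp_all add: \<mu>_def \<nu>_def)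
  define R where "R = norm (rGamma (\<nu> + 1))"
  define C where "C = R * (norm c1 + norm c2 + norm c3)"
  have R0: "R \<ge> 0" by (simp add: R_def)
  have m: "(\<lambda>(x, s). ?g x s) \<in> borel_measurable (lpos \<Otimes>\<^sub>M lpos)"
    by (rule measurable_lpos_lposI) measurable
  have ia: "integrable lpos (\<lambda>x. C * (exp (- ((p - 1 / 2) * x)) * x powr (\<alpha> + 1 - 1)))"
    using p \<alpha> by (intro integrable_mult_right Gamma_laplace_real(1)) auto
  have ib: "integrable lpos (\<lambda>s. exp (- s) * s powr (\<alpha> - 1))" using exp_powr_integrable[OF \<alpha>] .
  have bd: "norm (?g x s) \<le> C * (exp (- ((p - 1 / 2) * x)) * x powr (\<alpha> + 1 - 1)) * (exp (- s) * s powr (\<alpha> - 1))"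
    if "x \<in> space lpos" "s \<in> space lpos" for x s
  proof -
    have x: "x > 0" and s: "s > 0" using that by auto
    define w where "w = x / (4 * s)"
    have w0: "w > 0" using x s by (simp add: w_def)
    have nm: "norm (?m x) \<le> R * exp (x / 2)"
    proof -
      have "norm (?m x) \<le> R * exp (x / 4)" using norm_clifford_le(1)[OF \<nu>, of "of_real (x / 4)"] x by (simp add: R_def)
      also have "\<dots> \<le> R * exp (x / 2)" using x R0 by (intro mult_left_mono) auto
      finally show ?thesis .
    qed
    have nm1: "norm (of_real (x / 4) * ?m1 x) \<le> R * exp (x / 2)"
    proof -
      have "norm (of_real (x / 4) * ?m1 x) \<le> (x / 4) * (R * exp (x / 4))"
        using norm_clifford_le(2)[OF \<nu>, of "of_real (x / 4)"] x by (simp add: R_def norm_mult mult_left_mono)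
      also have "\<dots> \<le> exp (x / 4) * (R * exp (x / 4))"
      proof (rule mult_right_mono)
        show "x / 4 \<le> exp (x / 4)" using exp_ge_add_one_self[of "x / 4"] by linarith
      qed (use R0 in auto)
      also have "\<dots> = R * exp (x / 2)" by (simp add: mult.left_commute flip: exp_add)
      finally show ?thesis .
    qed
    have ew: "exp (- w) \<le> 1" "w * exp (- w) \<le> 1" using w0 times_exp_minus_le_one by auto
    let ?X = "R * exp (x / 2)"
    have X0: "?X \<ge> 0" using R0 by simp
    have "exp (- w) * norm (c1 * ?m x + c2 * (of_real w * ?m x) + c3 * (of_real (x / 4) * ?m1 x))
       \<le> exp (- w) * (norm c1 * ?X + norm c2 * (w * ?X) + norm c3 * ?X)"
    proof (intro mult_left_mono norm_triangle_le add_mono)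
      show "norm (c1 * ?m x) \<le> norm c1 * ?X" using nm by (simp add: norm_mult mult_left_mono)
      show "norm (c2 * (of_real w * ?m x)) \<le> norm c2 * (w * ?X)" using nm w0 by (simp add: norm_mult mult_left_mono)
      show "norm (c3 * (of_real (x / 4) * ?m1 x)) \<le> norm c3 * ?X" using nm1 unfolding norm_mult[of c3] by (intro mult_left_mono) auto
    qed auto
    also have "\<dots> = norm c1 * ?X * exp (- w) + norm c2 * ?X * (w * exp (- w)) + norm c3 * ?X * exp (- w)"
      by (simp add: algebra_simps)
    also have "\<dots> \<le> norm c1 * ?X * 1 + norm c2 * ?X * 1 + norm c3 * ?X * 1"
      using X0 R0 ew by (intro add_mono mult_left_mono mult_nonneg_nonneg) auto
    finally have key: "exp (- w) * norm (c1 * ?m x + c2 * (of_real w * ?m x) + c3 * (of_real (x / 4) * ?m1 x)) \<le> C * exp (x / 2)"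
      by (simp add: C_def algebra_simps)
    have e1: "exp (- s - w) = exp (- s) * exp (- w)" by (simp flip: exp_add)
    have "norm (?g x s) = (exp (- (p * x)) * x powr \<alpha> * (1 / 2)) * ((exp (- s) * s powr (\<alpha> - 1)) *
        (exp (- w) * norm (c1 * ?m x + c2 * (of_real w * ?m x) + c3 * (of_real (x / 4) * ?m1 x))))"
      using x s \<mu>(2) unfolding w_def[symmetric] e1 norm_mult by (simp add: norm_cpow norm_mult)
    also have "\<dots> \<le> (exp (- (p * x)) * x powr \<alpha> * 1) * ((exp (- s) * s powr (\<alpha> - 1)) * (C * exp (x / 2)))"
      using x by (intro mult_mono mult_left_mono key mult_nonneg_nonneg) auto
    also have "\<dots> = C * (exp (- ((p - 1 / 2) * x)) * x powr (\<alpha> + 1 - 1)) * (exp (- s) * s powr (\<alpha> - 1))"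
    proof -
      have "exp (- ((p - 1 / 2) * x)) = exp (- (p * x)) * exp (x / 2)" by (simp add: algebra_simps flip: exp_add)
      then show ?thesis by simp
    qed
    finally show ?thesis .
  qed
  have F: "integrable lpos (\<lambda>x. \<integral>s. ?g x s \<partial>lpos)" "integrable lpos (\<lambda>s. \<integral>x. ?g x s \<partial>lpos)"
      "(\<integral>x. (\<integral>s. ?g x s \<partial>lpos) \<partial>lpos) = (\<integral>s. (\<integral>x. ?g x s \<partial>lpos) \<partial>lpos)"
    by (rule lpos2.Fubini_product_bound[OF m ia ib bd], assumption+)+
  have Is: "(\<integral>s. ?g x s \<partial>lpos) = W x" if x: "x > 0" for x
  proof -
    have v: "x / 4 > 0" using x by simp
    let ?pw = "\<lambda>s. complex_of_real (exp (- s - (x / 4) / s)) * cpow s (\<mu> - 1)"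
    let ?qw = "\<lambda>s. complex_of_real (exp (- s - (x / 4) / s)) * cpow s (\<mu> - 1 - 1)"
    have i0: "integrable lpos ?pw"
      by (rule integrable_lpos_bound[OF exp_powr_integrable[OF \<mu>(1)] macdonald_integrand_measurable])
         (use x in \<open>auto simp: norm_mult norm_cpow intro!: mult_right_mono\<close>)
    have i1: "integrable lpos (\<lambda>s. of_real (x / 4) * ?qw s)"
      by (rule integrable_lpos_bound[OF exp_powr_integrable[OF \<mu>(1)]
            borel_measurable_times[OF borel_measurable_const macdonald_integrand_measurable]
            macdonald_minus_one_integrand_le[OF v]])
    have "(\<integral>s. ?g x s \<partial>lpos) = (\<integral>s. ?h x * (c1 * ?m x * ?pw s + c2 * ?m x * (of_real (x / 4) * ?qw s) + c3 * (of_real (x / 4) * ?m1 x) * ?pw s) \<partial>lpos)"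
    proof (rule integral_cong_lpos)
      fix s :: real assume s: "s > 0"
      have "cpow s (\<mu> - 1 - 1) = cpow s (\<mu> - 1) / of_real s"
        using cpow_add[of s "\<mu> - 1" "- 1"] s by (simp add: cpow_minus cpow_1 field_simps)
      then have a: "of_real (x / 4) * ?qw s = of_real (x / (4 * s)) * ?e x s" using s by simp
      have b: "?pw s = ?e x s" by simp
      show "?g x s = ?h x * (c1 * ?m x * ?pw s + c2 * ?m x * (of_real (x / 4) * ?qw s) + c3 * (of_real (x / 4) * ?m1 x) * ?pw s)"
        unfolding a b by (simp only: algebra_simps)
    qed
    also have "\<dots> = ?h x * (c1 * ?m x * (\<integral>s. ?pw s \<partial>lpos) + c2 * ?m x * (\<integral>s. of_real (x / 4) * ?qw s \<partial>lpos) + c3 * (of_real (x / 4) * ?m1 x) * (\<integral>s. ?pw s \<partial>lpos))"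
      by (subst integral_mult_right_zero, subst Bochner_Integration.integral_add, intro Bochner_Integration.integrable_add integrable_mult_right i0 i1,
          intro integrable_mult_right i0, subst Bochner_Integration.integral_add, intro integrable_mult_right i0, intro integrable_mult_right i1)
         (simp only: integral_mult_right_zero)
    also have "(\<integral>s. of_real (x / 4) * ?qw s \<partial>lpos) = of_real (x / 4) * macdonald (\<mu> - 1) (x / 4)"
      unfolding macdonald_def by (simp only: integral_mult_right_zero)
    also have "(\<integral>s. ?pw s \<partial>lpos) = macdonald \<mu> (x / 4)" unfolding macdonald_def ..
    finally show ?thesis unfolding W_def by (simp only: algebra_simps)
  qed
  show W: "integrable lpos W" using F(1) by (subst (asm) integrable_cong_lpos[OF Is])
  define S where "S s = 1 / 2 * cpow 4 (\<i> * of_real \<tau>) * (of_real (exp (- s)) * cpow s (\<mu> - 1)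
            * (cpow (p + 1 / (4 * s)) (- (\<nu> + 1)) * of_real (exp (1 / (4 * (p + 1 / (4 * s)))))))
         * (c1 + c2 * of_real (1 / (4 * s * (p + 1 / (4 * s)))) * (\<nu> + 1 + of_real (1 / (4 * (p + 1 / (4 * s)))))
            + c3 * of_real (1 / (4 * (p + 1 / (4 * s)))))" for s
  have Ix: "(\<integral>x. ?g x s \<partial>lpos) = S s" if s: "s > 0" for s
  proof -
    define B where "B = p + 1 / (4 * s)"
    have B: "B > 0" using p s unfolding B_def by (simp add: add_pos_pos)
    let ?E = "\<lambda>x. complex_of_real (exp (- (B * x)))"
    let ?f0 = "\<lambda>x. ?E x * cpow x \<nu> * ?m x"
    let ?f1 = "\<lambda>x. ?E x * cpow x (\<nu> + 1) * ?m x"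
    let ?f2 = "\<lambda>x. ?E x * cpow x (\<nu> + 1) * ?m1 x"
    have mm: "1 / 4 * complex_of_real x = of_real (x / 4)" for x by simp
    have i0: "integrable lpos ?f0" using laplace_clifford_sums(1)[where a = "\<nu> + 1" and B = B and \<mu> = \<nu> and \<beta> = "1/4"] B \<nu> unfolding mm by simp
    have i1: "integrable lpos ?f1" using laplace_clifford_sums(1)[where a = "\<nu> + 2" and B = B and \<mu> = \<nu> and \<beta> = "1/4"] B \<nu> unfolding mm by (simp add: add_diff_eq[symmetric])
    have i2: "integrable lpos ?f2" using laplace_clifford_sums(1)[where a = "\<nu> + 2" and B = B and \<mu> = "\<nu> + 1" and \<beta> = "1/4"] B \<nu> unfolding mm by (simp add: add_diff_eq[symmetric])
    define y where "y = 1 / (4 * B)"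
    have yB: "1 / 4 / complex_of_real B = of_real y" by (simp add: y_def)
    have v0: "integral\<^sup>L lpos ?f0 = cpow B (- (\<nu> + 1)) * exp (of_real y)"
      using laplace_clifford(1)[where \<mu> = \<nu> and B = B and \<beta> = "1/4"] B \<nu> unfolding mm yB by simp
    have v1: "integral\<^sup>L lpos ?f1 = cpow B (- (\<nu> + 2)) * (\<nu> + 1 + of_real y) * exp (of_real y)"
      using laplace_clifford(2)[where \<mu> = \<nu> and B = B and \<beta> = "1/4"] B \<nu> unfolding mm yB by simp
    have v2: "integral\<^sup>L lpos ?f2 = cpow B (- (\<nu> + 2)) * exp (of_real y)"
      using laplace_clifford(1)[where \<mu> = "\<nu> + 1" and B = B and \<beta> = "1/4"] B \<nu> unfolding mm yB by (simp add: add.assoc)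
    have cB: "cpow B (- (\<nu> + 2)) = cpow B (- (\<nu> + 1)) / of_real B"
    proof -
      have e: "- (\<nu> + 2) = - (\<nu> + 1) + - 1" by simp
      have "cpow B (- 1) = inverse (of_real B)" using B by (simp only: cpow_minus cpow_1)
      then show ?thesis unfolding e cpow_add by (simp only: divide_inverse)
    qed
    let ?k = "1 / 2 * cpow 4 (\<i> * of_real \<tau>) * (complex_of_real (exp (- s)) * cpow s (\<mu> - 1))"
    have "(\<integral>x. ?g x s \<partial>lpos) = (\<integral>x. ?k * (c1 * ?f0 x + c2 * of_real (1 / (4 * s)) * ?f1 x + c3 * (1 / 4) * ?f2 x) \<partial>lpos)"
    proof (rule integral_cong_lpos)
      fix x :: real assume x: "x > 0"
      have a: "cpow x (of_real \<alpha>) * cpow (x / 4) (- (\<i> * of_real \<tau>)) = cpow 4 (\<i> * of_real \<tau>) * cpow x \<nu>"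
      proof -
        have "\<nu> = of_real \<alpha> + - (\<i> * of_real \<tau>)" by (simp add: \<nu>_def complex_eq_iff)
        then have "cpow x \<nu> = cpow x (of_real \<alpha>) * cpow x (- (\<i> * of_real \<tau>))" by (simp only: cpow_add)
        then show ?thesis using x by (simp add: cpow_divide)
      qed
      have b: "cpow x (\<nu> + 1) = cpow x \<nu> * of_real x" using x by (simp add: cpow_add cpow_1)
      have c: "complex_of_real (exp (- (p * x))) * of_real (exp (- s - x / (4 * s))) = ?E x * of_real (exp (- s))"
      proof -
        have "- (p * x) + (- s - x / (4 * s)) = - (B * x) + - s" using s by (simp add: B_def algebra_simps)
        then show ?thesis by (simp only: exp_add[symmetric] of_real_mult[symmetric])
      qed
      have "?g x s = (complex_of_real (exp (- (p * x))) * of_real (exp (- s - x / (4 * s)))) * (cpow x (of_real \<alpha>) * cpow (x / 4) (- (\<i> * of_real \<tau>)))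
           * (1 / 2 * cpow s (\<mu> - 1)) * (c1 * ?m x + c2 * (of_real (x / (4 * s)) * ?m x) + c3 * (of_real (x / 4) * ?m1 x))"
        by (simp only: mult_ac)
      also have "\<dots> = ?k * (c1 * ?f0 x + c2 * of_real (1 / (4 * s)) * ?f1 x + c3 * (1 / 4) * ?f2 x)"
        unfolding a b c by (simp add: algebra_simps)
      finally show "?g x s = \<dots>" .
    qed
    also have "\<dots> = ?k * (c1 * integral\<^sup>L lpos ?f0 + c2 * of_real (1 / (4 * s)) * integral\<^sup>L lpos ?f1 + c3 * (1 / 4) * integral\<^sup>L lpos ?f2)"
      by (subst integral_mult_right_zero, subst Bochner_Integration.integral_add, intro Bochner_Integration.integrable_add integrable_mult_right i0 i1,
          intro integrable_mult_right i2, subst Bochner_Integration.integral_add, intro integrable_mult_right i0, intro integrable_mult_right i1)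
         (simp only: integral_mult_right_zero)
    also have "\<dots> = S s"
      unfolding v0 v1 v2 cB S_def B_def[symmetric] y_def[symmetric] exp_of_real
      using B s by (simp add: y_def field_simps)
    finally show ?thesis .
  qed
  have Sm: "S \<in> borel_measurable borel" unfolding S_def[abs_def] by measurable
  have Si: "integrable lpos S" using F(2) by (subst (asm) integrable_cong_lpos[OF Ix])
  have p0: "p > 0" using p by simp
  let ?st = "\<lambda>t. (exp (2 * t) - 1) / (4 * p)"
  note sub = lpos_substitution[where g = ?st and h = "\<lambda>t. exp (2 * t) / (2 * p)", OF Sm Si _ _ _ _ bij_betw_exp_subst[OF p0]]
  have eq: "(exp (2 * t) / (2 * p)) *\<^sub>R S (?st t) = exp (2 * \<i> * of_real (\<tau> * t)) * of_real (gauss_sinh \<alpha> p t) * b t" if t: "t > 0" for t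
  proof -
    note I = exp_substitution_identity[OF p0 t]
    have "1 / exp (2 * t) = exp (- 2 * t)" by (simp add: exp_minus inverse_eq_divide)
    then have I2: "1 / (4 * ?st t * (p + 1 / (4 * ?st t))) = exp (- 2 * t)" unfolding I(2) .
    have "(exp (2 * t) / (2 * p)) *\<^sub>R S (?st t) = (of_real (exp (2 * t) / (2 * p)) * (1 / 2 * cpow 4 (\<i> * of_real \<tau>) * (of_real (exp (- ?st t)) * cpow (?st t) (\<mu> - 1)
            * (cpow (p + 1 / (4 * ?st t)) (- (\<nu> + 1)) * of_real (exp (1 / (4 * (p + 1 / (4 * ?st t)))))))))
         * (c1 + c2 * of_real (1 / (4 * ?st t * (p + 1 / (4 * ?st t)))) * (\<nu> + 1 + of_real (1 / (4 * (p + 1 / (4 * ?st t)))))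
            + c3 * of_real (1 / (4 * (p + 1 / (4 * ?st t)))))"
      unfolding S_def scaleR_conv_of_real by (simp only: mult.assoc)
    also have "\<dots> = (exp (2 * \<i> * of_real (\<tau> * t)) * of_real (gauss_sinh \<alpha> p t)) * b t"
      unfolding \<mu>_def \<nu>_def I(4) I2 unfolding I(3) b_def \<nu>_def ..
    finally show ?thesis .
  qed
  have d: "(?st has_field_derivative exp (2 * t) / (2 * p)) (at t)" for t
    using p0 by (auto intro!: derivative_eq_intros)
  have "integrable lpos (\<lambda>t. (exp (2 * t) / (2 * p)) *\<^sub>R S (?st t))"
    by (rule sub(1)) (use d p0 in auto)
  then show "integrable lpos (\<lambda>t. exp (2 * \<i> * of_real (\<tau> * t)) * of_real (gauss_sinh \<alpha> p t) * b t)"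
    by (subst (asm) integrable_cong_lpos[OF eq])
  have "integral\<^sup>L lpos W = (\<integral>x. (\<integral>s. ?g x s \<partial>lpos) \<partial>lpos)" by (rule integral_cong_lpos) (rule Is[symmetric])
  also have "\<dots> = (\<integral>s. (\<integral>x. ?g x s \<partial>lpos) \<partial>lpos)" by (rule F(3))
  also have "\<dots> = integral\<^sup>L lpos S" by (rule integral_cong_lpos) (rule Ix)
  also have "\<dots> = (\<integral>t. (exp (2 * t) / (2 * p)) *\<^sub>R S (?st t) \<partial>lpos)"
    by (rule sub(2)) (use d p0 in auto)
  also have "\<dots> = (\<integral>t. exp (2 * \<i> * of_real (\<tau> * t)) * of_real (gauss_sinh \<alpha> p t) * b t \<partial>lpos)"
    by (rule integral_cong_lpos) (rule eq)
  finally show "integral\<^sup>L lpos W = (\<integral>t. exp (2 * \<i> * of_real (\<tau> * t)) * of_real (gauss_sinh \<alpha> p t) * b t \<partial>lpos)" .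
qed

lemma laplace_KI:
  assumes \<alpha>: "\<alpha> > 0" and \<tau>: "\<tau> \<noteq> 0" and p: "p \<ge> 1"
  shows "integrable lpos (\<lambda>x. of_real (exp (- (p * x))) * cpow x (of_real \<alpha>) * KI \<alpha> \<tau> x)"
    and "(\<integral>x. of_real (exp (- (p * x))) * cpow x (of_real \<alpha>) * KI \<alpha> \<tau> x \<partial>lpos) =
         (\<integral>t. exp (2 * \<i> * of_real (\<tau> * t)) * of_real (gauss_sinh \<alpha> p t) \<partial>lpos)"
proof -
  note L = laplace_KI_combination[OF \<alpha> p, of \<tau> 1 0 0]
  have e: "of_real (exp (- (p * x))) * cpow x (of_real \<alpha>) * (1 / 2 * cpow (x / 4) (- (\<i> * of_real \<tau>)) *
          (1 * (macdonald (Complex \<alpha> \<tau>) (x / 4) * clifford (Complex \<alpha> (- \<tau>)) (of_real (x / 4))) + 0 * (of_real (x / 4) * macdonald (Complex \<alpha> \<tau> - 1) (x / 4) * clifford (Complex \<alpha> (- \<tau>)) (of_real (x / 4)))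
           + 0 * (macdonald (Complex \<alpha> \<tau>) (x / 4) * (of_real (x / 4) * clifford (Complex \<alpha> (- \<tau>) + 1) (of_real (x / 4)))))) =
      of_real (exp (- (p * x))) * cpow x (of_real \<alpha>) * KI \<alpha> \<tau> x" if "x > 0" for x
    using KI_eq[OF \<alpha> \<tau> that] by simp
  show "integrable lpos (\<lambda>x. of_real (exp (- (p * x))) * cpow x (of_real \<alpha>) * KI \<alpha> \<tau> x)"
    using L(1) by (subst (asm) integrable_cong_lpos[OF e])
  show "(\<integral>x. of_real (exp (- (p * x))) * cpow x (of_real \<alpha>) * KI \<alpha> \<tau> x \<partial>lpos) =
         (\<integral>t. exp (2 * \<i> * of_real (\<tau> * t)) * of_real (gauss_sinh \<alpha> p t) \<partial>lpos)"
    using L(3) by (subst (asm) integral_cong_lpos[OF e]) simp_all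
qed

lemma gauss_sinh_has_derivative:
  assumes p: "p > 0" and t: "t > 0"
  shows "(gauss_sinh \<alpha> p has_real_derivative (2 * \<alpha> * cosh t / sinh t - 2 * sinh t * cosh t / p) * gauss_sinh \<alpha> p t) (at t)"
proof -
  have s: "sinh t > 0" using t by simp
  have d: "(sinh has_real_derivative cosh t) (at t)" by (auto intro!: derivative_eq_intros)
  have "((\<lambda>t. sinh t powr (2 * \<alpha>)) has_real_derivative 2 * \<alpha> * sinh t powr (2 * \<alpha> - 1) * cosh t) (at t)"
    by (rule DERIV_chain2[OF has_real_derivative_powr[OF s] d])
  moreover have "sinh t powr (2 * \<alpha> - 1) = sinh t powr (2 * \<alpha>) / sinh t" using s by (simp add: powr_diff)
  ultimately have 1: "((\<lambda>t. sinh t powr (2 * \<alpha>)) has_real_derivative (2 * \<alpha> * cosh t / sinh t) * sinh t powr (2 * \<alpha>)) (at t)"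
    by (simp add: mult_ac)
  have 2: "((\<lambda>t. exp (- ((sinh t)\<^sup>2 / p))) has_real_derivative - (2 * sinh t * cosh t / p) * exp (- ((sinh t)\<^sup>2 / p))) (at t)"
    using p by (auto intro!: derivative_eq_intros)
  have "((\<lambda>t. p powr (- (2 * \<alpha> + 1)) * (sinh t powr (2 * \<alpha>) * exp (- ((sinh t)\<^sup>2 / p)))) has_real_derivative
     p powr (- (2 * \<alpha> + 1)) * ((2 * \<alpha> * cosh t / sinh t) * sinh t powr (2 * \<alpha>) * exp (- ((sinh t)\<^sup>2 / p)) +
       - (2 * sinh t * cosh t / p) * exp (- ((sinh t)\<^sup>2 / p)) * sinh t powr (2 * \<alpha>))) (at t)"
    by (intro DERIV_cmult DERIV_mult 1 2)
  then show ?thesis unfolding gauss_sinh_def[abs_def] by (simp add: algebra_simps)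
qed

lemma filterlim_sinh_at_right_0: "filterlim sinh (at_right (0::real)) (at_right 0)"
proof -
  have "((sinh :: real \<Rightarrow> real) \<longlongrightarrow> sinh 0) (at 0)"
    using isCont_sinh[where 'a = real, of 0] by (simp only: isCont_def)
  then have "((sinh :: real \<Rightarrow> real) \<longlongrightarrow> 0) (at_right 0)"
    by (auto intro: tendsto_within_subset)
  then show ?thesis
    by (auto simp: filterlim_at eventually_at_filter)
qed

text \<open>
  The function $\omega$ is found by removing the powers of $i\tau$ from the Laplace transform of \<open>kernel_core\<close> one at a time,
  through $2i\tau e^{2i\tau t}=\frac{d}{dt}e^{2i\tau t}$; the identity says that what is left is \<open>gauss_sinh_dual\<close>.
  In terms of $e^t$ it is an identity between rational functions.
\<close>

lemma by_parts_identity: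
  fixes \<alpha> \<tau> p t :: real
  assumes p: "p > 0" and t: "t > 0"
  defines "q \<equiv> exp (- 2 * t)" and "u \<equiv> sinh t" and "c \<equiv> cosh t"
  defines "y \<equiv> (1 - q) / (4 * p)" and "\<mu> \<equiv> Complex \<alpha> \<tau>" and "\<nu> \<equiv> Complex \<alpha> (- \<tau>)"
  defines "\<omega> \<equiv> of_real (\<alpha> * q / 2 - (\<alpha> - u\<^sup>2 / p) / 2) + \<i> * of_real (\<tau> * (1 - q) / 2)"
  shows "\<mu> * \<nu> + \<nu> * of_real q * (\<nu> + 1 + of_real y) + \<mu> * of_real y + 2 * \<i> * of_real \<tau> * \<omega>
       + (of_real (- \<alpha> * q + u * c / p) + \<i> * of_real (\<tau> * q)) + of_real (2 * \<alpha> * c / u - 2 * u * c / p) * \<omega>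
       = of_real (((2 * \<alpha> + 1) / p - u\<^sup>2 / p\<^sup>2) * u * c)"
proof -
  define E where "E = exp t"
  have E: "E > 1" using t by (simp add: E_def)
  have q: "q = 1 / (E * E)" unfolding q_def E_def by (simp add: exp_minus inverse_eq_divide flip: exp_add)
  have u: "u = (E * E - 1) / (2 * E)" and c: "c = (E * E + 1) / (2 * E)"
    using E unfolding u_def c_def E_def by (simp_all add: sinh_field_def cosh_field_def exp_minus field_simps)
  have nz: "E \<noteq> 0" "E * E - 1 \<noteq> 0" "p \<noteq> 0"
    using E p mult_strict_mono[of 1 E 1 E] by auto
  have cu: "c / u = (E * E + 1) / (E * E - 1)" unfolding c u using nz by (simp add: field_simps)
  have Re: "\<alpha>\<^sup>2 + \<tau>\<^sup>2 + q * (\<alpha> * (\<alpha> + 1 + y) - \<tau>\<^sup>2) + \<alpha> * y - 2 * \<tau> * (\<tau> * (1 - q) / 2)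
       + (- \<alpha> * q + u * c / p) + (2 * \<alpha> * (c / u) - 2 * u * c / p) * (\<alpha> * q / 2 - (\<alpha> - u\<^sup>2 / p) / 2)
     = ((2 * \<alpha> + 1) / p - u\<^sup>2 / p\<^sup>2) * u * c"
    unfolding cu unfolding y_def q u c using nz by (simp add: divide_simps) algebra
  have Im: "q * (- \<alpha> * \<tau> - \<tau> * (\<alpha> + 1 + y)) + \<tau> * y + 2 * \<tau> * (\<alpha> * q / 2 - (\<alpha> - u\<^sup>2 / p) / 2)
       + \<tau> * q + (2 * \<alpha> * (c / u) - 2 * u * c / p) * (\<tau> * (1 - q) / 2) = 0"
    unfolding cu unfolding y_def q u c using nz by (simp add: divide_simps) algebra
  have u0: "u \<noteq> 0" using t by (simp add: u_def)
  show ?thesis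
    using Re Im u0 unfolding \<mu>_def \<nu>_def \<omega>_def complex_eq_iff
    by (simp add: algebra_simps power2_eq_square add_divide_distrib diff_divide_distrib)
qed

text \<open>
  One integration by parts, with boundary terms that vanish since $\sinh^{2\alpha}t\to0$ as $t\to0$.
\<close>

lemma laplace_kernel_core:
  assumes \<alpha>: "\<alpha> > 0" and p: "p \<ge> 1"
  shows "integrable lpos (\<lambda>x. of_real (exp (- (p * x))) * cpow x (of_real \<alpha>) * kernel_core \<alpha> \<tau> x)"
    and "(\<integral>x. of_real (exp (- (p * x))) * cpow x (of_real \<alpha>) * kernel_core \<alpha> \<tau> x \<partial>lpos) =
         2 * (\<integral>t. exp (2 * \<i> * of_real (\<tau> * t)) * of_real (gauss_sinh_dual \<alpha> p t) \<partial>lpos)"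
proof -
  define \<mu> \<nu> where "\<mu> = Complex \<alpha> \<tau>" and "\<nu> = Complex \<alpha> (- \<tau>)"
  have p0: "p > 0" using p by simp
  let ?e = "\<lambda>t. exp (2 * \<i> * complex_of_real (\<tau> * t))"
  let ?b = "\<lambda>t. \<mu> * \<nu> + \<nu> * of_real (exp (- 2 * t)) * (\<nu> + 1 + of_real ((1 - exp (- 2 * t)) / (4 * p))) + \<mu> * of_real ((1 - exp (- 2 * t)) / (4 * p))"
  note L = laplace_KI_combination[OF \<alpha> p, of \<tau> "\<mu> * \<nu>" \<nu> \<mu>, folded \<mu>_def \<nu>_def]
  have e: "of_real (exp (- (p * x))) * cpow x (of_real \<alpha>) * (1 / 2 * cpow (x / 4) (- (\<i> * of_real \<tau>)) *
          (\<mu> * \<nu> * (macdonald \<mu> (x / 4) * clifford \<nu> (of_real (x / 4))) + \<nu> * (of_real (x / 4) * macdonald (\<mu> - 1) (x / 4) * clifford \<nu> (of_real (x / 4)))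
           + \<mu> * (macdonald \<mu> (x / 4) * (of_real (x / 4) * clifford (\<nu> + 1) (of_real (x / 4)))))) =
      1 / 2 * (of_real (exp (- (p * x))) * cpow x (of_real \<alpha>) * kernel_core \<alpha> \<tau> x)" for x
    unfolding kernel_core_def Let_def \<mu>_def \<nu>_def by (simp only: mult_ac)
  have i: "integrable lpos (\<lambda>x. 1 / 2 * (of_real (exp (- (p * x))) * cpow x (of_real \<alpha>) * kernel_core \<alpha> \<tau> x))"
    using L(1) unfolding e .
  show int: "integrable lpos (\<lambda>x. of_real (exp (- (p * x))) * cpow x (of_real \<alpha>) * kernel_core \<alpha> \<tau> x)"
    using integrable_mult_right[OF i, of 2] by simp
  have 1: "1 / 2 * (\<integral>x. of_real (exp (- (p * x))) * cpow x (of_real \<alpha>) * kernel_core \<alpha> \<tau> x \<partial>lpos) =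
     (\<integral>t. ?e t * of_real (gauss_sinh \<alpha> p t) * ?b t \<partial>lpos)"
    using L(3) unfolding e integral_mult_right_zero .
  let ?\<omega> = "\<lambda>t. complex_of_real (\<alpha> * exp (- 2 * t) / 2 - (\<alpha> - (sinh t)\<^sup>2 / p) / 2) + \<i> * of_real (\<tau> * (1 - exp (- 2 * t)) / 2)"
  let ?F = "\<lambda>t. ?e t * (of_real (gauss_sinh \<alpha> p t) * ?\<omega> t)"
  let ?f = "\<lambda>t. ?e t * of_real (gauss_sinh_dual \<alpha> p t) - ?e t * of_real (gauss_sinh \<alpha> p t) * ?b t"
  have ie: "integrable lpos (\<lambda>t. ?e t * of_real (gauss_sinh_dual \<alpha> p t))"
  proof (rule integrable_lpos_bound[where g = "\<lambda>t. \<bar>gauss_sinh_dual \<alpha> p t\<bar>"])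
    show "integrable lpos (\<lambda>t. \<bar>gauss_sinh_dual \<alpha> p t\<bar>)" using gauss_sinh_dual_integrable[OF \<alpha> p0] by (rule integrable_abs)
    show "(\<lambda>t. ?e t * of_real (gauss_sinh_dual \<alpha> p t)) \<in> borel_measurable lpos" by (rule measurable_lposI) measurable
  qed (simp add: norm_mult norm_exp_eq_Re)
  have if': "integrable lpos ?f" using ie L(2) by (rule Bochner_Integration.integrable_diff)
  have dF: "(?F has_vector_derivative ?f t) (at t)" if t: "t > 0" for t
  proof -
    have d1: "(?e has_vector_derivative 2 * \<i> * of_real \<tau> * ?e t) (at t)"
    proof -
      have "((\<lambda>t. 2 * \<i> * complex_of_real (\<tau> * t)) has_vector_derivative 2 * \<i> * of_real \<tau>) (at t)"
        by (intro has_vector_derivative_mult_right has_vector_derivative_of_real)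
           (auto intro!: derivative_eq_intros)
      from field_vector_diff_chain_at[OF this, of exp "exp (2 * \<i> * complex_of_real (\<tau> * t))"]
      show ?thesis by (simp add: comp_def)
    qed
    have d2: "((\<lambda>t. complex_of_real (gauss_sinh \<alpha> p t)) has_vector_derivative of_real ((2 * \<alpha> * cosh t / sinh t - 2 * sinh t * cosh t / p) * gauss_sinh \<alpha> p t)) (at t)"
      by (intro has_vector_derivative_of_real gauss_sinh_has_derivative p0 t)
    have d3: "(?\<omega> has_vector_derivative of_real (- \<alpha> * exp (- 2 * t) + sinh t * cosh t / p) + \<i> * of_real (\<tau> * exp (- 2 * t))) (at t)"
      by (intro has_vector_derivative_add has_vector_derivative_mult_right has_vector_derivative_of_real)
         (use p0 in \<open>auto intro!: derivative_eq_intros\<close>)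
    have "(?F has_vector_derivative ?e t * (of_real (gauss_sinh \<alpha> p t) * (of_real (- \<alpha> * exp (- 2 * t) + sinh t * cosh t / p) + \<i> * of_real (\<tau> * exp (- 2 * t)))
        + of_real ((2 * \<alpha> * cosh t / sinh t - 2 * sinh t * cosh t / p) * gauss_sinh \<alpha> p t) * ?\<omega> t)
        + (2 * \<i> * of_real \<tau> * ?e t) * (of_real (gauss_sinh \<alpha> p t) * ?\<omega> t)) (at t)"
      by (intro has_vector_derivative_mult d1 d2 d3)
    moreover have "?e t * (of_real (gauss_sinh \<alpha> p t) * (of_real (- \<alpha> * exp (- 2 * t) + sinh t * cosh t / p) + \<i> * of_real (\<tau> * exp (- 2 * t)))
        + of_real ((2 * \<alpha> * cosh t / sinh t - 2 * sinh t * cosh t / p) * gauss_sinh \<alpha> p t) * ?\<omega> t)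
        + (2 * \<i> * of_real \<tau> * ?e t) * (of_real (gauss_sinh \<alpha> p t) * ?\<omega> t)
       = ?e t * of_real (gauss_sinh \<alpha> p t) * ((?b t + 2 * \<i> * of_real \<tau> * ?\<omega> t
         + (of_real (- \<alpha> * exp (- 2 * t) + sinh t * cosh t / p) + \<i> * of_real (\<tau> * exp (- 2 * t)))
         + of_real (2 * \<alpha> * cosh t / sinh t - 2 * sinh t * cosh t / p) * ?\<omega> t) - ?b t)"
    proof -
      have gen: "e * (k * D + (r * k) * w) + (c * e) * (k * w) = e * k * ((b + c * w + D + r * w) - b)"
        for e k D r w c b :: complex by (simp add: algebra_simps)
      show ?thesis
        unfolding of_real_mult[of "2 * \<alpha> * cosh t / sinh t - 2 * sinh t * cosh t / p" "gauss_sinh \<alpha> p t"] by (rule gen)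
    qed
    moreover have "\<dots> = ?f t"
      unfolding by_parts_identity[OF p0 t, of \<alpha> \<tau>, folded \<mu>_def \<nu>_def] gauss_sinh_dual_def
      by (simp add: algebra_simps)
    ultimately show ?thesis by simp
  qed
  let ?g = "\<lambda>u. p powr (- (2 * \<alpha> + 1)) * (u powr (2 * \<alpha>) * exp (- (u\<^sup>2 / p)) * (2 * \<alpha> + \<bar>\<tau>\<bar> + u\<^sup>2 / p))"
  have nF: "norm (?F t) \<le> ?g (sinh t)" if t: "t > 0" for t
  proof -
    have q: "exp (- 2 * t) > 0" "exp (- 2 * t) \<le> 1" using t by auto
    have "norm (?\<omega> t) \<le> \<bar>\<alpha> * exp (- 2 * t) / 2 - (\<alpha> - (sinh t)\<^sup>2 / p) / 2\<bar> + \<bar>\<tau> * (1 - exp (- 2 * t)) / 2\<bar>"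
      by (rule norm_triangle_le) (simp add: norm_mult del: of_real_diff of_real_divide of_real_mult)
    also have "\<bar>\<tau> * (1 - exp (- 2 * t)) / 2\<bar> \<le> \<bar>\<tau>\<bar>"
    proof -
      have "\<bar>\<tau>\<bar> * (1 - exp (- 2 * t)) \<le> \<bar>\<tau>\<bar> * 1" using q by (intro mult_left_mono) auto
      then show ?thesis using q by (simp add: abs_mult)
    qed
    also have "\<bar>\<alpha> * exp (- 2 * t) / 2 - (\<alpha> - (sinh t)\<^sup>2 / p) / 2\<bar> \<le> 2 * \<alpha> + (sinh t)\<^sup>2 / p"
    proof -
      have "\<alpha> * exp (- 2 * t) \<le> \<alpha> * 1" "\<alpha> * exp (- 2 * t) \<ge> 0" "(sinh t)\<^sup>2 / p \<ge> 0"
        using q \<alpha> p0 by (auto intro!: mult_left_mono)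
      moreover have "\<bar>Z / 2 - (a - X) / 2\<bar> \<le> 2 * a + X" if "Z \<le> a * 1" "Z \<ge> 0" "X \<ge> 0" "a > 0" for a X Z :: real
        using that by (intro abs_leI) (simp_all add: field_simps)
      ultimately show ?thesis using \<alpha> by blast
    qed
    finally have w: "norm (?\<omega> t) \<le> 2 * \<alpha> + \<bar>\<tau>\<bar> + (sinh t)\<^sup>2 / p" by simp
    have k0: "gauss_sinh \<alpha> p t \<ge> 0" by (simp add: gauss_sinh_def)
    have "norm (?F t) = gauss_sinh \<alpha> p t * norm (?\<omega> t)" using k0 by (simp add: norm_mult norm_exp_eq_Re)
    also have "\<dots> \<le> gauss_sinh \<alpha> p t * (2 * \<alpha> + \<bar>\<tau>\<bar> + (sinh t)\<^sup>2 / p)" by (intro mult_left_mono w k0)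
    finally show ?thesis by (simp add: gauss_sinh_def)
  qed
  have g0: "(?g \<longlongrightarrow> 0) (at_right 0)"
  proof -
    have "((\<lambda>u. u powr (2 * \<alpha>)) \<longlongrightarrow> 0) (at_right (0::real))" using \<alpha> by real_asymp
    moreover have "((\<lambda>u. exp (- (u\<^sup>2 / p)) * (2 * \<alpha> + \<bar>\<tau>\<bar> + u\<^sup>2 / p)) \<longlongrightarrow> exp (- (0\<^sup>2 / p)) * (2 * \<alpha> + \<bar>\<tau>\<bar> + 0\<^sup>2 / p)) (at_right 0)"
      using p0 by (intro tendsto_intros) auto
    ultimately have "((\<lambda>u. p powr (- (2 * \<alpha> + 1)) * (u powr (2 * \<alpha>) * (exp (- (u\<^sup>2 / p)) * (2 * \<alpha> + \<bar>\<tau>\<bar> + u\<^sup>2 / p)))) \<longlongrightarrow>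
      p powr (- (2 * \<alpha> + 1)) * (0 * (exp (- (0\<^sup>2 / p)) * (2 * \<alpha> + \<bar>\<tau>\<bar> + 0\<^sup>2 / p)))) (at_right 0)"
      by (rule tendsto_mult[OF tendsto_const tendsto_mult])
    then show ?thesis by (simp only: mult_zero_left mult_zero_right mult.assoc)
  qed
  have g1: "(?g \<longlongrightarrow> 0) at_top"
  proof -
    have "((\<lambda>u. u powr (2 * \<alpha>) * exp (- (u\<^sup>2 / p)) * (2 * \<alpha> + \<bar>\<tau>\<bar> + u\<^sup>2 / p)) \<longlongrightarrow> 0) at_top"
      using p0 \<alpha> by real_asymp
    then show ?thesis by (rule tendsto_mult_right_zero)
  qed
  have F0: "(?F \<longlongrightarrow> 0) (at_right 0)"
  proof (rule Lim_null_comparison)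
    show "((\<lambda>t. ?g (sinh t)) \<longlongrightarrow> 0) (at_right 0)" by (rule filterlim_compose[OF g0 filterlim_sinh_at_right_0])
    show "\<forall>\<^sub>F t in at_right 0. norm (?F t) \<le> ?g (sinh t)"
      unfolding eventually_at_filter by (intro always_eventually allI impI nF) simp
  qed
  have F1: "(?F \<longlongrightarrow> 0) at_top"
  proof (rule Lim_null_comparison)
    show "((\<lambda>t. ?g (sinh t)) \<longlongrightarrow> 0) at_top" by (rule filterlim_compose[OF g1 sinh_real_at_top])
    show "\<forall>\<^sub>F t in at_top. norm (?F t) \<le> ?g (sinh t)"
      using eventually_gt_at_top[of 0] by (rule eventually_mono) (rule nF)
  qed
  have "(LBINT t=ereal 0..\<infinity>. ?f t) = 0 - 0"
  proof (rule interval_integral_FTC_integrable)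
    fix t assume "ereal 0 < ereal t" "ereal t < \<infinity>"
    then have t: "t > 0" by simp
    show "(?F has_vector_derivative ?f t) (at t)" by (rule dF[OF t])
    have "continuous_on {0<..} ?f"
      unfolding gauss_sinh_dual_def gauss_sinh_def by (intro continuous_intros) (use p0 in auto)
    then show "isCont ?f t" using t by (simp add: continuous_on_eq_continuous_at)
  next
    show "set_integrable lborel (einterval (ereal 0) \<infinity>) ?f"
      using if' by (simp add: einterval_pos integrable_lpos_iff)
    show "((?F \<circ> real_of_ereal) \<longlongrightarrow> 0) (at_right (ereal 0))"
      using F0 unfolding zero_ereal_def[symmetric] by (simp only: ereal_tendsto_simps zero_ereal_def)
    show "((?F \<circ> real_of_ereal) \<longlongrightarrow> 0) (at_left \<infinity>)"
      using F1 by (simp only: ereal_tendsto_simps)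
  qed simp
  then have "integral\<^sup>L lpos ?f = 0"
    unfolding interval_lebesgue_integral_def integral_lpos by (simp add: einterval_pos)
  then have "(\<integral>t. ?e t * of_real (gauss_sinh \<alpha> p t) * ?b t \<partial>lpos) = (\<integral>t. ?e t * of_real (gauss_sinh_dual \<alpha> p t) \<partial>lpos)"
    using ie L(2) by (simp add: Bochner_Integration.integral_diff)
  with 1 show "(\<integral>x. of_real (exp (- (p * x))) * cpow x (of_real \<alpha>) * kernel_core \<alpha> \<tau> x \<partial>lpos) =
         2 * (\<integral>t. ?e t * of_real (gauss_sinh_dual \<alpha> p t) \<partial>lpos)" by simp
qed

section \<open>The Bessel function of order twice alpha\<close>

text \<open>
  The real restriction, needed for the differential inequality below.
\<close>

definition clifford_real :: "real \<Rightarrow> real \<Rightarrow> real" where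
  "clifford_real l v = (\<Sum>k. v ^ k * rGamma (l + real k + 1) / fact k)"

lemma clifford_real_summable: "summable (\<lambda>k. v ^ k * rGamma (l + real k + 1) / fact k)" for l v :: real
proof -
  have "norm (v ^ k * rGamma (l + real k + 1) / fact k) =
     norm (of_real v ^ k * rGamma (of_real l + of_nat k + 1) / fact k :: complex)" for k
    using rGamma_complex_of_real[of "l + real k + 1"]
    by (simp add: norm_mult norm_divide norm_power abs_mult power_abs)
  then show ?thesis
    using clifford_summable[of "of_real v" "of_real l"] by (intro summable_norm_cancel[of "\<lambda>k. v ^ k * rGamma (l + real k + 1) / fact k"]) simp
qed

lemma of_real_clifford_real: "complex_of_real (clifford_real l v) = clifford (of_real l) (of_real v)"
proof -
  have "complex_of_real (v ^ k * rGamma (l + real k + 1) / fact k) =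
     of_real v ^ k * rGamma (of_real l + of_nat k + 1) / fact k" for k
    using rGamma_complex_of_real[of "l + real k + 1"] by simp
  then show ?thesis
    unfolding clifford_real_def clifford_def suminf_of_real[OF clifford_real_summable] by (simp only:)
qed

lemma clifford_real_rec: "clifford_real l v = (l + 1) * clifford_real (l + 1) v + v * clifford_real (l + 2) v"
proof -
  have "complex_of_real (clifford_real l v) = of_real ((l + 1) * clifford_real (l + 1) v + v * clifford_real (l + 2) v)"
    using clifford_rec[of "of_real l" "of_real v"] by (simp add: of_real_clifford_real)
  then show ?thesis by (simp only: of_real_eq_iff)
qed

lemma DERIV_clifford_real: "(clifford_real l has_real_derivative clifford_real (l + 1) v) (at v)"
proof -
  have "((\<lambda>v. clifford (of_real l) (of_real v)) has_vector_derivative clifford (of_real l + 1) (of_real v)) (at v)"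
    using has_vector_derivative_real_field[OF DERIV_clifford[OF DERIV_ident]] by simp
  then have "((\<lambda>v. complex_of_real (clifford_real l v)) has_vector_derivative of_real (clifford_real (l + 1) v)) (at v)"
    by (simp add: of_real_clifford_real)
  from bounded_linear.has_vector_derivative[OF bounded_linear_Re this]
  show ?thesis by (simp add: has_real_derivative_iff_has_vector_derivative)
qed

text \<open>
  $J_{2\alpha}(2\sqrt v)$, so that $J_{2\alpha}(2\sqrt x\sinh t)$ is its value at $x\sinh^2t$.
\<close>

definition bessel_J_sqrt :: "real \<Rightarrow> real \<Rightarrow> real" where
  "bessel_J_sqrt \<alpha> v = v powr \<alpha> * clifford_real (2 * \<alpha>) (- v)"

text \<open>
  The logarithmic derivative $v\frac{d}{dv}$ of the former; in these terms Bessel's equation is first order.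
\<close>

definition bessel_J_sqrt_theta :: "real \<Rightarrow> real \<Rightarrow> real" where
  "bessel_J_sqrt_theta \<alpha> v = v powr \<alpha> * (\<alpha> * clifford_real (2 * \<alpha>) (- v) - v * clifford_real (2 * \<alpha> + 1) (- v))"

lemma DERIV_clifford_real_minus: "((\<lambda>v. clifford_real l (- v)) has_real_derivative - clifford_real (l + 1) (- v)) (at v)"
proof -
  have "(uminus has_real_derivative - 1) (at v)" by (auto intro!: derivative_eq_intros)
  from DERIV_chain2[where f = "clifford_real l" and g = uminus, OF DERIV_clifford_real this] show ?thesis by simp
qed

lemma DERIV_bessel_J_sqrt:
  assumes v: "v > 0"
  shows "(bessel_J_sqrt \<alpha> has_real_derivative bessel_J_sqrt_theta \<alpha> v / v) (at v)"
    and "(bessel_J_sqrt_theta \<alpha> has_real_derivative (\<alpha>\<^sup>2 - v) * bessel_J_sqrt \<alpha> v / v) (at v)"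
proof -
  have p: "((\<lambda>v. v powr \<alpha>) has_real_derivative \<alpha> * v powr \<alpha> / v) (at v)"
    using has_real_derivative_powr[OF v, of \<alpha>] v by (simp add: powr_diff)
  note m0 = DERIV_clifford_real_minus[of "2 * \<alpha>" v] and m1 = DERIV_clifford_real_minus[of "2 * \<alpha> + 1" v]
  have rec: "clifford_real (2 * \<alpha>) (- v) = (2 * \<alpha> + 1) * clifford_real (2 * \<alpha> + 1) (- v) - v * clifford_real (2 * \<alpha> + 1 + 1) (- v)"
    using clifford_real_rec[of "2 * \<alpha>" "- v"] by (simp add: add.assoc)
  have "((\<lambda>v. v powr \<alpha> * clifford_real (2 * \<alpha>) (- v)) has_real_derivative
     (\<alpha> * v powr \<alpha> / v) * clifford_real (2 * \<alpha>) (- v) + - clifford_real (2 * \<alpha> + 1) (- v) * v powr \<alpha>) (at v)"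
    by (intro DERIV_mult p m0)
  from DERIV_cong[OF this] show "(bessel_J_sqrt \<alpha> has_real_derivative bessel_J_sqrt_theta \<alpha> v / v) (at v)"
    unfolding bessel_J_sqrt_def[abs_def] bessel_J_sqrt_theta_def using v by (simp add: field_simps)
  have "((\<lambda>v. v powr \<alpha> * (\<alpha> * clifford_real (2 * \<alpha>) (- v) - v * clifford_real (2 * \<alpha> + 1) (- v))) has_real_derivative
     (\<alpha> * v powr \<alpha> / v) * (\<alpha> * clifford_real (2 * \<alpha>) (- v) - v * clifford_real (2 * \<alpha> + 1) (- v)) +
     (\<alpha> * - clifford_real (2 * \<alpha> + 1) (- v) - (1 * clifford_real (2 * \<alpha> + 1) (- v) + - clifford_real (2 * \<alpha> + 1 + 1) (- v) * v)) * v powr \<alpha>) (at v)"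
    by (intro DERIV_mult DERIV_diff DERIV_cmult DERIV_ident p m0 m1)
  note d2 = this
  show "(bessel_J_sqrt_theta \<alpha> has_real_derivative (\<alpha>\<^sup>2 - v) * bessel_J_sqrt \<alpha> v / v) (at v)"
    unfolding bessel_J_sqrt_def bessel_J_sqrt_theta_def[abs_def]
  proof (rule DERIV_cong[OF d2])
    have "(\<alpha> * X / v) * (\<alpha> * A - v * B) + (\<alpha> * - B - (1 * B + - C * v)) * X = (\<alpha>\<^sup>2 - v) * (X * A) / v"
      if "A = (2 * \<alpha> + 1) * B - v * C" for A B C X :: real
      unfolding that using v by (simp add: field_simps power2_eq_square)
    from this[OF rec] show "\<alpha> * v powr \<alpha> / v * (\<alpha> * clifford_real (2 * \<alpha>) (- v) - v * clifford_real (2 * \<alpha> + 1) (- v)) +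
     (\<alpha> * - clifford_real (2 * \<alpha> + 1) (- v) - (1 * clifford_real (2 * \<alpha> + 1) (- v) + - clifford_real (2 * \<alpha> + 1 + 1) (- v) * v)) * v powr \<alpha> =
     (\<alpha>\<^sup>2 - v) * (v powr \<alpha> * clifford_real (2 * \<alpha>) (- v)) / v" .
  qed
qed

lemma continuous_on_clifford_real: "continuous_on A (clifford_real l)"
  by (rule DERIV_continuous_on) (rule DERIV_subset[OF DERIV_clifford_real], simp)

lemma continuous_on_bessel_J_sqrt:
  assumes "\<alpha> > 0" "continuous_on A f" "\<And>x. x \<in> A \<Longrightarrow> f x \<ge> 0"
  shows "continuous_on A (\<lambda>x. bessel_J_sqrt \<alpha> (f x))"
  unfolding bessel_J_sqrt_def
  by (intro continuous_on_mult continuous_on_powr' continuous_on_compose2[OF continuous_on_clifford_real[of UNIV]] continuous_intros)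
     (use assms in auto)

lemma bessel_J_sqrt_measurable [measurable]: "bessel_J_sqrt \<alpha> \<in> borel_measurable borel"
proof -
  have [measurable]: "clifford_real l \<in> borel_measurable borel" for l
    by (intro borel_measurable_continuous_onI continuous_on_clifford_real)
  show ?thesis unfolding bessel_J_sqrt_def[abs_def] by measurable
qed

text \<open>
  In $z=\sqrt v$ the function $y=\sqrt z\,J_{2\alpha}(2z)$ satisfies $y''+(4-4\kappa/z^2)y=0$ with
  $\kappa=\alpha^2-\frac1{16}$. Its energy \<open>E\<close>, a quarter of $y'^2+(4-4\kappa/z^2)y^2$, has derivative $2\kappa y^2/z^3$, which for large
  \<open>z\<close> is at most $4\kappa E/z^3$; hence $E\,e^{2\kappa/z^2}$ decreases, and \<open>y\<close> is bounded. The sign of $\kappa$ is where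
  $\alpha>\frac14$ enters.
\<close>

lemma bessel_J_sqrt_bound:
  assumes \<alpha>: "\<alpha> > 1/4"
  shows "\<exists>C\<ge>0. \<forall>v\<ge>0. \<bar>bessel_J_sqrt \<alpha> v\<bar> \<le> C \<and> v powr (1/4) * \<bar>bessel_J_sqrt \<alpha> v\<bar> \<le> C"
proof -
  define \<kappa> where "\<kappa> = \<alpha>\<^sup>2 - 1/16"
  have "(1/4)\<^sup>2 < \<alpha>\<^sup>2" using \<alpha> by (intro power_strict_mono) auto
  then have \<kappa>: "\<kappa> > 0" by (simp add: \<kappa>_def power2_eq_square)
  \<comment> \<open>Beyond \<open>z0\<close> the energy dominates half of \<open>z * (b z)\<^sup>2\<close>.\<close>
  define z0 where "z0 = max 1 (sqrt (2 * \<kappa>))"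
  have z0: "z0 \<ge> 1" by (simp add: z0_def)
  define b b1 where "b z = bessel_J_sqrt \<alpha> (z\<^sup>2)" and "b1 z = bessel_J_sqrt_theta \<alpha> (z\<^sup>2)" for z
  define E where "E z = (b1 z + b z / 4)\<^sup>2 / z + z * (b z)\<^sup>2 - \<kappa> * (b z)\<^sup>2 / z" for z
  define G where "G z = E z * exp (2 * \<kappa> / z\<^sup>2)" for z
  have db: "(b has_real_derivative 2 * b1 z / z) (at z)"
    and db1: "(b1 has_real_derivative 2 * (\<alpha>\<^sup>2 - z\<^sup>2) * b z / z) (at z)" if z: "z > 0" for z
  proof -
    have z2: "z\<^sup>2 > 0" using z by simp
    have d: "((\<lambda>z. z\<^sup>2) has_real_derivative 2 * z) (at z)" by (auto intro!: derivative_eq_intros)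
    show "(b has_real_derivative 2 * b1 z / z) (at z)"
      using DERIV_chain2[OF DERIV_bessel_J_sqrt(1)[OF z2] d, of \<alpha>] z unfolding b_def[abs_def] b1_def by (simp add: power2_eq_square mult_ac)
    show "(b1 has_real_derivative 2 * (\<alpha>\<^sup>2 - z\<^sup>2) * b z / z) (at z)"
      using DERIV_chain2[OF DERIV_bessel_J_sqrt(2)[OF z2] d, of \<alpha>] z unfolding b_def b1_def[abs_def]
      by (elim DERIV_cong) (simp add: power2_eq_square)
  qed
  have dE: "(E has_real_derivative 2 * \<kappa> * (b z)\<^sup>2 / z\<^sup>2) (at z)" if z: "z > 0" for z
  proof -
    show ?thesis unfolding E_def[abs_def] using z
      by (auto intro!: derivative_eq_intros db[OF z] db1[OF z] simp: \<kappa>_def field_simps power2_eq_square)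
  qed
  have Eb: "z * (b z)\<^sup>2 \<le> 2 * E z" if z: "z \<ge> z0" for z
  proof -
    have zp: "z > 0" using z z0 by simp
    have "sqrt (2 * \<kappa>) \<le> z" using z by (simp add: z0_def)
    then have "2 * \<kappa> \<le> z\<^sup>2" using \<kappa> zp by (simp add: real_le_lsqrt sqrt_le_D)
    then have "2 * \<kappa> * (b z)\<^sup>2 \<le> z\<^sup>2 * (b z)\<^sup>2" by (rule mult_right_mono) auto
    then have "2 * \<kappa> * (b z)\<^sup>2 / z \<le> z * (b z)\<^sup>2" using zp by (simp add: field_simps power2_eq_square)
    moreover have "(b1 z + b z / 4)\<^sup>2 / z \<ge> 0" using zp by simp
    ultimately show ?thesis unfolding E_def by simp
  qed
  have dG: "(G has_real_derivative (2 * \<kappa> * (b z)\<^sup>2 / z\<^sup>2 - 4 * \<kappa> / z ^ 3 * E z) * exp (2 * \<kappa> / z\<^sup>2)) (at z)" if z: "z > 0" for z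
  proof -
    have d: "((\<lambda>z. exp (2 * \<kappa> / z\<^sup>2)) has_real_derivative - (4 * \<kappa> / z ^ 3) * exp (2 * \<kappa> / z\<^sup>2)) (at z)"
      using z by (auto intro!: derivative_eq_intros simp: field_simps power2_eq_square power3_eq_cube)
    show ?thesis unfolding G_def[abs_def]
      by (rule DERIV_cong[OF DERIV_mult[OF dE[OF z] d]]) (simp add: algebra_simps)
  qed
  have Gdec: "G z \<le> G z0" if z: "z \<ge> z0" for z
  proof (rule DERIV_nonpos_imp_nonincreasing[OF z])
    fix x assume x: "z0 \<le> x" "x \<le> z"
    have xp: "x > 0" using x z0 by simp
    have "2 * \<kappa> * (b x)\<^sup>2 / x\<^sup>2 = (2 * \<kappa> / x ^ 3) * (x * (b x)\<^sup>2)"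
      using xp by (simp add: field_simps power2_eq_square power3_eq_cube)
    also have "\<dots> \<le> (2 * \<kappa> / x ^ 3) * (2 * E x)" using Eb[OF x(1)] \<kappa> xp by (intro mult_left_mono) auto
    finally have "2 * \<kappa> * (b x)\<^sup>2 / x\<^sup>2 - 4 * \<kappa> / x ^ 3 * E x \<le> 0" by simp
    then have "(2 * \<kappa> * (b x)\<^sup>2 / x\<^sup>2 - 4 * \<kappa> / x ^ 3 * E x) * exp (2 * \<kappa> / x\<^sup>2) \<le> 0"
      by (rule mult_nonpos_nonneg) auto
    with dG[OF xp] show "\<exists>y. (G has_real_derivative y) (at x) \<and> y \<le> 0" by blast
  qed
  define K where "K = 2 * G z0"
  have K: "z * (b z)\<^sup>2 \<le> K" if z: "z \<ge> z0" for z
  proof -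
    have E0: "E z \<ge> 0" using Eb[OF z] z z0 by (smt (verit) mult_nonneg_nonneg zero_le_power2)
    have "E z * 1 \<le> G z" unfolding G_def using E0 \<kappa> by (intro mult_left_mono) auto
    then show ?thesis using Eb[OF z] Gdec[OF z] by (simp add: K_def)
  qed
  have K0: "K \<ge> 0" using K[of z0] z0 by (smt (verit) mult_nonneg_nonneg zero_le_power2)
  have big: "v powr (1/4) * \<bar>bessel_J_sqrt \<alpha> v\<bar> \<le> sqrt K" "\<bar>bessel_J_sqrt \<alpha> v\<bar> \<le> sqrt K" if v: "v \<ge> z0\<^sup>2" for v
  proof -
    have z: "sqrt v \<ge> z0" using v z0 by (simp add: real_le_rsqrt)
    have vp: "v \<ge> 1" using v z0 one_le_power[OF z0, of 2] by linarith
    have "(v powr (1/4))\<^sup>2 = sqrt v"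
      using vp by (simp add: powr_half_sqrt[symmetric] power2_eq_square flip: powr_add)
    then have "(v powr (1/4) * \<bar>bessel_J_sqrt \<alpha> v\<bar>)\<^sup>2 \<le> K" using K[OF z] vp by (simp add: b_def power_mult_distrib)
    then show 1: "v powr (1/4) * \<bar>bessel_J_sqrt \<alpha> v\<bar> \<le> sqrt K" by (rule real_le_rsqrt)
    have "1 * \<bar>bessel_J_sqrt \<alpha> v\<bar> \<le> v powr (1/4) * \<bar>bessel_J_sqrt \<alpha> v\<bar>"
      using vp by (intro mult_right_mono ge_one_powr_ge_zero) auto
    with 1 show "\<bar>bessel_J_sqrt \<alpha> v\<bar> \<le> sqrt K" by simp
  qed
  have "continuous_on {0..z0\<^sup>2} (\<lambda>v. bessel_J_sqrt \<alpha> v)" using \<alpha> by (intro continuous_on_bessel_J_sqrt continuous_intros) auto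
  from compact_imp_bounded[OF compact_continuous_image[OF this compact_Icc]]
  obtain C1 where C1: "\<forall>y\<in>bessel_J_sqrt \<alpha> ` {0..z0\<^sup>2}. norm y \<le> C1" unfolding bounded_iff by (elim exE)
  have small: "\<bar>bessel_J_sqrt \<alpha> v\<bar> \<le> C1" if "v \<ge> 0" "v \<le> z0\<^sup>2" for v using C1 that by auto
  have C10: "C1 \<ge> 0" using small[of 0] by simp
  have small': "v powr (1/4) * \<bar>bessel_J_sqrt \<alpha> v\<bar> \<le> z0\<^sup>2 powr (1/4) * C1" if "v \<ge> 0" "v \<le> z0\<^sup>2" for v
    using small[OF that] that by (intro mult_mono powr_mono2) auto
  let ?C = "sqrt K + C1 + z0\<^sup>2 powr (1/4) * C1"
  show ?thesis
  proof (intro exI[of _ ?C] conjI allI impI)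
    have t: "z0\<^sup>2 powr (1/4) * C1 \<ge> 0" "sqrt K \<ge> 0" using C10 K0 by auto
    then show "0 \<le> ?C" using C10 by linarith
    fix v :: real assume v: "v \<ge> 0"
    show "\<bar>bessel_J_sqrt \<alpha> v\<bar> \<le> ?C"
      using big(2)[of v] small[OF v] t C10 by (cases "v \<le> z0\<^sup>2"; linarith)
    show "v powr (1/4) * \<bar>bessel_J_sqrt \<alpha> v\<bar> \<le> ?C"
      using big(1)[of v] small'[OF v] t C10 by (cases "v \<le> z0\<^sup>2"; linarith)
  qed
qed

lemma laplace_bessel_J_sqrt:
  assumes \<alpha>: "\<alpha> > 0" and p: "p > 0" and w: "w > 0"
  shows "integrable lpos (\<lambda>x. of_real (exp (- (p * x))) * cpow x (of_real \<alpha>) * complex_of_real (bessel_J_sqrt \<alpha> (x * w)))"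
    and "(\<integral>x. of_real (exp (- (p * x))) * cpow x (of_real \<alpha>) * complex_of_real (bessel_J_sqrt \<alpha> (x * w)) \<partial>lpos) =
         of_real (w powr \<alpha> * p powr (- (2 * \<alpha> + 1)) * exp (- (w / p)))"
    and "integrable lpos (\<lambda>x. of_real (exp (- (p * x))) * cpow x (of_real (\<alpha> + 1)) * complex_of_real (bessel_J_sqrt \<alpha> (x * w)))"
    and "(\<integral>x. of_real (exp (- (p * x))) * cpow x (of_real (\<alpha> + 1)) * complex_of_real (bessel_J_sqrt \<alpha> (x * w)) \<partial>lpos) =
         of_real (w powr \<alpha> * p powr (- (2 * \<alpha> + 2)) * (2 * \<alpha> + 1 - w / p) * exp (- (w / p)))"
proof -
  let ?\<mu> = "complex_of_real (2 * \<alpha>)" and ?w = "complex_of_real w"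
  have eq: "of_real (exp (- (p * x))) * cpow x (of_real \<alpha> + c) * complex_of_real (bessel_J_sqrt \<alpha> (x * w)) =
      of_real (w powr \<alpha>) * (of_real (exp (- (p * x))) * cpow x (?\<mu> + c) * clifford ?\<mu> (- ?w * of_real x))" if x: "x > 0" for x c
  proof -
    have "complex_of_real (bessel_J_sqrt \<alpha> (x * w)) = of_real (w powr \<alpha>) * cpow x (of_real \<alpha>) * clifford ?\<mu> (- ?w * of_real x)"
      using x w by (simp add: bessel_J_sqrt_def powr_mult cpow_of_real of_real_clifford_real mult_ac)
    moreover have "cpow x (?\<mu> + c) = cpow x (of_real \<alpha> + c) * cpow x (of_real \<alpha>)"
      by (simp flip: cpow_add)
    ultimately show ?thesis by (simp only: mult_ac)
  qed
  have "Re (?\<mu> + 1) > 0" "Re (?\<mu> + 2) > 0" using \<alpha> by simp_all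
  note I1 = laplace_clifford_sums(1)[OF this(1) p, of ?\<mu> "- ?w"] and I2 = laplace_clifford_sums(1)[OF this(2) p, of ?\<mu> "- ?w"]
  have "Re ?\<mu> > - 1" using \<alpha> by simp
  note V = laplace_clifford[OF this p, of "- ?w"]
  have e: "exp (- ?w / of_real p) = of_real (exp (- (w / p)))" by (simp flip: exp_of_real)
  have c1: "cpow p (- (?\<mu> + 1)) = of_real (p powr (- (2 * \<alpha> + 1)))" and c2: "cpow p (- (?\<mu> + 2)) = of_real (p powr (- (2 * \<alpha> + 2)))"
    using cpow_of_real[OF p, of "- (2 * \<alpha> + 1)"] cpow_of_real[OF p, of "- (2 * \<alpha> + 2)"] by simp_all
  have m2: "?\<mu> + 2 - 1 = ?\<mu> + 1" by simp
  show "integrable lpos (\<lambda>x. of_real (exp (- (p * x))) * cpow x (of_real \<alpha>) * complex_of_real (bessel_J_sqrt \<alpha> (x * w)))"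
    using integrable_mult_right[OF I1, of "of_real (w powr \<alpha>)"] unfolding add_diff_cancel_right'
    by (subst integrable_cong_lpos[OF eq[of _ 0, unfolded add_0_right]])
  show "integrable lpos (\<lambda>x. of_real (exp (- (p * x))) * cpow x (of_real (\<alpha> + 1)) * complex_of_real (bessel_J_sqrt \<alpha> (x * w)))"
    using integrable_mult_right[OF I2, of "of_real (w powr \<alpha>)"] unfolding m2 of_real_add of_real_1
    by (subst integrable_cong_lpos[OF eq[of _ 1]])
  have "(\<integral>x. of_real (exp (- (p * x))) * cpow x (of_real \<alpha> + 0) * complex_of_real (bessel_J_sqrt \<alpha> (x * w)) \<partial>lpos) =
     of_real (w powr \<alpha>) * (\<integral>x. of_real (exp (- (p * x))) * cpow x (?\<mu> + 0) * clifford ?\<mu> (- ?w * of_real x) \<partial>lpos)"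
    unfolding integral_mult_right_zero[symmetric] by (rule integral_cong_lpos) (rule eq)
  then show "(\<integral>x. of_real (exp (- (p * x))) * cpow x (of_real \<alpha>) * complex_of_real (bessel_J_sqrt \<alpha> (x * w)) \<partial>lpos) =
         of_real (w powr \<alpha> * p powr (- (2 * \<alpha> + 1)) * exp (- (w / p)))"
    unfolding add_0_right V(1) e c1 by simp
  have "(\<integral>x. of_real (exp (- (p * x))) * cpow x (of_real \<alpha> + 1) * complex_of_real (bessel_J_sqrt \<alpha> (x * w)) \<partial>lpos) =
     of_real (w powr \<alpha>) * (\<integral>x. of_real (exp (- (p * x))) * cpow x (?\<mu> + 1) * clifford ?\<mu> (- ?w * of_real x) \<partial>lpos)"
    unfolding integral_mult_right_zero[symmetric] by (rule integral_cong_lpos) (rule eq)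
  then show "(\<integral>x. of_real (exp (- (p * x))) * cpow x (of_real (\<alpha> + 1)) * complex_of_real (bessel_J_sqrt \<alpha> (x * w)) \<partial>lpos) =
         of_real (w powr \<alpha> * p powr (- (2 * \<alpha> + 2)) * (2 * \<alpha> + 1 - w / p) * exp (- (w / p)))"
    unfolding V(2) e c2 by (simp add: mult_ac)
qed

section \<open>Cosine inversion\<close>

text \<open>
  Cosine transforms over the half-line are treated as Fourier transforms of even functions.
\<close>

lemma integrable_lborel_even:
  fixes g :: "real \<Rightarrow> 'a::{banach, second_countable_topology}"
  assumes even: "\<And>x. g (- x) = g x" and int: "integrable lpos g"
  shows "integrable lborel g" and "integral\<^sup>L lborel g = 2 *\<^sub>R integral\<^sup>L lpos g"
proof -
  let ?P = "\<lambda>x. indicator {0<..} x *\<^sub>R g x" and ?N = "\<lambda>x. indicator {..<0} x *\<^sub>R g x"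
  have P: "integrable lborel ?P" using int by (simp add: integrable_lpos_iff set_integrable_def)
  have e: "?P (0 + (-1) * x) = ?N x" for x by (simp add: even indicator_def)
  have N: "integrable lborel ?N"
    using lborel_integrable_real_affine[OF P, of "-1" 0] unfolding e by simp
  have IN: "integral\<^sup>L lborel ?N = integral\<^sup>L lborel ?P"
    using lborel_integral_real_affine[of "-1" ?P 0] unfolding e by simp
  have ae: "AE x in lborel. ?P x + ?N x = g x"
  proof (rule AE_mp[OF AE_lborel_singleton[of 0]], rule AE_I2, rule impI)
    fix x :: real assume "x \<noteq> 0"
    then show "?P x + ?N x = g x" by (cases "x > 0") (auto simp: indicator_def)
  qed
  have PN: "integrable lborel (\<lambda>x. ?P x + ?N x)" using P N by (rule Bochner_Integration.integrable_add)
  have gm: "g \<in> borel_measurable lborel"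
  proof -
    have "g = (\<lambda>x. if x = 0 then g 0 else ?P x + ?N x)" by (auto simp: fun_eq_iff indicator_def)
    moreover have "(\<lambda>x. if x = 0 then g 0 else ?P x + ?N x) \<in> borel_measurable lborel"
      using borel_measurable_integrable[OF PN] by measurable
    ultimately show ?thesis by (simp only:)
  qed
  show "integrable lborel g" using PN gm ae by (subst integrable_cong_AE[of g _ "\<lambda>x. ?P x + ?N x"]) auto
  have "integral\<^sup>L lborel g = integral\<^sup>L lborel (\<lambda>x. ?P x + ?N x)"
    using gm borel_measurable_integrable[OF PN] ae by (intro integral_cong_AE) auto
  also have "\<dots> = 2 *\<^sub>R integral\<^sup>L lborel ?P" using P N IN by (simp add: scaleR_2)
  finally show "integral\<^sup>L lborel g = 2 *\<^sub>R integral\<^sup>L lpos g"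
    by (simp add: integral_lpos set_lebesgue_integral_def)
qed

lemma gaussian_cosine:
  assumes n: "n > 0"
  shows "integrable lborel (\<lambda>\<tau>. exp (- ((\<tau> / n)\<^sup>2 / 2)) * cos (a * \<tau>))"
    and "(\<integral>\<tau>. exp (- ((\<tau> / n)\<^sup>2 / 2)) * cos (a * \<tau>) \<partial>lborel) = n * sqrt (2 * pi) * exp (- ((n * a)\<^sup>2 / 2))"
proof -
  have s: "std_normal_density x = exp (- (x\<^sup>2 / 2)) / sqrt (2 * pi)" for x
    by (simp add: std_normal_density_def)
  have i0: "integrable lborel std_normal_density" by (rule integrable_normal_density) simp
  have base: "integrable lborel (\<lambda>x. std_normal_density x * cos (b * x)) \<and>
     (\<integral>x. std_normal_density x * cos (b * x) \<partial>lborel) = exp (- (b\<^sup>2 / 2))" for b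
  proof
    show "integrable lborel (\<lambda>x. std_normal_density x * cos (b * x))"
      by (rule Bochner_Integration.integrable_bound[OF i0])
         (auto simp: abs_mult intro!: mult_left_le)
    have i: "integrable lborel (\<lambda>x. std_normal_density x *\<^sub>R iexp (b * x))"
      by (rule Bochner_Integration.integrable_bound[OF i0]) (auto simp: normal_density_nonneg)
    have "char std_normal_distribution b = (CLINT x|lborel. std_normal_density x *\<^sub>R iexp (b * x))"
      unfolding char_def by (subst integral_density) (auto simp: normal_density_nonneg)
    then have "(CLINT x|lborel. std_normal_density x *\<^sub>R iexp (b * x)) = complex_of_real (exp (- (b\<^sup>2 / 2)))"
      by (simp add: char_std_normal_distribution)
    then have "Re (CLINT x|lborel. std_normal_density x *\<^sub>R iexp (b * x)) = exp (- (b\<^sup>2 / 2))"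
      by (simp only: Re_complex_of_real)
    moreover have "Re (CLINT x|lborel. std_normal_density x *\<^sub>R iexp (b * x)) = (\<integral>x. Re (std_normal_density x *\<^sub>R iexp (b * x)) \<partial>lborel)"
      by (rule integral_Re[OF i, symmetric])
    moreover have "Re (std_normal_density x *\<^sub>R iexp (b * x)) = std_normal_density x * cos (b * x)" for x
      by (simp add: Re_exp)
    ultimately show "(\<integral>x. std_normal_density x * cos (b * x) \<partial>lborel) = exp (- (b\<^sup>2 / 2))" by (simp only:)
  qed
  let ?G = "\<lambda>x. exp (- (x\<^sup>2 / 2)) * cos (n * a * x)"
  have "integrable lborel (\<lambda>x. sqrt (2 * pi) * (std_normal_density x * cos (n * a * x)))"
    using base by (intro integrable_mult_right) auto
  then have G: "integrable lborel ?G" by (simp add: s)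
  have "(\<integral>x. sqrt (2 * pi) * (std_normal_density x * cos (n * a * x)) \<partial>lborel) = sqrt (2 * pi) * exp (- ((n * a)\<^sup>2 / 2))"
    using base[of "n * a"] by (simp only: integral_mult_right_zero)
  then have VG: "integral\<^sup>L lborel ?G = sqrt (2 * pi) * exp (- ((n * a)\<^sup>2 / 2))" by (simp add: s)
  have e: "?G (0 + (1 / n) * \<tau>) = exp (- ((\<tau> / n)\<^sup>2 / 2)) * cos (a * \<tau>)" for \<tau> using n by simp
  show "integrable lborel (\<lambda>\<tau>. exp (- ((\<tau> / n)\<^sup>2 / 2)) * cos (a * \<tau>))"
    using lborel_integrable_real_affine[OF G, of "1 / n" 0] n unfolding e by simp
  have "integral\<^sup>L lborel ?G = (1 / n) * (\<integral>\<tau>. exp (- ((\<tau> / n)\<^sup>2 / 2)) * cos (a * \<tau>) \<partial>lborel)"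
    using lborel_integral_real_affine[of "1 / n" ?G 0] n unfolding e by simp
  then show "(\<integral>\<tau>. exp (- ((\<tau> / n)\<^sup>2 / 2)) * cos (a * \<tau>) \<partial>lborel) = n * sqrt (2 * pi) * exp (- ((n * a)\<^sup>2 / 2))"
    unfolding VG using n by (simp add: field_simps)
qed

text \<open>
  Inserting a Gaussian convergence factor of width \<open>n\<close> turns the inversion integral into the convolution of \<open>h\<close> with a
  Gaussian of width $1/n$.
\<close>

theorem cosine_inversion:
  fixes h :: "real \<Rightarrow> complex"
  assumes even: "\<And>s. h (- s) = h s" and cont: "continuous_on UNIV h" and int: "integrable lpos h"
    and bound: "\<And>s. norm (h s) \<le> C"
  defines "\<Phi> \<equiv> (\<lambda>\<tau>. \<integral>s. of_real (cos (2 * \<tau> * s)) * h s \<partial>lpos)"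
  assumes \<Phi>: "integrable lpos \<Phi>"
  shows "(\<integral>\<tau>. of_real (cos (2 * \<tau> * t)) * \<Phi> \<tau> \<partial>lpos) = of_real (pi / 4) * h t"
proof -
  have hm [measurable]: "h \<in> borel_measurable borel" using cont by (rule borel_measurable_continuous_onI)
  have hi: "integrable lborel h" by (rule integrable_lborel_even(1)[OF even int])
  have ci: "integrable lpos (\<lambda>s. of_real (cos (2 * \<tau> * s)) * h s)" for \<tau>
    by (rule Bochner_Integration.integrable_bound[OF int])
       (auto intro!: measurable_lposI AE_I2 simp: norm_mult mult_left_le_one_le)
  have \<Phi>2: "\<Phi> \<tau> = 1 / 2 * (\<integral>s. of_real (cos (2 * \<tau> * s)) * h s \<partial>lborel)" for \<tau>
    using integrable_lborel_even(2)[OF _ ci[of \<tau>]] by (simp add: \<Phi>_def even scaleR_conv_of_real)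
  have \<Phi>even: "\<Phi> (- \<tau>) = \<Phi> \<tau>" for \<tau> by (simp add: \<Phi>_def)
  have \<Phi>i: "integrable lborel \<Phi>" by (rule integrable_lborel_even(1)[OF \<Phi>even \<Phi>])
  have \<Phi>m [measurable]: "\<Phi> \<in> borel_measurable borel" using borel_measurable_integrable[OF \<Phi>i] by simp
  define w where "w n \<tau> = exp (- ((\<tau> / n)\<^sup>2 / 2))" for n \<tau> :: real
  have wb: "0 \<le> w n \<tau>" "w n \<tau> \<le> 1" for n \<tau> by (simp_all add: w_def)
  have wi: "integrable lborel (w n)" if "n > 0" for n
    using gaussian_cosine(1)[OF that, of 0] by (simp add: w_def[abs_def])
  let ?J = "\<lambda>n. \<integral>\<tau>. of_real (w n \<tau> * cos (2 * \<tau> * t)) * \<Phi> \<tau> \<partial>lborel"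
  have lim1: "(\<lambda>n. ?J (real (Suc n))) \<longlonglongrightarrow> (\<integral>\<tau>. of_real (cos (2 * \<tau> * t)) * \<Phi> \<tau> \<partial>lborel)"
  proof (rule integral_dominated_convergence[where w = "\<lambda>\<tau>. norm (\<Phi> \<tau>)"])
    show "AE \<tau> in lborel. (\<lambda>n. of_real (w (real (Suc n)) \<tau> * cos (2 * \<tau> * t)) * \<Phi> \<tau>) \<longlonglongrightarrow> of_real (cos (2 * \<tau> * t)) * \<Phi> \<tau>"
    proof (rule AE_I2)
      fix \<tau> :: real
      have "(\<lambda>n. \<tau> / real (Suc n)) \<longlonglongrightarrow> 0" by (rule LIMSEQ_Suc[OF lim_const_over_n])
      then have "(\<lambda>n. w (real (Suc n)) \<tau>) \<longlonglongrightarrow> exp (- (0\<^sup>2 / 2))" unfolding w_def by (intro tendsto_intros) auto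
      then have "(\<lambda>n. of_real (w (real (Suc n)) \<tau> * cos (2 * \<tau> * t)) * \<Phi> \<tau>) \<longlonglongrightarrow> of_real (exp (- (0\<^sup>2 / 2)) * cos (2 * \<tau> * t)) * \<Phi> \<tau>"
        by (intro tendsto_mult tendsto_of_real tendsto_const)
      then show "(\<lambda>n. of_real (w (real (Suc n)) \<tau> * cos (2 * \<tau> * t)) * \<Phi> \<tau>) \<longlonglongrightarrow> of_real (cos (2 * \<tau> * t)) * \<Phi> \<tau>" by simp
    qed
    show "AE \<tau> in lborel. norm (of_real (w (real (Suc n)) \<tau> * cos (2 * \<tau> * t)) * \<Phi> \<tau>) \<le> norm (\<Phi> \<tau>)" for n
    proof (rule AE_I2)
      fix \<tau> :: real
      have "\<bar>w (real (Suc n)) \<tau> * cos (2 * \<tau> * t)\<bar> \<le> 1 * 1"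
        unfolding abs_mult using wb by (intro mult_mono) auto
      then show "norm (of_real (w (real (Suc n)) \<tau> * cos (2 * \<tau> * t)) * \<Phi> \<tau>) \<le> norm (\<Phi> \<tau>)"
        unfolding norm_mult norm_of_real by (intro mult_left_le_one_le) auto
    qed
  qed (use \<Phi>i in \<open>auto simp: w_def\<close>)
  have Jn: "?J n = of_real (1 / 2 * sqrt (2 * pi)) * (\<integral>v. h (t + v / n) * of_real (exp (- (2 * v\<^sup>2))) \<partial>lborel)"
    if n: "n > 0" for n
  proof -
    let ?g = "\<lambda>\<tau> s. complex_of_real (w n \<tau> * (cos (2 * \<tau> * t) * cos (2 * \<tau> * s))) * h s"
    have m: "(\<lambda>(\<tau>, s). ?g \<tau> s) \<in> borel_measurable (lborel \<Otimes>\<^sub>M lborel)"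
      unfolding w_def by measurable
    have bd: "norm (?g \<tau> s) \<le> w n \<tau> * norm (h s)" for \<tau> s
    proof -
      have "\<bar>cos (2 * \<tau> * t) * cos (2 * \<tau> * s)\<bar> \<le> 1 * 1" unfolding abs_mult by (intro mult_mono) auto
      then have "w n \<tau> * \<bar>cos (2 * \<tau> * t) * cos (2 * \<tau> * s)\<bar> \<le> w n \<tau> * 1" using wb by (intro mult_left_mono) auto
      then show ?thesis using wb unfolding norm_mult norm_of_real by (intro mult_right_mono) (auto simp: abs_mult)
    qed
    note F = lborel_pair.Fubini_product_bound(3)[OF m wi[OF n] integrable_norm[OF hi] bd]
    have "?J n = 1 / 2 * (\<integral>\<tau>. (\<integral>s. ?g \<tau> s \<partial>lborel) \<partial>lborel)"
    proof -
      have "of_real (w n \<tau> * cos (2 * \<tau> * t)) * \<Phi> \<tau> = 1 / 2 * (\<integral>s. ?g \<tau> s \<partial>lborel)" for \<tau>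
      proof -
        have "(\<integral>s. ?g \<tau> s \<partial>lborel) = (\<integral>s. of_real (w n \<tau> * cos (2 * \<tau> * t)) * (of_real (cos (2 * \<tau> * s)) * h s) \<partial>lborel)"
          by (simp add: mult_ac)
        then show ?thesis unfolding \<Phi>2 integral_mult_right_zero by simp
      qed
      then show ?thesis by (simp only: integral_mult_right_zero)
    qed
    also have "(\<integral>\<tau>. (\<integral>s. ?g \<tau> s \<partial>lborel) \<partial>lborel) = (\<integral>s. (\<integral>\<tau>. ?g \<tau> s \<partial>lborel) \<partial>lborel)" by (rule F)
    also have "\<dots> = (\<integral>s. of_real (n * sqrt (2 * pi) / 2) * (h s * of_real (exp (- (2 * n\<^sup>2 * (s - t)\<^sup>2))) + h s * of_real (exp (- (2 * n\<^sup>2 * (s + t)\<^sup>2)))) \<partial>lborel)"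
    proof (rule Bochner_Integration.integral_cong[OF refl])
      fix s :: real
      have "w n \<tau> * (cos (2 * \<tau> * t) * cos (2 * \<tau> * s)) = 1 / 2 * (w n \<tau> * cos (2 * (s - t) * \<tau>) + w n \<tau> * cos (2 * (s + t) * \<tau>))" for \<tau>
      proof -
        have a: "2 * (s - t) * \<tau> = 2 * \<tau> * s - 2 * \<tau> * t" "2 * (s + t) * \<tau> = 2 * \<tau> * s + 2 * \<tau> * t" by (simp_all add: algebra_simps)
        show ?thesis unfolding a cos_diff cos_add by (simp add: algebra_simps)
      qed
      then have "(\<integral>\<tau>. w n \<tau> * (cos (2 * \<tau> * t) * cos (2 * \<tau> * s)) \<partial>lborel) =
         1 / 2 * ((\<integral>\<tau>. w n \<tau> * cos (2 * (s - t) * \<tau>) \<partial>lborel) + (\<integral>\<tau>. w n \<tau> * cos (2 * (s + t) * \<tau>) \<partial>lborel))"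
        using gaussian_cosine(1)[OF n] unfolding w_def by (simp del: times_divide_eq_left)
      also have "\<dots> = n * sqrt (2 * pi) / 2 * (exp (- (2 * n\<^sup>2 * (s - t)\<^sup>2)) + exp (- (2 * n\<^sup>2 * (s + t)\<^sup>2)))"
      proof -
        have q: "(n * (2 * c))\<^sup>2 / 2 = 2 * n\<^sup>2 * c\<^sup>2" for c by (simp add: power_mult_distrib)
        show ?thesis unfolding w_def gaussian_cosine(2)[OF n] q by (simp add: distrib_left)
      qed
      finally have I: "(\<integral>\<tau>. w n \<tau> * (cos (2 * \<tau> * t) * cos (2 * \<tau> * s)) \<partial>lborel) = n * sqrt (2 * pi) / 2 * (exp (- (2 * n\<^sup>2 * (s - t)\<^sup>2)) + exp (- (2 * n\<^sup>2 * (s + t)\<^sup>2)))" .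
      have "(\<integral>\<tau>. ?g \<tau> s \<partial>lborel) = of_real (\<integral>\<tau>. w n \<tau> * (cos (2 * \<tau> * t) * cos (2 * \<tau> * s)) \<partial>lborel) * h s"
        by (simp only: integral_mult_left_zero integral_complex_of_real)
      then show "(\<integral>\<tau>. ?g \<tau> s \<partial>lborel) = of_real (n * sqrt (2 * pi) / 2) * (h s * of_real (exp (- (2 * n\<^sup>2 * (s - t)\<^sup>2))) + h s * of_real (exp (- (2 * n\<^sup>2 * (s + t)\<^sup>2))))"
        unfolding I by (simp add: algebra_simps)
    qed
    also have "\<dots> = of_real (n * sqrt (2 * pi) / 2) * ((\<integral>s. h s * of_real (exp (- (2 * n\<^sup>2 * (s - t)\<^sup>2))) \<partial>lborel) + (\<integral>s. h s * of_real (exp (- (2 * n\<^sup>2 * (s + t)\<^sup>2))) \<partial>lborel))"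
    proof -
      have "integrable lborel (\<lambda>s. h s * of_real (exp (- (2 * n\<^sup>2 * (s + c)\<^sup>2))))" for c
        by (rule Bochner_Integration.integrable_bound[OF hi]) (auto simp: norm_mult intro!: mult_left_le)
      from this[of t] this[of "- t"] show ?thesis by (simp del: of_real_mult of_real_divide)
    qed
    also have "(\<integral>s. h s * of_real (exp (- (2 * n\<^sup>2 * (s + t)\<^sup>2))) \<partial>lborel) = (\<integral>s. h s * of_real (exp (- (2 * n\<^sup>2 * (s - t)\<^sup>2))) \<partial>lborel)"
    proof -
      have "(- x + t)\<^sup>2 = (x - t)\<^sup>2" for x by (simp add: power2_eq_square algebra_simps)
      then show ?thesis
        using lborel_integral_real_affine[of "-1" "\<lambda>s. h s * of_real (exp (- (2 * n\<^sup>2 * (s + t)\<^sup>2)))" 0] by (simp add: even)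
    qed
    also have "(\<integral>s. h s * of_real (exp (- (2 * n\<^sup>2 * (s - t)\<^sup>2))) \<partial>lborel) = of_real (1 / n) * (\<integral>v. h (t + v / n) * of_real (exp (- (2 * v\<^sup>2))) \<partial>lborel)"
      using lborel_integral_real_affine[of "1 / n" "\<lambda>s. h s * of_real (exp (- (2 * n\<^sup>2 * (s - t)\<^sup>2)))" t] n
      by (simp add: scaleR_conv_of_real power_divide)
    finally show ?thesis using n by simp
  qed
  have g2: "integrable lborel (\<lambda>v::real. exp (- (2 * v\<^sup>2)))" "(\<integral>v. exp (- (2 * v\<^sup>2)) \<partial>(lborel :: real measure)) = 1 / 2 * sqrt (2 * pi)"
    using gaussian_cosine[of "1/2" 0] by (simp_all add: power_mult_distrib)
  have lim2: "(\<lambda>n. \<integral>v. h (t + v / real (Suc n)) * of_real (exp (- (2 * v\<^sup>2))) \<partial>lborel) \<longlonglongrightarrow> (\<integral>v. h t * of_real (exp (- (2 * v\<^sup>2))) \<partial>lborel)"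
  proof (rule integral_dominated_convergence[where w = "\<lambda>v. C * exp (- (2 * v\<^sup>2))"])
    show "AE v in lborel. (\<lambda>n. h (t + v / real (Suc n)) * of_real (exp (- (2 * v\<^sup>2)))) \<longlonglongrightarrow> h t * of_real (exp (- (2 * v\<^sup>2)))"
    proof (rule AE_I2)
      fix v :: real
      have "(\<lambda>n. v / real (Suc n)) \<longlonglongrightarrow> 0" by (rule LIMSEQ_Suc[OF lim_const_over_n])
      then have "(\<lambda>n. t + v / real (Suc n)) \<longlonglongrightarrow> t + 0" by (intro tendsto_intros)
      then have "(\<lambda>n. h (t + v / real (Suc n))) \<longlonglongrightarrow> h (t + 0)"
        using cont by (intro continuous_on_tendsto_compose[OF cont]) auto
      then show "(\<lambda>n. h (t + v / real (Suc n)) * of_real (exp (- (2 * v\<^sup>2)))) \<longlonglongrightarrow> h t * of_real (exp (- (2 * v\<^sup>2)))"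
        by (intro tendsto_mult tendsto_const) simp
    qed
    show "AE v in lborel. norm (h (t + v / real (Suc n)) * of_real (exp (- (2 * v\<^sup>2)))) \<le> C * exp (- (2 * v\<^sup>2))" for n
      using bound by (auto simp: norm_mult intro!: mult_right_mono)
  qed (use g2(1) in auto)
  have "(\<integral>v. h t * of_real (exp (- (2 * v\<^sup>2))) \<partial>lborel) = h t * of_real (1 / 2 * sqrt (2 * pi))"
    unfolding integral_mult_right_zero integral_complex_of_real g2(2) ..
  note I3 = this
  have Jn': "?J (real (Suc n)) = of_real (1 / 2 * sqrt (2 * pi)) * (\<integral>v. h (t + v / real (Suc n)) * of_real (exp (- (2 * v\<^sup>2))) \<partial>lborel)" for n
    by (rule Jn) simp
  have "(\<lambda>n. ?J (real (Suc n))) \<longlonglongrightarrow> of_real (1 / 2 * sqrt (2 * pi)) * (h t * of_real (1 / 2 * sqrt (2 * pi)))"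
    unfolding Jn' by (rule tendsto_mult[OF tendsto_const lim2[unfolded I3]])
  from LIMSEQ_unique[OF lim1 this]
  have "(\<integral>\<tau>. of_real (cos (2 * \<tau> * t)) * \<Phi> \<tau> \<partial>lborel) = h t * of_real ((1 / 2 * sqrt (2 * pi)) * (1 / 2 * sqrt (2 * pi)))"
    by (simp only: mult_ac of_real_mult)
  also have "(1 / 2 * sqrt (2 * pi)) * (1 / 2 * sqrt (2 * pi)) = pi / 2"
    by simp
  finally have 1: "(\<integral>\<tau>. of_real (cos (2 * \<tau> * t)) * \<Phi> \<tau> \<partial>lborel) = h t * of_real (pi / 2)" .
  have "integrable lpos (\<lambda>\<tau>. of_real (cos (2 * \<tau> * t)) * \<Phi> \<tau>)"
    by (rule Bochner_Integration.integrable_bound[OF \<Phi>])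
       (auto intro!: measurable_lposI AE_I2 simp: norm_mult mult_left_le_one_le)
  from integrable_lborel_even(2)[OF _ this] \<Phi>even 1
  have "h t * of_real (pi / 2) = 2 * (\<integral>\<tau>. of_real (cos (2 * \<tau> * t)) * \<Phi> \<tau> \<partial>lpos)" by (simp add: scaleR_conv_of_real)
  then show ?thesis by (simp add: mult.commute)
qed

section \<open>The product of Bessel functions as a Fourier transform\<close>

text \<open>
  A lower bound by a multiple of $te^{t/3}$ makes $\sinh^{-1/2}$ comparable to the integrand of a Gamma integral.
\<close>

lemma sinh_lower:
  assumes "t > 0"
  shows "t / 3 * exp (t / 3) \<le> sinh (t :: real)"
proof -
  define y where "y = exp (2 * t / 3)"
  have y1: "y \<ge> 1 + 2 * t / 3" unfolding y_def using exp_ge_add_one_self by blast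
  have y0: "y > 0" by (simp add: y_def)
  have y3: "exp (2 * t) = y * y * y" unfolding y_def by (simp flip: exp_add)
  have y2: "exp (4 * t / 3) = y * y" unfolding y_def by (simp flip: exp_add)
  have "(2 * t / 3) * (y * y) \<le> (y - 1) * (y * y + y + 1)"
    using y1 y0 assms by (intro mult_mono) auto
  also have "\<dots> = exp (2 * t) - 1" unfolding y3 by (simp add: algebra_simps)
  finally have "(2 * t / 3) * exp (4 * t / 3) * exp (- t) \<le> (exp (2 * t) - 1) * exp (- t)"
    unfolding y2 by (rule mult_right_mono) auto
  moreover have "exp (4 * t / 3) * exp (- t) = exp (t / 3)" "exp (2 * t) * exp (- t) = exp t"
    by (simp_all flip: exp_add)
  ultimately have "(2 * t / 3) * exp (t / 3) \<le> exp t - exp (- t)"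
    by (simp only: mult.assoc left_diff_distrib mult_1_left)
  then show ?thesis by (simp add: sinh_field_def)
qed

lemma sinh_powr_integrable: "integrable lpos (\<lambda>t. sinh t powr (- (1/2)))"
proof (rule integrable_lpos_bound)
  show "integrable lpos (\<lambda>t. 3 powr (1/2) * (exp (- (1/6 * t)) * t powr (1/2 - 1)))"
    by (intro integrable_mult_right Gamma_laplace_real(1)) auto
  show "(\<lambda>t. sinh t powr (- (1/2))) \<in> borel_measurable lpos" by (rule measurable_lposI) measurable
  fix t :: real assume t: "t > 0"
  have "sinh t powr (- (1/2)) \<le> (t / 3 * exp (t / 3)) powr (- (1/2))"
    using sinh_lower[OF t] t by (intro powr_mono2') auto
  also have "\<dots> = 3 powr (1/2) * (exp (- (1/6 * t)) * t powr (1/2 - 1))"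
    using t by (simp add: powr_mult powr_divide powr_minus exp_powr_real exp_minus field_simps)
  finally show "norm (sinh t powr (- (1/2))) \<le> 3 powr (1/2) * (exp (- (1/6 * t)) * t powr (1/2 - 1))" by simp
qed

lemma bessel_J_sqrt_sinh_bound:
  assumes C: "\<forall>v\<ge>0. \<bar>bessel_J_sqrt \<alpha> v\<bar> \<le> C \<and> v powr (1/4) * \<bar>bessel_J_sqrt \<alpha> v\<bar> \<le> C" and x: "x > 0" and t: "t > 0"
  shows "\<bar>bessel_J_sqrt \<alpha> (x * (sinh t)\<^sup>2)\<bar> \<le> C * x powr (- (1/4)) * sinh t powr (- (1/2))"
proof -
  have s: "sinh t > 0" using t by simp
  define v where "v = x * (sinh t)\<^sup>2"
  have v: "v > 0" using x s by (simp add: v_def)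
  have "\<bar>bessel_J_sqrt \<alpha> v\<bar> = v powr (- (1/4)) * (v powr (1/4) * \<bar>bessel_J_sqrt \<alpha> v\<bar>)"
    using v by (simp flip: mult.assoc powr_add)
  also have "\<dots> \<le> v powr (- (1/4)) * C" using C v by (intro mult_left_mono) auto
  also have "v powr (- (1/4)) = x powr (- (1/4)) * sinh t powr (- (1/2))"
    unfolding v_def using x s by (simp add: powr_mult powr_powr flip: powr_numeral)
  finally show ?thesis by (simp add: v_def mult_ac)
qed

text \<open>
  Both sides, multiplied by $x^\alpha$, have the Laplace transform $\int_0^\infty e^{2i\tau t}\,$\<open>gauss_sinh \<alpha> p t\<close>$\,dt$: the left
  one by \<open>laplace_KI\<close>, the right one by integrating over \<open>x\<close> first.
\<close>

theorem KI_eq_integral_bessel_J: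
  assumes \<alpha>: "\<alpha> > 1/4" and \<tau>: "\<tau> \<noteq> 0"
  shows "AE x in lpos. KI \<alpha> \<tau> x = (\<integral>t. exp (2 * \<i> * of_real (\<tau> * t)) * of_real (bessel_J_sqrt \<alpha> (x * (sinh t)\<^sup>2)) \<partial>lpos)"
proof -
  have a0: "\<alpha> > 0" using \<alpha> by simp
  obtain C where C: "C \<ge> 0" "\<forall>v\<ge>0. \<bar>bessel_J_sqrt \<alpha> v\<bar> \<le> C \<and> v powr (1/4) * \<bar>bessel_J_sqrt \<alpha> v\<bar> \<le> C"
    using bessel_J_sqrt_bound[OF \<alpha>] by (elim exE conjE)
  let ?e = "\<lambda>t. exp (2 * \<i> * complex_of_real (\<tau> * t))"
  let ?K = "\<lambda>x. \<integral>t. ?e t * of_real (bessel_J_sqrt \<alpha> (x * (sinh t)\<^sup>2)) \<partial>lpos"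
  let ?G = "\<lambda>x. cpow x (of_real \<alpha>) * (KI \<alpha> \<tau> x - ?K x)"
  have L: "integrable lpos (\<lambda>x. of_real (exp (- (p * x))) * ?G x) \<and> (\<integral>x. of_real (exp (- (p * x))) * ?G x \<partial>lpos) = 0"
    if p: "p \<ge> 1" for p
  proof -
    have p0: "p > 0" using p by simp
    let ?g = "\<lambda>x t. of_real (exp (- (p * x))) * cpow x (of_real \<alpha>) * (?e t * complex_of_real (bessel_J_sqrt \<alpha> (x * (sinh t)\<^sup>2)))"
    have m: "(\<lambda>(x, t). ?g x t) \<in> borel_measurable (lpos \<Otimes>\<^sub>M lpos)" by (rule measurable_lpos_lposI) measurable
    have ia: "integrable lpos (\<lambda>x. C * (exp (- (p * x)) * x powr (\<alpha> + 3/4 - 1)))"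
      using p0 a0 by (intro integrable_mult_right Gamma_laplace_real(1)) auto
    have bd: "norm (?g x t) \<le> C * (exp (- (p * x)) * x powr (\<alpha> + 3/4 - 1)) * sinh t powr (- (1/2))"
      if "x \<in> space lpos" "t \<in> space lpos" for x t
    proof -
      have x: "x > 0" and t: "t > 0" using that by auto
      have "norm (?g x t) = exp (- (p * x)) * x powr \<alpha> * \<bar>bessel_J_sqrt \<alpha> (x * (sinh t)\<^sup>2)\<bar>"
        using x by (simp add: norm_mult norm_cpow norm_exp_eq_Re)
      also have "\<dots> \<le> exp (- (p * x)) * x powr \<alpha> * (C * x powr (- (1/4)) * sinh t powr (- (1/2)))"
        by (intro mult_left_mono bessel_J_sqrt_sinh_bound[OF C(2) x t]) auto
      also have "\<dots> = C * (exp (- (p * x)) * (x powr \<alpha> * x powr (- (1/4)))) * sinh t powr (- (1/2))" by (simp add: mult_ac)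
      also have "x powr \<alpha> * x powr (- (1/4)) = x powr (\<alpha> + 3/4 - 1)" using x by (simp flip: powr_add)
      finally show ?thesis .
    qed
    have F: "integrable lpos (\<lambda>x. \<integral>t. ?g x t \<partial>lpos)"
        "(\<integral>x. (\<integral>t. ?g x t \<partial>lpos) \<partial>lpos) = (\<integral>t. (\<integral>x. ?g x t \<partial>lpos) \<partial>lpos)"
      by (rule lpos2.Fubini_product_bound[OF m ia sinh_powr_integrable bd], assumption+)+
    have It: "(\<integral>t. ?g x t \<partial>lpos) = of_real (exp (- (p * x))) * cpow x (of_real \<alpha>) * ?K x" for x
      by (rule integral_mult_right_zero)
    have Ix: "(\<integral>x. ?g x t \<partial>lpos) = ?e t * of_real (gauss_sinh \<alpha> p t)" if t: "t > 0" for t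
    proof -
      have s: "(sinh t)\<^sup>2 > 0" "sinh t > 0" using t by auto
      have "(\<integral>x. ?g x t \<partial>lpos) = (\<integral>x. ?e t * (of_real (exp (- (p * x))) * cpow x (of_real \<alpha>) * complex_of_real (bessel_J_sqrt \<alpha> (x * (sinh t)\<^sup>2))) \<partial>lpos)"
        by (simp only: mult_ac)
      also have "\<dots> = ?e t * of_real (((sinh t)\<^sup>2) powr \<alpha> * p powr (- (2 * \<alpha> + 1)) * exp (- ((sinh t)\<^sup>2 / p)))"
        unfolding integral_mult_right_zero laplace_bessel_J_sqrt(2)[OF a0 p0 s(1)] ..
      also have "((sinh t)\<^sup>2) powr \<alpha> = sinh t powr (2 * \<alpha>)" using s(2) by (simp add: powr_powr flip: powr_numeral)
      finally show ?thesis by (simp add: gauss_sinh_def mult_ac)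
    qed
    have V: "(\<integral>x. of_real (exp (- (p * x))) * cpow x (of_real \<alpha>) * ?K x \<partial>lpos) = (\<integral>t. ?e t * of_real (gauss_sinh \<alpha> p t) \<partial>lpos)"
    proof -
      have "(\<integral>t. (\<integral>x. ?g x t \<partial>lpos) \<partial>lpos) = (\<integral>t. ?e t * of_real (gauss_sinh \<alpha> p t) \<partial>lpos)"
        by (rule integral_cong_lpos) (rule Ix)
      then show ?thesis using F(2) unfolding It by (simp only:)
    qed
    note LK = laplace_KI[OF a0 \<tau> p]
    have eq: "of_real (exp (- (p * x))) * ?G x = of_real (exp (- (p * x))) * cpow x (of_real \<alpha>) * KI \<alpha> \<tau> x - of_real (exp (- (p * x))) * cpow x (of_real \<alpha>) * ?K x" for x
      by (simp only: right_diff_distrib mult.assoc)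
    show ?thesis unfolding eq
      using LK(1) F(1)[unfolded It] LK(2) V by (simp only: Bochner_Integration.integrable_diff Bochner_Integration.integral_diff diff_self simp_thms)
  qed
  have "AE x in lpos. ?G x = 0" by (rule laplace_unique) (use L in auto)
  then show ?thesis by eventually_elim simp
qed

text \<open>
  In $v=\sinh^2t$ this is again a Laplace transform of \<open>bessel_J_sqrt\<close>, now at the parameter $1/p$: the Gaussian
  Hankel transforms are inverted by the same formula that produced them.
\<close>

lemma hankel_gauss_sinh_dual:
  assumes \<alpha>: "\<alpha> > 0" and p: "p > 0" and x: "x > 0"
  shows "(\<integral>t. complex_of_real (gauss_sinh_dual \<alpha> p t * bessel_J_sqrt \<alpha> (x * (sinh t)\<^sup>2)) \<partial>lpos) = 1 / 2 * (cpow x (of_real (\<alpha> + 1)) * of_real (exp (- (p * x))))"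
proof -
  define P where "P = p powr (- (2 * \<alpha> + 1))"
  have pw: "(1 / p) powr (- (2 * \<alpha> + 1)) = 1 / P" "(1 / p) powr (- (2 * \<alpha> + 2)) = p / P"
  proof -
    have r: "(1 / p) powr (- a) = p powr a" for a using p by (simp add: powr_divide powr_minus)
    have "p powr (2 * \<alpha> + 2) = p * p powr (2 * \<alpha> + 1)"
    proof -
      have e: "2 * \<alpha> + 2 = 1 + (2 * \<alpha> + 1)" by simp
      show ?thesis unfolding e powr_add[of p 1] using p by simp
    qed
    moreover have "P = 1 / p powr (2 * \<alpha> + 1)" unfolding P_def powr_minus by (rule inverse_eq_divide)
    ultimately show "(1 / p) powr (- (2 * \<alpha> + 1)) = 1 / P" "(1 / p) powr (- (2 * \<alpha> + 2)) = p / P"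
      unfolding r by simp_all
  qed
  let ?E = "\<lambda>v. of_real (exp (- (1 / p * v))) * cpow v (of_real \<alpha>) * complex_of_real (bessel_J_sqrt \<alpha> (v * x))"
  let ?E1 = "\<lambda>v. of_real (exp (- (1 / p * v))) * cpow v (of_real (\<alpha> + 1)) * complex_of_real (bessel_J_sqrt \<alpha> (v * x))"
  let ?f = "\<lambda>v. of_real (1 / 2 * P) * (of_real ((2 * \<alpha> + 1) / p) * ?E v - of_real (1 / p\<^sup>2) * ?E1 v)"
  have p': "1 / p > 0" using p by simp
  note B = laplace_bessel_J_sqrt[OF \<alpha> p' x]
  have fm: "?f \<in> borel_measurable borel" by measurable
  have fi: "integrable lpos ?f"
    using B(1,3) by (intro integrable_mult_right Bochner_Integration.integrable_diff) auto
  have "integral\<^sup>L lpos ?f = of_real (1 / 2 * P) * (of_real ((2 * \<alpha> + 1) / p) * integral\<^sup>L lpos ?E - of_real (1 / p\<^sup>2) * integral\<^sup>L lpos ?E1)"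
    unfolding integral_mult_right_zero
    by (subst Bochner_Integration.integral_diff) (use B(1,3) in \<open>auto simp del: of_real_divide of_real_add of_real_power\<close>)
  also have "\<dots> = of_real (1 / 2 * P * ((2 * \<alpha> + 1) / p * (x powr \<alpha> * (1 / p) powr (- (2 * \<alpha> + 1)) * exp (- (x / (1 / p))))
       - 1 / p\<^sup>2 * (x powr \<alpha> * (1 / p) powr (- (2 * \<alpha> + 2)) * (2 * \<alpha> + 1 - x / (1 / p)) * exp (- (x / (1 / p))))))"
    unfolding B(2,4) by (simp only: of_real_mult of_real_diff)
  also have "1 / 2 * P * ((2 * \<alpha> + 1) / p * (x powr \<alpha> * (1 / p) powr (- (2 * \<alpha> + 1)) * exp (- (x / (1 / p))))
       - 1 / p\<^sup>2 * (x powr \<alpha> * (1 / p) powr (- (2 * \<alpha> + 2)) * (2 * \<alpha> + 1 - x / (1 / p)) * exp (- (x / (1 / p)))))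
     = 1 / 2 * (x powr (\<alpha> + 1) * exp (- (p * x)))"
  proof -
    have P0: "P > 0" using p by (simp add: P_def)
    have xx: "x powr (\<alpha> + 1) = x powr \<alpha> * x" using x by (simp add: powr_add)
    have e: "exp (- (x / (1 / p))) = exp (- (p * x))" by (simp add: mult.commute)
    show ?thesis unfolding pw xx e using P0 p by (simp add: field_simps power2_eq_square)
  qed
  also have "complex_of_real (1 / 2 * (x powr (\<alpha> + 1) * exp (- (p * x)))) = 1 / 2 * (cpow x (of_real (\<alpha> + 1)) * of_real (exp (- (p * x))))"
    using cpow_of_real[OF x, of "\<alpha> + 1"] by simp
  finally have V: "integral\<^sup>L lpos ?f = 1 / 2 * (cpow x (of_real (\<alpha> + 1)) * of_real (exp (- (p * x))))" .
  have eq: "(2 * sinh t * cosh t) *\<^sub>R ?f ((sinh t)\<^sup>2) = complex_of_real (gauss_sinh_dual \<alpha> p t * bessel_J_sqrt \<alpha> (x * (sinh t)\<^sup>2))" if t: "t > 0" for t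
  proof -
    have s: "(sinh t)\<^sup>2 > 0" "sinh t > 0" using t by auto
    have 1: "((sinh t)\<^sup>2) powr \<alpha> = sinh t powr (2 * \<alpha>)" using s(2) by (simp add: powr_powr flip: powr_numeral)
    have 2: "((sinh t)\<^sup>2) powr (\<alpha> + 1) = sinh t powr (2 * \<alpha>) * (sinh t)\<^sup>2" using s 1 by (simp add: powr_add)
    have "?f ((sinh t)\<^sup>2) = of_real (1 / 2 * P * ((2 * \<alpha> + 1) / p * (exp (- (1 / p * (sinh t)\<^sup>2)) * ((sinh t)\<^sup>2) powr \<alpha> * bessel_J_sqrt \<alpha> ((sinh t)\<^sup>2 * x))
       - 1 / p\<^sup>2 * (exp (- (1 / p * (sinh t)\<^sup>2)) * ((sinh t)\<^sup>2) powr (\<alpha> + 1) * bessel_J_sqrt \<alpha> ((sinh t)\<^sup>2 * x))))"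
      unfolding cpow_of_real[OF s(1)] by (simp only: of_real_mult of_real_diff)
    then show ?thesis unfolding 1 2 scaleR_conv_of_real gauss_sinh_dual_def gauss_sinh_def P_def[symmetric]
      by (simp only: of_real_mult[symmetric] of_real_eq_iff) (simp add: algebra_simps)
  qed
  have "integral\<^sup>L lpos ?f = (\<integral>t. (2 * sinh t * cosh t) *\<^sub>R ?f ((sinh t)\<^sup>2) \<partial>lpos)"
    by (rule sinh_square_substitution(2)[OF fm fi])
  also have "\<dots> = (\<integral>t. complex_of_real (gauss_sinh_dual \<alpha> p t * bessel_J_sqrt \<alpha> (x * (sinh t)\<^sup>2)) \<partial>lpos)"
    by (rule integral_cong_lpos) (rule eq)
  finally show ?thesis using V by simp
qed

section \<open>Inversion of the transform\<close>

text \<open>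
  The function \<open>h\<close> of the introduction.
\<close>

definition hankel_sinh :: "real \<Rightarrow> (real \<Rightarrow> complex) \<Rightarrow> real \<Rightarrow> complex" where
  "hankel_sinh \<alpha> f t = (\<integral>x. f x * of_real (bessel_J_sqrt \<alpha> (x * (sinh t)\<^sup>2)) \<partial>lpos)"

text \<open>
  Up to the factor $2\sqrt\pi/\cosh(\pi\tau)$ this is the index transform of \<open>f\<close>
  (\<open>hankel_sinh_integrable_and_transform\<close>).
\<close>

definition cos_hankel :: "real \<Rightarrow> (real \<Rightarrow> complex) \<Rightarrow> real \<Rightarrow> complex" where
  "cos_hankel \<alpha> f \<tau> = (\<integral>t. of_real (cos (2 * \<tau> * t)) * hankel_sinh \<alpha> f t \<partial>lpos)"

lemma bessel_J_sqrt_0 [simp]: "bessel_J_sqrt \<alpha> 0 = 0"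
  by (simp add: bessel_J_sqrt_def)

lemma hankel_sinh_even: "hankel_sinh \<alpha> f (- t) = hankel_sinh \<alpha> f t"
  by (simp add: hankel_sinh_def)

lemma hankel_sinh_0: "hankel_sinh \<alpha> f 0 = 0"
  by (simp add: hankel_sinh_def)

lemma hankel_sinh_bounded_continuous:
  assumes \<alpha>: "\<alpha> > 1/4" and fm [measurable]: "f \<in> borel_measurable borel" and f1: "integrable lpos f"
  shows "\<exists>C. \<forall>t. norm (hankel_sinh \<alpha> f t) \<le> C" and "continuous_on UNIV (hankel_sinh \<alpha> f)"
proof -
  obtain C where C: "C \<ge> 0" "\<forall>v\<ge>0. \<bar>bessel_J_sqrt \<alpha> v\<bar> \<le> C \<and> v powr (1/4) * \<bar>bessel_J_sqrt \<alpha> v\<bar> \<le> C"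
    using bessel_J_sqrt_bound[OF \<alpha>] by (elim exE conjE)
  have bd: "norm (f x * of_real (bessel_J_sqrt \<alpha> (x * (sinh t)\<^sup>2))) \<le> norm (f x) * C" if "x \<in> space lpos" for x t
    using C(2) that by (auto simp: norm_mult intro!: mult_left_mono)
  have w: "integrable lpos (\<lambda>x. norm (f x) * C)" using f1 by (intro integrable_mult_left integrable_norm)
  have m: "(\<lambda>x. f x * of_real (bessel_J_sqrt \<alpha> (x * (sinh t)\<^sup>2))) \<in> borel_measurable lpos" for t
    by (rule measurable_lposI) measurable
  have "norm (hankel_sinh \<alpha> f t) \<le> (\<integral>x. norm (f x) * C \<partial>lpos)" for t
    unfolding hankel_sinh_def
    by (rule Bochner_Integration.integral_norm_bound_integral[OF integrable_lpos_bound[OF w m] w]) (use bd in auto)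
  then show "\<exists>C. \<forall>t. norm (hankel_sinh \<alpha> f t) \<le> C" by blast
  show "continuous_on UNIV (hankel_sinh \<alpha> f)"
    unfolding hankel_sinh_def[abs_def]
  proof (rule continuous_on_integral_dominated[OF m w _ bd])
    fix x assume "x \<in> space lpos"
    then show "continuous_on UNIV (\<lambda>t. f x * of_real (bessel_J_sqrt \<alpha> (x * (sinh t)\<^sup>2)))"
      using \<alpha> by (intro continuous_intros continuous_on_bessel_J_sqrt) auto
  qed
qed

lemma KI_measurable_lpos:
  assumes "\<alpha> > 0" "\<tau> \<noteq> 0"
  shows "KI \<alpha> \<tau> \<in> borel_measurable lpos"
proof -
  have "(\<lambda>x. 1 / 2 * cpow (x / 4) (- (\<i> * of_real \<tau>)) * (macdonald (Complex \<alpha> \<tau>) (x / 4) * clifford (Complex \<alpha> (- \<tau>)) (of_real (x / 4)))) \<in> borel_measurable lpos"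
    by (rule measurable_lposI) measurable
  also have "?this \<longleftrightarrow> KI \<alpha> \<tau> \<in> borel_measurable lpos"
    by (rule measurable_cong) (use KI_eq[OF assms] in auto)
  finally show ?thesis .
qed

lemma cos_hankel_measurable:
  assumes "continuous_on UNIV (hankel_sinh \<alpha> f)"
  shows "cos_hankel \<alpha> f \<in> borel_measurable borel"
proof -
  have [measurable]: "hankel_sinh \<alpha> f \<in> borel_measurable borel" using assms by (rule borel_measurable_continuous_onI)
  show ?thesis unfolding cos_hankel_def[abs_def]
    by (rule lpos.borel_measurable_lebesgue_integral, rule measurable_snd_lpos) measurable
qed

lemma hankel_sinh_integrable_and_transform:
  assumes \<alpha>: "\<alpha> > 1/4" and fm [measurable]: "f \<in> borel_measurable borel"
    and f34: "integrable lpos (\<lambda>x. norm (f x) * x powr (- (1/4)))"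
  shows "integrable lpos (hankel_sinh \<alpha> f)"
    and "\<tau> \<noteq> 0 \<Longrightarrow> (\<integral>x. of_real (Re (KI \<alpha> \<tau> x)) * f x \<partial>lpos) = cos_hankel \<alpha> f \<tau>"
proof -
  obtain C where C: "C \<ge> 0" "\<forall>v\<ge>0. \<bar>bessel_J_sqrt \<alpha> v\<bar> \<le> C \<and> v powr (1/4) * \<bar>bessel_J_sqrt \<alpha> v\<bar> \<le> C"
    using bessel_J_sqrt_bound[OF \<alpha>] by (elim exE conjE)
  let ?g = "\<lambda>\<tau> x t. of_real (cos (2 * \<tau> * t)) * (f x * complex_of_real (bessel_J_sqrt \<alpha> (x * (sinh t)\<^sup>2)))"
  have m: "(\<lambda>(x, t). ?g \<tau> x t) \<in> borel_measurable (lpos \<Otimes>\<^sub>M lpos)" for \<tau>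
    by (rule measurable_lpos_lposI) measurable
  have ia: "integrable lpos (\<lambda>x. C * (norm (f x) * x powr (- (1/4))))" using f34 by (rule integrable_mult_right)
  have bd: "norm (?g \<tau> x t) \<le> C * (norm (f x) * x powr (- (1/4))) * sinh t powr (- (1/2))"
    if "x \<in> space lpos" "t \<in> space lpos" for \<tau> x t
  proof -
    have "norm (?g \<tau> x t) \<le> 1 * (norm (f x) * \<bar>bessel_J_sqrt \<alpha> (x * (sinh t)\<^sup>2)\<bar>)"
      unfolding norm_mult norm_of_real by (intro mult_right_mono) auto
    also have "\<dots> \<le> 1 * (norm (f x) * (C * x powr (- (1/4)) * sinh t powr (- (1/2))))"
      using that by (intro mult_left_mono bessel_J_sqrt_sinh_bound[OF C(2)]) auto
    finally show ?thesis by (simp add: mult_ac)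
  qed
  have F: "integrable lpos (\<lambda>t. \<integral>x. ?g \<tau> x t \<partial>lpos)"
      "(\<integral>x. (\<integral>t. ?g \<tau> x t \<partial>lpos) \<partial>lpos) = (\<integral>t. (\<integral>x. ?g \<tau> x t \<partial>lpos) \<partial>lpos)" for \<tau>
    by (rule lpos2.Fubini_product_bound[OF m ia sinh_powr_integrable bd], assumption+)+
  have It: "(\<integral>x. ?g \<tau> x t \<partial>lpos) = of_real (cos (2 * \<tau> * t)) * hankel_sinh \<alpha> f t" for t \<tau>
    unfolding hankel_sinh_def by (rule integral_mult_right_zero)
  show "integrable lpos (hankel_sinh \<alpha> f)" using F(1)[of 0] unfolding It by simp
  show "(\<integral>x. of_real (Re (KI \<alpha> \<tau> x)) * f x \<partial>lpos) = cos_hankel \<alpha> f \<tau>" if \<tau>: "\<tau> \<noteq> 0"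
  proof -
    let ?e = "\<lambda>t. exp (2 * \<i> * complex_of_real (\<tau> * t))"
    have Ix: "(\<integral>t. ?g \<tau> x t \<partial>lpos) = of_real (Re (\<integral>t. ?e t * of_real (bessel_J_sqrt \<alpha> (x * (sinh t)\<^sup>2)) \<partial>lpos)) * f x"
      if x: "x > 0" for x
    proof -
      have i: "integrable lpos (\<lambda>t. ?e t * of_real (bessel_J_sqrt \<alpha> (x * (sinh t)\<^sup>2)))"
      proof (rule integrable_lpos_bound)
        show "integrable lpos (\<lambda>t. C * x powr (- (1/4)) * sinh t powr (- (1/2)))"
          by (intro integrable_mult_right sinh_powr_integrable)
        show "(\<lambda>t. ?e t * of_real (bessel_J_sqrt \<alpha> (x * (sinh t)\<^sup>2))) \<in> borel_measurable lpos"
          by (rule measurable_lposI) measurable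
        show "norm (?e t * of_real (bessel_J_sqrt \<alpha> (x * (sinh t)\<^sup>2))) \<le> C * x powr (- (1/4)) * sinh t powr (- (1/2))" if "t > 0" for t
          using bessel_J_sqrt_sinh_bound[OF C(2) x that] by (simp add: norm_mult norm_exp_eq_Re)
      qed
      have re: "Re (?e t * of_real (bessel_J_sqrt \<alpha> (x * (sinh t)\<^sup>2))) = cos (2 * \<tau> * t) * bessel_J_sqrt \<alpha> (x * (sinh t)\<^sup>2)" for t
        by (simp add: Re_exp mult.assoc)
      have "complex_of_real (Re (\<integral>t. ?e t * of_real (bessel_J_sqrt \<alpha> (x * (sinh t)\<^sup>2)) \<partial>lpos)) =
         (\<integral>t. of_real (cos (2 * \<tau> * t) * bessel_J_sqrt \<alpha> (x * (sinh t)\<^sup>2)) \<partial>lpos)"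
        unfolding integral_Re[OF i, symmetric] re by (rule integral_complex_of_real[symmetric])
      moreover have "(\<integral>t. ?g \<tau> x t \<partial>lpos) = (\<integral>t. of_real (cos (2 * \<tau> * t) * bessel_J_sqrt \<alpha> (x * (sinh t)\<^sup>2)) * f x \<partial>lpos)"
        by (simp only: of_real_mult mult_ac)
      ultimately show ?thesis by (simp only: integral_mult_left_zero)
    qed
    have "(\<integral>x. of_real (Re (KI \<alpha> \<tau> x)) * f x \<partial>lpos) = (\<integral>x. (\<integral>t. ?g \<tau> x t \<partial>lpos) \<partial>lpos)"
    proof (rule integral_cong_AE)
      have [measurable]: "KI \<alpha> \<tau> \<in> borel_measurable lpos" using KI_measurable_lpos \<alpha> \<tau> by simp
      have [measurable]: "f \<in> borel_measurable lpos" by (rule measurable_lposI) measurable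
      show "(\<lambda>x. of_real (Re (KI \<alpha> \<tau> x)) * f x) \<in> borel_measurable lpos" by measurable
      show "(\<lambda>x. \<integral>t. ?g \<tau> x t \<partial>lpos) \<in> borel_measurable lpos"
        by (rule lpos.borel_measurable_lebesgue_integral) (rule m)
      show "AE x in lpos. of_real (Re (KI \<alpha> \<tau> x)) * f x = (\<integral>t. ?g \<tau> x t \<partial>lpos)"
        using KI_eq_integral_bessel_J[OF \<alpha> \<tau>] AE_space[of lpos] by eventually_elim (simp only: space_lpos greaterThan_iff Ix)
    qed
    also have "\<dots> = cos_hankel \<alpha> f \<tau>" unfolding F(2) It cos_hankel_def ..
    finally show ?thesis .
  qed
qed

text \<open>
  The factor $e^{\pi\tau}$ in the hypothesis matches the growth of \<open>kernel_core\<close> in $\tau$. The second claim is cosine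
  inversion at $t=0$, where \<open>hankel_sinh\<close> vanishes because $J_{2\alpha}(0)=0$.
\<close>

theorem transform_inversion:
  assumes \<alpha>: "\<alpha> > 1/4" and fm [measurable]: "f \<in> borel_measurable borel"
    and f1: "integrable lpos f" and f34: "integrable lpos (\<lambda>x. norm (f x) * x powr (- (1/4)))"
    and \<Phi>: "integrable lpos (\<lambda>\<tau>. norm (cos_hankel \<alpha> f \<tau>) * exp (pi * \<tau>))"
  defines "R \<equiv> (\<lambda>x. of_real (4 / (pi * x)) * (\<integral>\<tau>. of_real (Re (kernel_core \<alpha> \<tau> x)) * cos_hankel \<alpha> f \<tau> \<partial>lpos))"
  shows "integrable lpos (cos_hankel \<alpha> f)" "(\<integral>\<tau>. cos_hankel \<alpha> f \<tau> \<partial>lpos) = 0"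
    and "\<And>x. x > 0 \<Longrightarrow> integrable lpos (\<lambda>\<tau>. of_real (Re (kernel_core \<alpha> \<tau> x)) * cos_hankel \<alpha> f \<tau>)"
    and "continuous_on {0<..} R" and "AE x in lpos. f x = R x"
proof -
  have a0: "\<alpha> > 0" using \<alpha> by simp
  obtain C where C: "\<forall>t. norm (hankel_sinh \<alpha> f t) \<le> C" using hankel_sinh_bounded_continuous(1)[OF \<alpha> fm f1] by (elim exE)
  have hc: "continuous_on UNIV (hankel_sinh \<alpha> f)" by (rule hankel_sinh_bounded_continuous(2)[OF \<alpha> fm f1])
  have hi: "integrable lpos (hankel_sinh \<alpha> f)" by (rule hankel_sinh_integrable_and_transform(1)[OF \<alpha> fm f34])
  have Pm [measurable]: "cos_hankel \<alpha> f \<in> borel_measurable borel" by (rule cos_hankel_measurable[OF hc])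
  have Pml: "cos_hankel \<alpha> f \<in> borel_measurable lpos" by (rule measurable_lposI[OF Pm])
  show Pi: "integrable lpos (cos_hankel \<alpha> f)"
  proof (rule integrable_lpos_bound[OF \<Phi> Pml])
    fix \<tau> :: real assume "\<tau> > 0"
    then have "norm (cos_hankel \<alpha> f \<tau>) * 1 \<le> norm (cos_hankel \<alpha> f \<tau>) * exp (pi * \<tau>)" by (intro mult_left_mono) auto
    then show "norm (cos_hankel \<alpha> f \<tau>) \<le> norm (cos_hankel \<alpha> f \<tau>) * exp (pi * \<tau>)" by simp
  qed
  have inv: "(\<integral>\<tau>. of_real (cos (2 * \<tau> * t)) * cos_hankel \<alpha> f \<tau> \<partial>lpos) = of_real (pi / 4) * hankel_sinh \<alpha> f t" for t
    unfolding cos_hankel_def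
    by (rule cosine_inversion[OF hankel_sinh_even hc hi])
       (use C Pi in \<open>auto simp: cos_hankel_def[abs_def]\<close>)
  show "(\<integral>\<tau>. cos_hankel \<alpha> f \<tau> \<partial>lpos) = 0" using inv[of 0] by (simp add: hankel_sinh_0)
  obtain D where D: "D \<ge> 0" "\<forall>\<tau>>0. \<forall>x>0. norm (kernel_core \<alpha> \<tau> x) \<le> D * exp (pi * \<tau>) * exp (x / 2)"
    using kernel_core_bound[OF a0] by (elim exE conjE)
  have Zb: "norm (of_real (Re (kernel_core \<alpha> \<tau> x)) * cos_hankel \<alpha> f \<tau>) \<le> D * exp (x / 2) * (norm (cos_hankel \<alpha> f \<tau>) * exp (pi * \<tau>))"
    if "\<tau> > 0" "x > 0" for \<tau> x
  proof -
    have "\<bar>Re (kernel_core \<alpha> \<tau> x)\<bar> \<le> D * exp (pi * \<tau>) * exp (x / 2)"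
      using abs_Re_le_cmod[of "kernel_core \<alpha> \<tau> x"] D(2) that by (meson order_trans)
    then have "\<bar>Re (kernel_core \<alpha> \<tau> x)\<bar> * norm (cos_hankel \<alpha> f \<tau>) \<le> D * exp (pi * \<tau>) * exp (x / 2) * norm (cos_hankel \<alpha> f \<tau>)"
      by (rule mult_right_mono) auto
    then show ?thesis by (simp add: norm_mult mult_ac)
  qed
  have Zm: "(\<lambda>\<tau>. of_real (Re (kernel_core \<alpha> \<tau> x)) * cos_hankel \<alpha> f \<tau>) \<in> borel_measurable lpos" for x
    by (rule measurable_lposI) measurable
  show "integrable lpos (\<lambda>\<tau>. of_real (Re (kernel_core \<alpha> \<tau> x)) * cos_hankel \<alpha> f \<tau>)" if "x > 0" for x
    by (rule integrable_lpos_bound[OF integrable_mult_right[OF \<Phi>, of "D * exp (x / 2)"] Zm Zb[OF _ that]])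
  show Rc: "continuous_on {0<..} R"
  proof -
    have I: "continuous_on {0<..<b} (\<lambda>x. \<integral>\<tau>. of_real (Re (kernel_core \<alpha> \<tau> x)) * cos_hankel \<alpha> f \<tau> \<partial>lpos)" for b
    proof (rule continuous_on_integral_dominated[OF Zm integrable_mult_right[OF \<Phi>, of "D * exp (b / 2)"]])
      show "continuous_on {0<..<b} (\<lambda>x. of_real (Re (kernel_core \<alpha> \<tau> x)) * cos_hankel \<alpha> f \<tau>)" for \<tau>
        by (intro continuous_intros continuous_on_subset[OF continuous_on_kernel_core[OF a0]]) auto
      fix x \<tau> :: real assume x: "x \<in> {0<..<b}" and "\<tau> \<in> space lpos"
      then have "norm (of_real (Re (kernel_core \<alpha> \<tau> x)) * cos_hankel \<alpha> f \<tau>) \<le> D * exp (x / 2) * (norm (cos_hankel \<alpha> f \<tau>) * exp (pi * \<tau>))"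
        by (intro Zb) auto
      also have "\<dots> \<le> D * exp (b / 2) * (norm (cos_hankel \<alpha> f \<tau>) * exp (pi * \<tau>))"
        using x D(1) by (intro mult_right_mono mult_left_mono) auto
      finally show "norm (of_real (Re (kernel_core \<alpha> \<tau> x)) * cos_hankel \<alpha> f \<tau>) \<le> D * exp (b / 2) * (norm (cos_hankel \<alpha> f \<tau>) * exp (pi * \<tau>))" .
    qed
    have "isCont (\<lambda>x. \<integral>\<tau>. of_real (Re (kernel_core \<alpha> \<tau> x)) * cos_hankel \<alpha> f \<tau> \<partial>lpos) x" if "x > 0" for x
      using I[of "x + 1"] that by (simp add: continuous_on_eq_continuous_at)
    then have "continuous_on {0<..} (\<lambda>x. \<integral>\<tau>. of_real (Re (kernel_core \<alpha> \<tau> x)) * cos_hankel \<alpha> f \<tau> \<partial>lpos)"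
      by (simp add: continuous_on_eq_continuous_at)
    moreover have "continuous_on {0<..} (\<lambda>x. complex_of_real (4 / (pi * x)))" by (intro continuous_intros) auto
    ultimately show ?thesis unfolding R_def by (intro continuous_on_mult)
  qed
  let ?G = "\<lambda>x. cpow x (of_real (\<alpha> + 1)) * (f x - R x)"
  have L: "integrable lpos (\<lambda>x. of_real (exp (- (p * x))) * ?G x) \<and> (\<integral>x. of_real (exp (- (p * x))) * ?G x \<partial>lpos) = 0"
    if p: "p \<ge> 1" for p
  proof -
    have p0: "p > 0" using p by simp
    have di: "integrable lpos (gauss_sinh_dual \<alpha> p)" by (rule gauss_sinh_dual_integrable[OF a0 p0])
    let ?w = "\<lambda>x. complex_of_real (exp (- (p * x))) * cpow x (of_real \<alpha>)"
    let ?w1 = "\<lambda>x. complex_of_real (exp (- (p * x))) * cpow x (of_real (\<alpha> + 1))"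
    \<comment> \<open>Integrate the kernel against the test function first: its Laplace transform is known.\<close>
    let ?g = "\<lambda>x \<tau>. ?w x * (of_real (Re (kernel_core \<alpha> \<tau> x)) * cos_hankel \<alpha> f \<tau>)"
    have m1: "(\<lambda>(x, \<tau>). ?g x \<tau>) \<in> borel_measurable (lpos \<Otimes>\<^sub>M lpos)" by (rule measurable_lpos_lposI) measurable
    have ia: "integrable lpos (\<lambda>x. D * (exp (- ((p - 1/2) * x)) * x powr (\<alpha> + 1 - 1)))"
      using p a0 by (intro integrable_mult_right Gamma_laplace_real(1)) auto
    have bd1: "norm (?g x \<tau>) \<le> D * (exp (- ((p - 1/2) * x)) * x powr (\<alpha> + 1 - 1)) * (norm (cos_hankel \<alpha> f \<tau>) * exp (pi * \<tau>))"
      if "x \<in> space lpos" "\<tau> \<in> space lpos" for x \<tau>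
    proof -
      have x: "x > 0" and \<tau>: "\<tau> > 0" using that by auto
      have "norm (?g x \<tau>) = (exp (- (p * x)) * x powr \<alpha>) * norm (of_real (Re (kernel_core \<alpha> \<tau> x)) * cos_hankel \<alpha> f \<tau>)"
        using x by (simp add: norm_mult norm_cpow)
      also have "\<dots> \<le> (exp (- (p * x)) * x powr \<alpha>) * (D * exp (x / 2) * (norm (cos_hankel \<alpha> f \<tau>) * exp (pi * \<tau>)))"
        by (intro mult_left_mono Zb x \<tau>) auto
      also have "\<dots> = D * (exp (- (p * x)) * exp (x / 2) * x powr (\<alpha> + 1 - 1)) * (norm (cos_hankel \<alpha> f \<tau>) * exp (pi * \<tau>))"
        by (simp add: mult_ac)
      also have "exp (- (p * x)) * exp (x / 2) = exp (- ((p - 1/2) * x))" by (simp add: algebra_simps flip: exp_add)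
      finally show ?thesis .
    qed
    have F1: "integrable lpos (\<lambda>x. \<integral>\<tau>. ?g x \<tau> \<partial>lpos)"
        "(\<integral>x. (\<integral>\<tau>. ?g x \<tau> \<partial>lpos) \<partial>lpos) = (\<integral>\<tau>. (\<integral>x. ?g x \<tau> \<partial>lpos) \<partial>lpos)"
      by (rule lpos2.Fubini_product_bound[OF m1 ia \<Phi> bd1], assumption+)+
    have R1: "?w1 x * R x = of_real (4 / pi) * (\<integral>\<tau>. ?g x \<tau> \<partial>lpos)" if x: "x > 0" for x
    proof -
      have "?w1 x = ?w x * of_real x" using x by (simp add: cpow_add cpow_1)
      then have "?w1 x * R x = ?w x * (of_real x * of_real (4 / (pi * x))) * (\<integral>\<tau>. of_real (Re (kernel_core \<alpha> \<tau> x)) * cos_hankel \<alpha> f \<tau> \<partial>lpos)"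
        unfolding R_def by (simp only: mult_ac)
      also have "of_real x * of_real (4 / (pi * x)) = complex_of_real (4 / pi)" using x by simp
      finally show ?thesis unfolding integral_mult_right_zero by (simp only: mult_ac)
    qed
    have I1: "(\<integral>x. ?g x \<tau> \<partial>lpos) = 2 * (\<integral>t. of_real (cos (2 * \<tau> * t) * gauss_sinh_dual \<alpha> p t) * cos_hankel \<alpha> f \<tau> \<partial>lpos)" for \<tau>
    proof -
      note LZ = laplace_kernel_core[OF a0 p, of \<tau>]
      have wr: "?w x = of_real (exp (- (p * x)) * x powr \<alpha>)" if "x > 0" for x using that by (simp add: cpow_of_real)
      have "(\<integral>x. ?g x \<tau> \<partial>lpos) = (\<integral>x. ?w x * of_real (Re (kernel_core \<alpha> \<tau> x)) \<partial>lpos) * cos_hankel \<alpha> f \<tau>"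
        unfolding integral_mult_left_zero[symmetric] by (simp only: mult.assoc)
      also have "(\<integral>x. ?w x * of_real (Re (kernel_core \<alpha> \<tau> x)) \<partial>lpos) = (\<integral>x. of_real (Re (?w x * kernel_core \<alpha> \<tau> x)) \<partial>lpos)"
        by (rule integral_cong_lpos) (simp add: wr del: of_real_mult, simp)
      also have "\<dots> = of_real (Re (\<integral>x. ?w x * kernel_core \<alpha> \<tau> x \<partial>lpos))"
        unfolding integral_complex_of_real by (simp only: integral_Re[OF LZ(1)])
      also have "\<dots> = 2 * of_real (Re (\<integral>t. exp (2 * \<i> * of_real (\<tau> * t)) * of_real (gauss_sinh_dual \<alpha> p t) \<partial>lpos))"
        unfolding LZ(2) by simp
      also have "Re (\<integral>t. exp (2 * \<i> * of_real (\<tau> * t)) * of_real (gauss_sinh_dual \<alpha> p t) \<partial>lpos) = (\<integral>t. cos (2 * \<tau> * t) * gauss_sinh_dual \<alpha> p t \<partial>lpos)"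
      proof -
        have i: "integrable lpos (\<lambda>t. exp (2 * \<i> * complex_of_real (\<tau> * t)) * of_real (gauss_sinh_dual \<alpha> p t))"
          by (rule integrable_lpos_bound[OF integrable_norm[OF di]])
             (auto intro!: measurable_lposI simp: norm_mult norm_exp_eq_Re)
        have "Re (exp (2 * \<i> * complex_of_real (\<tau> * t)) * of_real (gauss_sinh_dual \<alpha> p t)) = cos (2 * \<tau> * t) * gauss_sinh_dual \<alpha> p t" for t
          by (simp add: Re_exp mult.assoc)
        then show ?thesis unfolding integral_Re[OF i, symmetric] by (simp only:)
      qed
      also have "2 * complex_of_real (\<integral>t. cos (2 * \<tau> * t) * gauss_sinh_dual \<alpha> p t \<partial>lpos) * cos_hankel \<alpha> f \<tau> =
          2 * (\<integral>t. of_real (cos (2 * \<tau> * t) * gauss_sinh_dual \<alpha> p t) * cos_hankel \<alpha> f \<tau> \<partial>lpos)"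
        unfolding integral_mult_left_zero integral_complex_of_real by (simp only: mult.assoc)
      finally show ?thesis .
    qed
    \<comment> \<open>Cosine inversion turns the remaining \<open>\<tau>\<close>-integral back into the Hankel transform of \<open>f\<close>.\<close>
    let ?k = "\<lambda>\<tau> t. of_real (cos (2 * \<tau> * t) * gauss_sinh_dual \<alpha> p t) * cos_hankel \<alpha> f \<tau>"
    have m2: "(\<lambda>(\<tau>, t). ?k \<tau> t) \<in> borel_measurable (lpos \<Otimes>\<^sub>M lpos)" by (rule measurable_lpos_lposI) measurable
    have bd2: "norm (?k \<tau> t) \<le> norm (cos_hankel \<alpha> f \<tau>) * norm (gauss_sinh_dual \<alpha> p t)" for \<tau> t
      using mult_right_mono[of "\<bar>cos (2 * \<tau> * t)\<bar>" 1 "\<bar>gauss_sinh_dual \<alpha> p t\<bar> * norm (cos_hankel \<alpha> f \<tau>)"]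
      by (simp add: norm_mult abs_mult mult_ac)
    note F2 = lpos2.Fubini_product_bound(3)[OF m2 integrable_norm[OF Pi] integrable_norm[OF di] bd2]
    have I2: "(\<integral>\<tau>. ?k \<tau> t \<partial>lpos) = of_real (gauss_sinh_dual \<alpha> p t) * (of_real (pi / 4) * hankel_sinh \<alpha> f t)" for t
    proof -
      have "(\<integral>\<tau>. ?k \<tau> t \<partial>lpos) = (\<integral>\<tau>. of_real (gauss_sinh_dual \<alpha> p t) * (of_real (cos (2 * \<tau> * t)) * cos_hankel \<alpha> f \<tau>) \<partial>lpos)"
        by (simp only: of_real_mult mult_ac)
      then show ?thesis unfolding integral_mult_right_zero inv .
    qed
    \<comment> \<open>Hankel inversion on the test function recovers the Laplace transform of \<open>f\<close>.\<close>
    let ?l = "\<lambda>x t. f x * complex_of_real (gauss_sinh_dual \<alpha> p t * bessel_J_sqrt \<alpha> (x * (sinh t)\<^sup>2))"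
    obtain B where B: "B \<ge> 0" "\<forall>v\<ge>0. \<bar>bessel_J_sqrt \<alpha> v\<bar> \<le> B \<and> v powr (1/4) * \<bar>bessel_J_sqrt \<alpha> v\<bar> \<le> B"
      using bessel_J_sqrt_bound[OF \<alpha>] by (elim exE conjE)
    have m3: "(\<lambda>(x, t). ?l x t) \<in> borel_measurable (lpos \<Otimes>\<^sub>M lpos)" by (rule measurable_lpos_lposI) measurable
    have bd3: "norm (?l x t) \<le> (norm (f x) * B) * norm (gauss_sinh_dual \<alpha> p t)" if "x \<in> space lpos" "t \<in> space lpos" for x t
    proof -
      have "\<bar>bessel_J_sqrt \<alpha> (x * (sinh t)\<^sup>2)\<bar> \<le> B" using B(2) that by auto
      then have "(norm (f x) * \<bar>gauss_sinh_dual \<alpha> p t\<bar>) * \<bar>bessel_J_sqrt \<alpha> (x * (sinh t)\<^sup>2)\<bar> \<le> (norm (f x) * \<bar>gauss_sinh_dual \<alpha> p t\<bar>) * B"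
        by (intro mult_left_mono) auto
      then show ?thesis by (simp add: norm_mult abs_mult mult_ac)
    qed
    have F3: "integrable lpos (\<lambda>x. \<integral>t. ?l x t \<partial>lpos)"
        "(\<integral>x. (\<integral>t. ?l x t \<partial>lpos) \<partial>lpos) = (\<integral>t. (\<integral>x. ?l x t \<partial>lpos) \<partial>lpos)"
      by (rule lpos2.Fubini_product_bound[OF m3 integrable_mult_left[OF integrable_norm[OF f1]] integrable_norm[OF di] bd3], assumption+)+
    have I3: "(\<integral>x. ?l x t \<partial>lpos) = of_real (gauss_sinh_dual \<alpha> p t) * hankel_sinh \<alpha> f t" for t
      unfolding hankel_sinh_def integral_mult_right_zero[symmetric] by (simp only: of_real_mult mult_ac)
    have I3': "(\<integral>t. ?l x t \<partial>lpos) = 1 / 2 * (?w1 x * f x)" if x: "x > 0" for x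
      unfolding integral_mult_right_zero hankel_gauss_sinh_dual[OF a0 p0 x] by (simp only: mult_ac)
    have fi: "integrable lpos (\<lambda>x. 1 / 2 * (?w1 x * f x))" using F3(1) by (subst (asm) integrable_cong_lpos[OF I3'])
    have fi': "integrable lpos (\<lambda>x. ?w1 x * f x)" using integrable_mult_right[OF fi, of 2] by simp
    have fv: "(\<integral>x. ?w1 x * f x \<partial>lpos) = 2 * (\<integral>t. of_real (gauss_sinh_dual \<alpha> p t) * hankel_sinh \<alpha> f t \<partial>lpos)"
    proof -
      have "(\<integral>x. (\<integral>t. ?l x t \<partial>lpos) \<partial>lpos) = (\<integral>x. 1 / 2 * (?w1 x * f x) \<partial>lpos)"
        by (rule integral_cong_lpos) (rule I3')
      then have "1 / 2 * (\<integral>x. ?w1 x * f x \<partial>lpos) = (\<integral>t. of_real (gauss_sinh_dual \<alpha> p t) * hankel_sinh \<alpha> f t \<partial>lpos)"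
        using F3(2) unfolding I3 integral_mult_right_zero by (simp only:)
      then show ?thesis by (simp add: field_simps)
    qed
    have Ri: "integrable lpos (\<lambda>x. ?w1 x * R x)"
      using integrable_mult_right[OF F1(1), of "of_real (4 / pi)"] by (subst integrable_cong_lpos[OF R1])
    have Rv: "(\<integral>x. ?w1 x * R x \<partial>lpos) = 2 * (\<integral>t. of_real (gauss_sinh_dual \<alpha> p t) * hankel_sinh \<alpha> f t \<partial>lpos)"
    proof -
      have "(\<integral>x. ?w1 x * R x \<partial>lpos) = (\<integral>x. of_real (4 / pi) * (\<integral>\<tau>. ?g x \<tau> \<partial>lpos) \<partial>lpos)"
        by (rule integral_cong_lpos) (rule R1)
      also have "\<dots> = of_real (4 / pi) * (\<integral>x. (\<integral>\<tau>. ?g x \<tau> \<partial>lpos) \<partial>lpos)"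
        by (rule integral_mult_right_zero)
      also have "\<dots> = of_real (4 / pi) * (2 * (\<integral>\<tau>. (\<integral>t. ?k \<tau> t \<partial>lpos) \<partial>lpos))"
        unfolding F1(2) I1 by (simp only: integral_mult_right_zero[where c = 2])
      also have "(\<integral>\<tau>. (\<integral>t. ?k \<tau> t \<partial>lpos) \<partial>lpos) = (\<integral>t. of_real (pi / 4) * (of_real (gauss_sinh_dual \<alpha> p t) * hankel_sinh \<alpha> f t) \<partial>lpos)"
        unfolding F2 I2 by (simp only: mult_ac)
      also have "\<dots> = of_real (pi / 4) * (\<integral>t. of_real (gauss_sinh_dual \<alpha> p t) * hankel_sinh \<alpha> f t \<partial>lpos)"
        by (rule integral_mult_right_zero)
      finally show ?thesis by simp
    qed
    have eq: "of_real (exp (- (p * x))) * ?G x = ?w1 x * f x - ?w1 x * R x" for x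
      by (simp only: right_diff_distrib mult.assoc)
    show ?thesis unfolding eq using fi' Ri fv Rv
      by (simp only: Bochner_Integration.integrable_diff Bochner_Integration.integral_diff diff_self simp_thms)
  qed
  have "AE x in lpos. ?G x = 0" by (rule laplace_unique) (use L in auto)
  then show "AE x in lpos. f x = R x" by eventually_elim simp
qed

section \<open>From the function spaces to the inversion formula\<close>

text \<open>
  The theorem is stated for Lebesgue measurable functions. Up to null sets they are Borel functions, for which the
  results above apply.
\<close>

lemma lebesgue_integral_lpos:
  fixes f :: "real \<Rightarrow> 'a::euclidean_space"
  assumes "f \<in> borel_measurable lpos"
  shows "set_lebesgue_integral lebesgue {0<..} f = integral\<^sup>L lpos f"
proof -
  have m: "(\<lambda>x. indicator {0<..} x *\<^sub>R f x) \<in> borel_measurable lborel"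
    using assms unfolding lpos_def by (subst (asm) borel_measurable_restrict_space_iff) auto
  show ?thesis
    unfolding integral_lpos set_lebesgue_integral_def using m by (simp add: integral_completion)
qed

lemma powr_splice_integrable:
  assumes \<eta>: "\<eta> > 0"
  shows "integrable lpos (\<lambda>x. if x \<le> 1 then x powr (\<eta> - 1) else x powr (- \<eta> - 1))"
proof -
  have m: "(\<lambda>x::real. if x \<le> 1 then x powr (\<eta> - 1) else 0) \<in> borel_measurable lpos"
       "(\<lambda>x::real. if x \<le> 1 then 0 else x powr (- \<eta> - 1)) \<in> borel_measurable lpos"
    by (rule measurable_lposI, measurable)+
  have 1: "integrable lpos (\<lambda>x. if x \<le> 1 then x powr (\<eta> - 1) else 0)"
  proof (rule integrable_lpos_bound[OF _ m(1)])
    show "integrable lpos (\<lambda>x. exp 1 * (exp (- x) * x powr (\<eta> - 1)))"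
      by (rule integrable_mult_right[OF exp_powr_integrable[OF \<eta>]])
    fix x :: real assume "x > 0"
    have "1 * x powr (\<eta> - 1) \<le> exp (1 - x) * x powr (\<eta> - 1)" if "x \<le> 1"
      using that by (intro mult_right_mono) auto
    then show "norm (if x \<le> 1 then x powr (\<eta> - 1) else 0) \<le> exp 1 * (exp (- x) * x powr (\<eta> - 1))"
      by (auto simp: exp_diff exp_minus field_simps)
  qed
  have "(\<lambda>x. x powr (- \<eta> - 1)) absolutely_integrable_on {1..}"
    using has_integral_powr_to_inf[of "- \<eta> - 1" 1] \<eta>
    by (intro nonnegative_absolutely_integrable_1) (auto simp: has_integral_iff)
  then have "set_integrable lborel {1..} (\<lambda>x. x powr (- \<eta> - 1))"
    unfolding set_integrable_def by (subst (asm) integrable_completion) auto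
  then have "integrable lborel (\<lambda>x. indicator {1..} x * x powr (- \<eta> - 1))" by (simp add: set_integrable_def)
  then have "integrable lborel (\<lambda>x. indicator {0<..} x *\<^sub>R (if x \<le> 1 then 0 else x powr (- \<eta> - 1)))"
    by (rule Bochner_Integration.integrable_bound) (auto simp: indicator_def)
  then have 2: "integrable lpos (\<lambda>x. if x \<le> 1 then 0 else x powr (- \<eta> - 1))"
    by (simp add: integrable_lpos_iff set_integrable_def)
  have "(\<lambda>x. (if x \<le> 1 then x powr (\<eta> - 1) else 0) + (if x \<le> 1 then 0 else x powr (- \<eta> - 1))) =
     (\<lambda>x::real. if x \<le> 1 then x powr (\<eta> - 1) else x powr (- \<eta> - 1))" by auto
  with Bochner_Integration.integrable_add[OF 1 2] show ?thesis by simp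
qed

text \<open>
  Near 0 the lower weight exponent is used and near infinity the upper one. Either $g\,x^c\le x^e$, or
  $g\,x^{c-e}>1$ and a \<open>p\<close>-th power only increases it; this replaces Hoelder's inequality.
\<close>

lemma weighted_L1_of_Lp:
  fixes g :: "real \<Rightarrow> real"
  assumes [measurable]: "g \<in> borel_measurable borel" and g0: "\<And>x. g x \<ge> 0" and p: "p > 1" and \<eta>: "\<eta> > 0"
    and lo: "integrable lpos (\<lambda>x. g x powr p * x powr ((c - \<eta>) * p - 1))"
    and hi: "integrable lpos (\<lambda>x. g x powr p * x powr ((c + \<eta>) * p - 1))"
  shows "integrable lpos (\<lambda>x. g x * x powr (c - 1))"
proof (rule integrable_lpos_bound)
  show "integrable lpos (\<lambda>x. (if x \<le> 1 then x powr (\<eta> - 1) else x powr (- \<eta> - 1)) +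
      (g x powr p * x powr ((c - \<eta>) * p - 1) + g x powr p * x powr ((c + \<eta>) * p - 1)))"
    by (intro Bochner_Integration.integrable_add powr_splice_integrable \<eta> lo hi)
  show "(\<lambda>x. g x * x powr (c - 1)) \<in> borel_measurable lpos" by (rule measurable_lposI) measurable
  fix x :: real assume x: "x > 0"
  have *: "g x * x powr (c - 1) \<le> x powr (e - 1) + g x powr p * x powr ((c - e) * p + e - 1)" for e
  proof (cases "g x * x powr c \<le> x powr e")
    case True
    then have "g x * x powr c / x \<le> x powr e / x" using x by (intro divide_right_mono) auto
    then have "g x * x powr (c - 1) \<le> x powr (e - 1)" using x by (simp add: powr_diff)
    moreover have "0 \<le> g x powr p * x powr ((c - e) * p + e - 1)" by simp
    ultimately show ?thesis by linarith
  next
    case False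
    define G where "G = g x * x powr (c - e)"
    have "x powr (c - e) * x powr e = x powr c" by (simp flip: powr_add)
    then have Gx: "g x * x powr c = G * x powr e" by (simp add: G_def mult.assoc)
    have G1: "G > 1" using False x unfolding Gx by (simp add: not_le)
    have "G powr 1 \<le> G powr p" using G1 p by (intro powr_mono) auto
    then have "G * x powr (e - 1) \<le> G powr p * x powr (e - 1)" using G1 by (intro mult_right_mono) auto
    moreover have "G * x powr (e - 1) = g x * x powr (c - 1)"
      unfolding G_def mult.assoc powr_add[symmetric] by simp
    moreover have "G powr p * x powr (e - 1) = g x powr p * x powr ((c - e) * p + e - 1)"
      unfolding G_def using g0[of x] x by (simp add: powr_mult powr_powr mult.assoc add_diff_eq flip: powr_add)
    moreover have "0 \<le> x powr (e - 1)" by simp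
    ultimately show ?thesis by linarith
  qed
  have "g x * x powr (c - 1) \<le> (if x \<le> 1 then x powr (\<eta> - 1) else x powr (- \<eta> - 1)) +
      (g x powr p * x powr ((c - \<eta>) * p - 1) + g x powr p * x powr ((c + \<eta>) * p - 1))"
  proof (cases "x \<le> 1")
    case True
    have "x powr ((c - \<eta>) * p + \<eta> - 1) \<le> x powr ((c - \<eta>) * p - 1)"
      using True x \<eta> by (intro powr_mono') auto
    then have "g x powr p * x powr ((c - \<eta>) * p + \<eta> - 1) \<le> g x powr p * x powr ((c - \<eta>) * p - 1)"
      by (intro mult_left_mono) auto
    moreover have "0 \<le> g x powr p * x powr ((c + \<eta>) * p - 1)" by simp
    ultimately show ?thesis using *[of \<eta>] True unfolding if_P[OF True] by linarith
  next
    case False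
    have "x powr ((c - - \<eta>) * p + - \<eta> - 1) \<le> x powr ((c + \<eta>) * p - 1)"
      using False \<eta> by (intro powr_mono) auto
    then have "g x powr p * x powr ((c - - \<eta>) * p + - \<eta> - 1) \<le> g x powr p * x powr ((c + \<eta>) * p - 1)"
      by (intro mult_left_mono) auto
    moreover have "0 \<le> g x powr p * x powr ((c - \<eta>) * p - 1)" by simp
    ultimately show ?thesis using *[of "- \<eta>"] False unfolding if_not_P[OF False] by linarith
  qed
  then show "norm (g x * x powr (c - 1)) \<le> (if x \<le> 1 then x powr (\<eta> - 1) else x powr (- \<eta> - 1)) +
      (g x powr p * x powr ((c - \<eta>) * p - 1) + g x powr p * x powr ((c + \<eta>) * p - 1))"
    using g0[of x] by (simp add: abs_mult)
qed

lemma ex_borel_representative: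
  fixes f :: "real \<Rightarrow> complex"
  assumes "set_borel_measurable lebesgue {0<..} f"
  shows "\<exists>f0. f0 \<in> borel_measurable borel \<and> (AE x in lborel. x > 0 \<longrightarrow> f x = f0 x)"
proof -
  let ?f = "\<lambda>x. indicator {0<..} x *\<^sub>R f x"
  have m: "?f \<in> borel_measurable lebesgue" using assms by (simp add: set_borel_measurable_def)
  have "(\<lambda>x. Re (?f x)) \<in> borel_measurable lebesgue" "(\<lambda>x. Im (?f x)) \<in> borel_measurable lebesgue"
    using m by measurable
  from this[THEN completion_ex_borel_measurable_real]
  obtain g1 g2 where g: "g1 \<in> borel_measurable lborel" "g2 \<in> borel_measurable lborel"
    and ae: "AE x in lborel. Re (?f x) = g1 x" "AE x in lborel. Im (?f x) = g2 x" by blast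
  have "(\<lambda>x. Complex (g1 x) (g2 x)) \<in> borel_measurable borel" using g by measurable
  moreover have "AE x in lborel. x > 0 \<longrightarrow> f x = Complex (g1 x) (g2 x)"
    using ae by eventually_elim (auto simp: complex_eq_iff)
  ultimately show ?thesis by blast
qed

lemma set_integrable_lebesgue_cong_AE:
  fixes k k' :: "real \<Rightarrow> real"
  assumes k: "set_integrable lebesgue {0<..} k" and k': "k' \<in> borel_measurable borel"
    and ae: "AE x in lborel. x > 0 \<longrightarrow> k x = k' x"
  shows "integrable lpos k'"
proof -
  have "integrable lebesgue (\<lambda>x. indicator {0<..} x *\<^sub>R k' x)"
  proof (rule integrable_cong_AE_imp)
    show "integrable lebesgue (\<lambda>x. indicator {0<..} x *\<^sub>R k x)" using k by (simp add: set_integrable_def)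
    have "(\<lambda>x. indicator {0<..} x *\<^sub>R k' x) \<in> borel_measurable lborel" using k' by measurable
    then show "(\<lambda>x. indicator {0<..} x *\<^sub>R k' x) \<in> borel_measurable lebesgue" by (rule measurable_completion)
    show "AE x in lebesgue. indicator {0<..} x *\<^sub>R k x = indicator {0<..} x *\<^sub>R k' x"
      using AE_completion[OF ae] by eventually_elim (auto simp: indicator_def)
  qed
  then show ?thesis using measurable_lposI[OF k'] lpos_absolutely_integrable[of k'] by (simp add: set_integrable_def)
qed

theorem theorem2:
  fixes \<alpha> p :: real and f :: "real \<Rightarrow> complex" and fs :: "complex \<Rightarrow> complex"
  assumes "\<alpha> > 1/4" and "1 < p" and "p \<le> 2"
    and "\<And>\<nu>. 1 - \<nu> \<in> {0<..<\<alpha> + 1} \<Longrightarrow> mem_L (1 - \<nu>) p f"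
    and "\<And>\<nu>. 1 - \<nu> \<in> {0<..<\<alpha> + 1} \<Longrightarrow> is_mellin_transform_on_line p f (1 - \<nu>) fs"
    and "\<And>\<nu>. 1 - \<nu> \<in> {0<..<\<alpha> + 1} \<Longrightarrow> integrable lebesgue (\<lambda>t. fs (Complex (1 - \<nu>) t))"
    and "fs analytic_on {s. Re s \<in> {0<..<\<alpha> + 1}}"
    and "mem_weighted_L1 (\<lambda>\<tau>. \<tau> * exp (2 * pi * \<tau>)) (index_transform \<alpha> f)"
  shows "\<exists>g. continuous_on {0<..} g \<and>
           (AE x in lebesgue. x > 0 \<longrightarrow> f x = g x) \<and>
           (\<forall>x>0.
              set_integrable lebesgue {0<..}
                (\<lambda>\<tau>. of_real (inversion_kernel \<alpha> \<tau> x * cosh (pi * \<tau>)) * index_transform \<alpha> f \<tau>) \<and>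
              g x = - of_real (4 / (pi * sqrt pi)) *
                (LINT \<tau>:{0<..}|lebesgue.
                   of_real (inversion_kernel \<alpha> \<tau> x * cosh (pi * \<tau>)) * index_transform \<alpha> f \<tau>))"
proof -
  note \<alpha> = assms(1)
  have a0: "\<alpha> > 0" using \<alpha> by simp
  have memL: "mem_L c p f" if "0 < c" "c < \<alpha> + 1" for c
    using assms(4)[of "1 - c"] that by simp
  have "set_borel_measurable lebesgue {0<..} f" using memL[of 1] a0 by (simp add: mem_L_def)
  then obtain f0 where f0: "f0 \<in> borel_measurable borel" and ff0: "AE x in lborel. x > 0 \<longrightarrow> f x = f0 x"
    using ex_borel_representative by blast
  note [measurable] = f0
  have Lp: "integrable lpos (\<lambda>x. norm (f0 x) powr p * x powr (c * p - 1))" if "0 < c" "c < \<alpha> + 1" for c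
  proof (rule set_integrable_lebesgue_cong_AE)
    show "set_integrable lebesgue {0<..} (\<lambda>x. norm (f x) powr p * x powr (c * p - 1))"
      using memL[OF that] by (simp add: mem_L_def)
    show "(\<lambda>x. norm (f0 x) powr p * x powr (c * p - 1)) \<in> borel_measurable borel" by measurable
    show "AE x in lborel. x > 0 \<longrightarrow> norm (f x) powr p * x powr (c * p - 1) = norm (f0 x) powr p * x powr (c * p - 1)"
      using ff0 by eventually_elim auto
  qed
  \<comment> \<open>The exponents \<open>3/4\<close> and \<open>1\<close>, with a margin of \<open>1/8\<close>, stay below \<open>5/4 < \<alpha> + 1\<close>.\<close>
  have L1: "integrable lpos (\<lambda>x. norm (f0 x) * x powr (c - 1))" if "c \<in> {3/4, 1}" for c
    by (rule weighted_L1_of_Lp[where p = p and \<eta> = "1/8"])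
       (use that \<alpha> assms(2) in \<open>auto intro!: Lp borel_measurable_norm f0\<close>)
  have f1: "integrable lpos f0"
  proof (rule integrable_lpos_bound[OF L1[of 1]])
    show "f0 \<in> borel_measurable lpos" by (rule measurable_lposI[OF f0])
  qed auto
  have f34: "integrable lpos (\<lambda>x. norm (f0 x) * x powr (- (1/4)))" using L1[of "3/4"] by simp
  have hc: "continuous_on UNIV (hankel_sinh \<alpha> f0)" by (rule hankel_sinh_bounded_continuous(2)[OF \<alpha> f0 f1])
  have hi: "integrable lpos (hankel_sinh \<alpha> f0)" by (rule hankel_sinh_integrable_and_transform(1)[OF \<alpha> f0 f34])
  have Pm [measurable]: "cos_hankel \<alpha> f0 \<in> borel_measurable borel" by (rule cos_hankel_measurable[OF hc])
  have F: "index_transform \<alpha> f \<tau> = of_real (2 * sqrt pi / cosh (pi * \<tau>)) * cos_hankel \<alpha> f0 \<tau>" if \<tau>: "\<tau> > 0" for \<tau>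
  proof -
    have [measurable]: "KI \<alpha> \<tau> \<in> borel_measurable lpos" using \<tau> by (intro KI_measurable_lpos a0) simp
    have Km: "(\<lambda>x. complex_of_real (Re (KI \<alpha> \<tau> x))) \<in> borel_measurable lpos" by measurable
    have fm: "f0 \<in> borel_measurable lpos" by (rule measurable_lposI[OF f0])
    have m0: "(\<lambda>x. of_real (Re (KI \<alpha> \<tau> x)) * f0 x) \<in> borel_measurable lpos" using Km fm by measurable
    have "(\<lambda>x. indicator {0<..} x *\<^sub>R complex_of_real (Re (KI \<alpha> \<tau> x))) \<in> borel_measurable lborel"
      using Km unfolding lpos_def by (subst (asm) borel_measurable_restrict_space_iff) auto
    then have m1: "(\<lambda>x. indicator {0<..} x *\<^sub>R complex_of_real (Re (KI \<alpha> \<tau> x))) \<in> borel_measurable lebesgue"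
      by (rule measurable_completion)
    have m2: "(\<lambda>x. indicator {0<..} x *\<^sub>R f x) \<in> borel_measurable lebesgue"
      using memL[of 1] a0 by (simp add: mem_L_def set_borel_measurable_def)
    have m3: "(\<lambda>x. indicator {0<..} x *\<^sub>R (of_real (Re (KI \<alpha> \<tau> x)) * f x)) \<in> borel_measurable lebesgue"
    proof -
      have "(\<lambda>x. indicator {0<..} x *\<^sub>R (complex_of_real (Re (KI \<alpha> \<tau> x)) * f x)) =
        (\<lambda>x. (indicator {0<..} x *\<^sub>R complex_of_real (Re (KI \<alpha> \<tau> x))) * (indicator {0<..} x *\<^sub>R f x))"
        by (auto simp: indicator_def)
      then show ?thesis using m1 m2 by (simp only: borel_measurable_times)
    qed
    have m4: "(\<lambda>x. indicator {0<..} x *\<^sub>R (of_real (Re (KI \<alpha> \<tau> x)) * f0 x)) \<in> borel_measurable lebesgue"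
      using m0 unfolding lpos_def
      by (subst (asm) borel_measurable_restrict_space_iff) (auto intro: measurable_completion)
    have "(LINT x:{0<..}|lebesgue. of_real (Re (KI \<alpha> \<tau> x)) * f x) = (LINT x:{0<..}|lebesgue. of_real (Re (KI \<alpha> \<tau> x)) * f0 x)"
      unfolding set_lebesgue_integral_def
    proof (rule integral_cong_AE[OF m3 m4])
      show "AE x in lebesgue. indicator {0<..} x *\<^sub>R (of_real (Re (KI \<alpha> \<tau> x)) * f x) = indicator {0<..} x *\<^sub>R (of_real (Re (KI \<alpha> \<tau> x)) * f0 x)"
        using AE_completion[OF ff0] by eventually_elim (auto simp: indicator_def)
    qed
    also have "\<dots> = cos_hankel \<alpha> f0 \<tau>"
      using lebesgue_integral_lpos[OF m0] hankel_sinh_integrable_and_transform(2)[OF \<alpha> f0 f34, of \<tau>] \<tau> by simp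
    finally show ?thesis by (simp add: index_transform_def)
  qed
  have cosh_le: "cosh (pi * \<tau>) \<le> exp (pi * \<tau>)" if "\<tau> > 0" for \<tau>
    using that by (simp add: cosh_field_def)
  have W: "integrable lpos (\<lambda>\<tau>. norm (of_real (2 * sqrt pi / cosh (pi * \<tau>)) * cos_hankel \<alpha> f0 \<tau>) * (\<tau> * exp (2 * pi * \<tau>)))"
  proof (rule set_integrable_lebesgue_cong_AE)
    show "set_integrable lebesgue {0<..} (\<lambda>\<tau>. norm (index_transform \<alpha> f \<tau>) * (\<tau> * exp (2 * pi * \<tau>)))"
      using assms(8) by (simp add: mem_weighted_L1_def)
    show "AE \<tau> in lborel. \<tau> > 0 \<longrightarrow> norm (index_transform \<alpha> f \<tau>) * (\<tau> * exp (2 * pi * \<tau>)) =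
        norm (of_real (2 * sqrt pi / cosh (pi * \<tau>)) * cos_hankel \<alpha> f0 \<tau>) * (\<tau> * exp (2 * pi * \<tau>))"
      by (rule AE_I2) (simp add: F)
  qed measurable
  define H where "H = (\<integral>t. norm (hankel_sinh \<alpha> f0 t) \<partial>lpos)"
  have PH: "norm (cos_hankel \<alpha> f0 \<tau>) \<le> H" for \<tau>
    unfolding cos_hankel_def H_def
  proof (rule Bochner_Integration.integral_norm_bound_integral)
    have [measurable]: "hankel_sinh \<alpha> f0 \<in> borel_measurable borel" using hc by (rule borel_measurable_continuous_onI)
    show "integrable lpos (\<lambda>t. norm (hankel_sinh \<alpha> f0 t))" by (rule integrable_norm[OF hi])
    have bd: "norm (of_real (cos (2 * \<tau> * t)) * hankel_sinh \<alpha> f0 t) \<le> norm (hankel_sinh \<alpha> f0 t)" for t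
      by (simp add: norm_mult mult_left_le_one_le)
    then show "norm (of_real (cos (2 * \<tau> * t)) * hankel_sinh \<alpha> f0 t) \<le> norm (hankel_sinh \<alpha> f0 t)" for t .
    show "integrable lpos (\<lambda>t. of_real (cos (2 * \<tau> * t)) * hankel_sinh \<alpha> f0 t)"
    proof (rule integrable_lpos_bound[OF integrable_norm[OF hi]])
      show "(\<lambda>t. of_real (cos (2 * \<tau> * t)) * hankel_sinh \<alpha> f0 t) \<in> borel_measurable lpos"
        by (rule measurable_lposI) measurable
    qed (rule bd)
  qed
  have H0: "H \<ge> 0" using PH[of 0] norm_ge_zero order_trans by blast
  \<comment> \<open>The weight \<open>\<tau> * exp (2 * pi * \<tau>)\<close> controls \<open>\<tau> > 1\<close>; it degenerates at 0, where boundedness is used instead.\<close>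
  have \<Phi>: "integrable lpos (\<lambda>\<tau>. norm (cos_hankel \<alpha> f0 \<tau>) * exp (pi * \<tau>))"
  proof (rule integrable_lpos_bound)
    have "integrable lpos (\<lambda>\<tau>. exp (- \<tau>))" using Gamma_laplace_one(1)[of 1] by simp
    then show "integrable lpos (\<lambda>\<tau>. norm (of_real (2 * sqrt pi / cosh (pi * \<tau>)) * cos_hankel \<alpha> f0 \<tau>) * (\<tau> * exp (2 * pi * \<tau>))
        + H * exp pi * exp 1 * exp (- \<tau>))"
      by (intro Bochner_Integration.integrable_add W integrable_mult_right)
    show "(\<lambda>\<tau>. norm (cos_hankel \<alpha> f0 \<tau>) * exp (pi * \<tau>)) \<in> borel_measurable lpos"
      by (rule measurable_lposI) measurable
    fix \<tau> :: real assume \<tau>: "\<tau> > 0"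
    have nn: "0 \<le> norm (of_real (2 * sqrt pi / cosh (pi * \<tau>)) * cos_hankel \<alpha> f0 \<tau>) * (\<tau> * exp (2 * pi * \<tau>))"
        "0 \<le> H * exp pi * exp 1 * exp (- \<tau>)" using \<tau> H0 by auto
    have "norm (cos_hankel \<alpha> f0 \<tau>) * exp (pi * \<tau>) \<le> norm (of_real (2 * sqrt pi / cosh (pi * \<tau>)) * cos_hankel \<alpha> f0 \<tau>) * (\<tau> * exp (2 * pi * \<tau>))
        + H * exp pi * exp 1 * exp (- \<tau>)"
    proof (cases "\<tau> \<le> 1")
      case True
      have "norm (cos_hankel \<alpha> f0 \<tau>) * exp (pi * \<tau>) \<le> H * exp pi"
        using PH[of \<tau>] True H0 by (intro mult_mono) auto
      also have "\<dots> \<le> (H * exp pi) * exp (1 - \<tau>)"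
        using True H0 mult_left_mono[of 1 "exp (1 - \<tau>)" "H * exp pi"] by simp
      also have "exp (1 - \<tau>) = exp 1 * exp (- \<tau>)" by (simp flip: exp_add)
      finally show ?thesis using nn(1) by (simp add: mult.assoc)
    next
      case False
      have c: "cosh (pi * \<tau>) > 0" by (rule cosh_real_pos)
      have "exp (pi * \<tau>) * cosh (pi * \<tau>) \<le> exp (pi * \<tau>) * exp (pi * \<tau>)"
        by (intro mult_left_mono cosh_le \<tau>) auto
      also have "\<dots> = 1 * exp (2 * pi * \<tau>)" by (simp flip: exp_add)
      also have "\<dots> \<le> (2 * sqrt pi * \<tau>) * exp (2 * pi * \<tau>)"
      proof (rule mult_right_mono)
        have "1 \<le> sqrt pi" using pi_ge_two by (intro real_sqrt_ge_one) linarith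
        then have "1 \<le> 2 * sqrt pi" by linarith
        then have "1 * 1 \<le> (2 * sqrt pi) * \<tau>" using False by (intro mult_mono) auto
        then show "1 \<le> 2 * sqrt pi * \<tau>" by simp
      qed simp
      finally have "exp (pi * \<tau>) \<le> 2 * sqrt pi / cosh (pi * \<tau>) * (\<tau> * exp (2 * pi * \<tau>))"
        using c by (simp add: field_simps)
      then have "norm (cos_hankel \<alpha> f0 \<tau>) * exp (pi * \<tau>) \<le> norm (cos_hankel \<alpha> f0 \<tau>) * (2 * sqrt pi / cosh (pi * \<tau>) * (\<tau> * exp (2 * pi * \<tau>)))"
        by (rule mult_left_mono) auto
      also have "\<dots> = norm (of_real (2 * sqrt pi / cosh (pi * \<tau>)) * cos_hankel \<alpha> f0 \<tau>) * (\<tau> * exp (2 * pi * \<tau>))"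
        using c unfolding norm_mult norm_of_real by simp
      finally show ?thesis using nn(2) by simp
    qed
    then show "norm (norm (cos_hankel \<alpha> f0 \<tau>) * exp (pi * \<tau>)) \<le> norm (of_real (2 * sqrt pi / cosh (pi * \<tau>)) * cos_hankel \<alpha> f0 \<tau>) * (\<tau> * exp (2 * pi * \<tau>))
        + H * exp pi * exp 1 * exp (- \<tau>)" by simp
  qed
  note T = transform_inversion[OF \<alpha> f0 f1 f34 \<Phi>]
  let ?R = "\<lambda>x. of_real (4 / (pi * x)) * (\<integral>\<tau>. of_real (Re (kernel_core \<alpha> \<tau> x)) * cos_hankel \<alpha> f0 \<tau> \<partial>lpos)"
  show ?thesis
  proof (intro exI[of _ ?R] conjI allI impI)
    show "continuous_on {0<..} ?R" by (rule T(4))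
    have "AE x in lborel. x > 0 \<longrightarrow> f x = ?R x"
      using ff0 T(5)[unfolded AE_lpos] by eventually_elim auto
    then show "AE x in lebesgue. x > 0 \<longrightarrow> f x = ?R x" by (rule AE_completion)
    fix x :: real assume x: "x > 0"
    let ?k = "\<lambda>\<tau>. of_real (sqrt pi / x) * (of_real \<alpha> * cos_hankel \<alpha> f0 \<tau> - of_real (Re (kernel_core \<alpha> \<tau> x)) * cos_hankel \<alpha> f0 \<tau>)"
    have e: "of_real (inversion_kernel \<alpha> \<tau> x * cosh (pi * \<tau>)) * index_transform \<alpha> f \<tau> = ?k \<tau>" if \<tau>: "\<tau> \<in> {0<..}" for \<tau>
    proof -
      have c: "cosh (pi * \<tau>) \<noteq> 0" using cosh_real_pos[of "pi * \<tau>"] by simp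
      have "of_real (inversion_kernel \<alpha> \<tau> x * cosh (pi * \<tau>)) * index_transform \<alpha> f \<tau> =
         of_real (inversion_kernel \<alpha> \<tau> x * cosh (pi * \<tau>) * (2 * sqrt pi / cosh (pi * \<tau>))) * cos_hankel \<alpha> f0 \<tau>"
        using F[of \<tau>] \<tau> by (simp only: greaterThan_iff of_real_mult mult.assoc)
      also have "inversion_kernel \<alpha> \<tau> x * cosh (pi * \<tau>) * (2 * sqrt pi / cosh (pi * \<tau>)) = sqrt pi / x * (\<alpha> - Re (kernel_core \<alpha> \<tau> x))"
        unfolding inversion_kernel_eq[OF a0 less_imp_neq[OF \<tau>[simplified], symmetric] x] using c x by (simp add: field_simps)
      finally show ?thesis by (simp only: of_real_mult of_real_diff mult.assoc left_diff_distrib)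
    qed
    have i: "integrable lpos ?k"
      using T(1) T(3)[OF x] by (intro integrable_mult_right Bochner_Integration.integrable_diff)
    have m: "?k \<in> borel_measurable lpos" using i by (rule borel_measurable_integrable)
    show "set_integrable lebesgue {0<..} (\<lambda>\<tau>. of_real (inversion_kernel \<alpha> \<tau> x * cosh (pi * \<tau>)) * index_transform \<alpha> f \<tau>)"
    proof (subst set_integrable_cong[OF refl refl])
      show "set_integrable lebesgue {0<..} ?k" using lpos_absolutely_integrable[OF m] i by (rule iffD1)
    qed (rule e)
    have "(LINT \<tau>:{0<..}|lebesgue. of_real (inversion_kernel \<alpha> \<tau> x * cosh (pi * \<tau>)) * index_transform \<alpha> f \<tau>) = integral\<^sup>L lpos ?k"
      unfolding lebesgue_integral_lpos[OF m, symmetric] by (intro set_lebesgue_integral_cong) (use e in auto)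
    also have "\<dots> = of_real (sqrt pi / x) * (of_real \<alpha> * (\<integral>\<tau>. cos_hankel \<alpha> f0 \<tau> \<partial>lpos) - (\<integral>\<tau>. of_real (Re (kernel_core \<alpha> \<tau> x)) * cos_hankel \<alpha> f0 \<tau> \<partial>lpos))"
      using T(1) T(3)[OF x]
      by (simp only: integral_mult_right_zero Bochner_Integration.integral_diff integrable_mult_right)
    also have "\<dots> = - (of_real (sqrt pi / x) * (\<integral>\<tau>. of_real (Re (kernel_core \<alpha> \<tau> x)) * cos_hankel \<alpha> f0 \<tau> \<partial>lpos))"
      unfolding T(2) by simp
    finally have V: "(LINT \<tau>:{0<..}|lebesgue. of_real (inversion_kernel \<alpha> \<tau> x * cosh (pi * \<tau>)) * index_transform \<alpha> f \<tau>) =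
        - (of_real (sqrt pi / x) * (\<integral>\<tau>. of_real (Re (kernel_core \<alpha> \<tau> x)) * cos_hankel \<alpha> f0 \<tau> \<partial>lpos))" .
    have "4 / (pi * x) = 4 / (pi * sqrt pi) * (sqrt pi / x)" by simp
    then show "?R x = - of_real (4 / (pi * sqrt pi)) * (LINT \<tau>:{0<..}|lebesgue. of_real (inversion_kernel \<alpha> \<tau> x * cosh (pi * \<tau>)) * index_transform \<alpha> f \<tau>)"
      unfolding V by (simp only: of_real_mult mult_minus_left mult_minus_right minus_minus mult.assoc)
  qed
qed

end
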